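(* Let $\widehat{\mathfrak{stl}}_3(R)=\mathcal U\oplus\mathfrak{stl}_3(R)$ with bracket $[(c,x),(c',y)]=(\psi(x,y),[x,y])$ and let $\pi$ be the projection onto $\mathfrak{stl}_3(R)$. Then $(\widehat{\mathfrak{stl}}_3(R),\pi)$ is the universal central extension of $\mathfrak{stl}_3(R)$ in the category of Leibniz algebras over $K$, and hence $HL_2(\mathfrak{stl}_3(R))\cong\mathcal U=R_3^6$.
   Context: $K$ unital commutative ring, $R$ unital associative $K$-algebra, free as $K$-module with basis containing $1$. Leibniz algebra: $K$-bilinear bracket with $[x,[y,z]]=[[x,y],z]-[[x,z],y]$. A central extension of a Leibniz algebra $L$ is a surjective homomorphism $\pi:\hat L\to L$ with central kernel that splits as a $K$-module map; it is universal if for every central extension $\tau:\tilde L\to L$ there is a unique homomorphism $\eta:\hat L\to\tilde L$ with $\tau\circ\eta=\pi$. $HL_2(L)$ is the second homology of the Leibniz complex $(L^{\otimes n},\delta)$, $\delta(x_1\otimes\cdots\otimes x_n)=\sum_{1\le i<j\le n}(-1)^{j+1}x_1\otimes\cdots\otimes x_{i-1}\otimes[x_i,x_j]\otimes x_{i+1}\otimes\cdots\widehat{x_j}\cdots\otimes x_n$. $\mathfrak{stl}_3(R)$: Leibniz algebra over $K$ generated by $X_{ij}(a)$, $a\in R$, $1\le i\ne j\le 3$, subject to $K$-linearity in $a$, $[X_{ij}(a),X_{jk}(b)]=X_{ik}(ab)$ and $[X_{ij}(a),X_{ki}(b)]=-X_{kj}(ba)$ for distinct $i,j,k$, $[X_{ij}(a),X_{kl}(b)]=0$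 for $j\ne k$, $i\ne l$. $H$ is the $K$-span of all $[X_{ij}(a),X_{ji}(b)]$; $\mathfrak{stl}_3(R)=H\oplus\bigoplus_{i\ne j}X_{ij}(R)$ with $a\mapsto X_{ij}(a)$ injective. $R_3=R/(3R+R[R,R])$, $\bar a$ the class of $a$. $\mathcal U=R_3^6$ with coordinates indexed by $\{1,2,3,-1,-2,-3\}$; $\bar a^{(m)}$ is the element with coordinate $\bar a$ at index $m$, $0$ elsewhere. $\mathrm{sign}(m,n)=1$ if $m<n$, $-1$ if $m>n$. $\psi$ is the $K$-bilinear map with $\psi(X_{ij}(a),X_{ik}(b))=\mathrm{sign}(j,k)(\overline{ab})^{(i)}$, $\psi(X_{ij}(a),X_{kj}(b))=\mathrm{sign}(i,k)(\overline{ab})^{(-j)}$ for distinct $i,j,k$, $\psi=0$ on all other pairs $X_{ij}(a),X_{kl}(b)$ and whenever an argument lies in $H$. *)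

theory Defs
  imports Complex_Main
begin

text \<open>A structure over the scalar ring 'k: carrier, addition, zero, negation,
  scalar multiplication and bracket (the bracket is ignored for plain modules).\<close>

record ('k, 'a) lalg =
  carr  :: "'a set"
  ladd  :: "'a \<Rightarrow> 'a \<Rightarrow> 'a"
  lzero :: "'a"
  lneg  :: "'a \<Rightarrow> 'a"
  lsmul :: "'k \<Rightarrow> 'a \<Rightarrow> 'a"
  lbr   :: "'a \<Rightarrow> 'a \<Rightarrow> 'a"

definition lsub :: "('k, 'a) lalg \<Rightarrow> 'a \<Rightarrow> 'a \<Rightarrow> 'a" where
  "lsub M x y = ladd M x (lneg M y)"

definition kmod :: "('k::comm_ring_1, 'a) lalg \<Rightarrow> bool" where
  "kmod M \<longleftrightarrow>
     lzero M \<in> carr M \<and>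
     (\<forall>x\<in>carr M. \<forall>y\<in>carr M. ladd M x y \<in> carr M) \<and>
     (\<forall>x\<in>carr M. lneg M x \<in> carr M) \<and>
     (\<forall>k. \<forall>x\<in>carr M. lsmul M k x \<in> carr M) \<and>
     (\<forall>x\<in>carr M. \<forall>y\<in>carr M. \<forall>z\<in>carr M. ladd M (ladd M x y) z = ladd M x (ladd M y z)) \<and>
     (\<forall>x\<in>carr M. \<forall>y\<in>carr M. ladd M x y = ladd M y x) \<and>
     (\<forall>x\<in>carr M. ladd M (lzero M) x = x) \<and>
     (\<forall>x\<in>carr M. ladd M (lneg M x) x = lzero M) \<and>
     (\<forall>k. \<forall>x\<in>carr M. \<forall>y\<in>carr M. lsmul M k (ladd M x y) = ladd M (lsmul M k x) (lsmul M k y)) \<and>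
     (\<forall>k l. \<forall>x\<in>carr M. lsmul M (k + l) x = ladd M (lsmul M k x) (lsmul M l x)) \<and>
     (\<forall>k l. \<forall>x\<in>carr M. lsmul M (k * l) x = lsmul M k (lsmul M l x)) \<and>
     (\<forall>x\<in>carr M. lsmul M 1 x = x)"

definition leibniz :: "('k::comm_ring_1, 'a) lalg \<Rightarrow> bool" where
  "leibniz L \<longleftrightarrow> kmod L \<and>
     (\<forall>x\<in>carr L. \<forall>y\<in>carr L. lbr L x y \<in> carr L) \<and>
     (\<forall>x\<in>carr L. \<forall>y\<in>carr L. \<forall>z\<in>carr L.
        lbr L (ladd L x y) z = ladd L (lbr L x z) (lbr L y z) \<and>
        lbr L x (ladd L y z) = ladd L (lbr L x y) (lbr L x z)) \<and>
     (\<forall>k. \<forall>x\<in>carr L. \<forall>y\<in>carr L.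
        lbr L (lsmul L k x) y = lsmul L k (lbr L x y) \<and>
        lbr L x (lsmul L k y) = lsmul L k (lbr L x y)) \<and>
     (\<forall>x\<in>carr L. \<forall>y\<in>carr L. \<forall>z\<in>carr L.
        lbr L x (lbr L y z) = lsub L (lbr L (lbr L x y) z) (lbr L (lbr L x z) y))"

definition linmap :: "('k::comm_ring_1, 'a) lalg \<Rightarrow> ('k, 'b) lalg \<Rightarrow> ('a \<Rightarrow> 'b) \<Rightarrow> bool" where
  "linmap M N f \<longleftrightarrow>
     (\<forall>x\<in>carr M. f x \<in> carr N) \<and>
     (\<forall>x\<in>carr M. \<forall>y\<in>carr M. f (ladd M x y) = ladd N (f x) (f y)) \<and>
     (\<forall>k. \<forall>x\<in>carr M. f (lsmul M k x) = lsmul N k (f x))"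

definition lhom :: "('k::comm_ring_1, 'a) lalg \<Rightarrow> ('k, 'b) lalg \<Rightarrow> ('a \<Rightarrow> 'b) \<Rightarrow> bool" where
  "lhom L M f \<longleftrightarrow> linmap L M f \<and>
     (\<forall>x\<in>carr L. \<forall>y\<in>carr L. f (lbr L x y) = lbr M (f x) (f y))"

definition bilin :: "('k::comm_ring_1, 'a) lalg \<Rightarrow> ('k, 'b) lalg \<Rightarrow> ('k, 'c) lalg
    \<Rightarrow> ('a \<Rightarrow> 'b \<Rightarrow> 'c) \<Rightarrow> bool" where
  "bilin A B C p \<longleftrightarrow>
     (\<forall>x\<in>carr A. \<forall>y\<in>carr B. p x y \<in> carr C) \<and>
     (\<forall>x\<in>carr A. \<forall>x'\<in>carr A. \<forall>y\<in>carr B. p (ladd A x x') y = ladd C (p x y) (p x' y)) \<and>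
     (\<forall>x\<in>carr A. \<forall>y\<in>carr B. \<forall>y'\<in>carr B. p x (ladd B y y') = ladd C (p x y) (p x y')) \<and>
     (\<forall>k. \<forall>x\<in>carr A. \<forall>y\<in>carr B. p (lsmul A k x) y = lsmul C k (p x y) \<and>
                                     p x (lsmul B k y) = lsmul C k (p x y))"

definition kmod_iso :: "('k::comm_ring_1, 'a) lalg \<Rightarrow> ('k, 'b) lalg \<Rightarrow> ('a \<Rightarrow> 'b) \<Rightarrow> bool" where
  "kmod_iso M N f \<longleftrightarrow> linmap M N f \<and> bij_betw f (carr M) (carr N)"

definition submodule :: "('k::comm_ring_1, 'a) lalg \<Rightarrow> 'a set \<Rightarrow> bool" where
  "submodule M N \<longleftrightarrow> N \<subseteq> carr M \<and> lzero M \<in> N \<and>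
     (\<forall>x\<in>N. \<forall>y\<in>N. ladd M x y \<in> N) \<and> (\<forall>x\<in>N. lneg M x \<in> N) \<and>
     (\<forall>k. \<forall>x\<in>N. lsmul M k x \<in> N)"

definition lspan :: "('k::comm_ring_1, 'a) lalg \<Rightarrow> 'a set \<Rightarrow> 'a set" where
  "lspan M S = \<Inter>{N. submodule M N \<and> S \<subseteq> N}"

definition lideal :: "('k::comm_ring_1, 'a) lalg \<Rightarrow> 'a set \<Rightarrow> bool" where
  "lideal M N \<longleftrightarrow> submodule M N \<and>
     (\<forall>x\<in>N. \<forall>y\<in>carr M. lbr M x y \<in> N \<and> lbr M y x \<in> N)"

definition ideal_gen :: "('k::comm_ring_1, 'a) lalg \<Rightarrow> 'a set \<Rightarrow> 'a set" where
  "ideal_gen M S = \<Inter>{N. lideal M N \<and> S \<subseteq> N}"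

definition lcoset :: "('k, 'a) lalg \<Rightarrow> 'a set \<Rightarrow> 'a \<Rightarrow> 'a set" where
  "lcoset M N x = {ladd M x n | n. n \<in> N}"

definition rep :: "'a set \<Rightarrow> 'a" where
  "rep A = (SOME x. x \<in> A)"

definition quot :: "('k, 'a) lalg \<Rightarrow> 'a set \<Rightarrow> ('k, 'a set) lalg" where
  "quot M N = \<lparr> carr = {lcoset M N x | x. x \<in> carr M},
      ladd = (\<lambda>A B. lcoset M N (ladd M (rep A) (rep B))),
      lzero = lcoset M N (lzero M),
      lneg = (\<lambda>A. lcoset M N (lneg M (rep A))),
      lsmul = (\<lambda>k A. lcoset M N (lsmul M k (rep A))),
      lbr = (\<lambda>A B. lcoset M N (lbr M (rep A) (rep B))) \<rparr>"

definition restr :: "('k, 'a) lalg \<Rightarrow> 'a set \<Rightarrow> ('k, 'a) lalg" where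
  "restr M S = M\<lparr>carr := S\<rparr>"

definition ind :: "'x \<Rightarrow> 'x \<Rightarrow> 'k::comm_ring_1" where
  "ind x = (\<lambda>y. if y = x then 1 else 0)"

definition free_mod :: "'x set \<Rightarrow> ('k::comm_ring_1, 'x \<Rightarrow> 'k) lalg" where
  "free_mod X = \<lparr> carr = {f. finite {x. f x \<noteq> 0} \<and> {x. f x \<noteq> 0} \<subseteq> X},
      ladd = (\<lambda>f g x. f x + g x), lzero = (\<lambda>x. 0), lneg = (\<lambda>f x. - f x),
      lsmul = (\<lambda>k f x. k * f x), lbr = (\<lambda>f g x. 0) \<rparr>"

definition tensor_rel :: "('k::comm_ring_1, 'a) lalg \<Rightarrow> ('k, 'b) lalg \<Rightarrow> ('a \<times> 'b \<Rightarrow> 'k) set" where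
  "tensor_rel M N =
     {(\<lambda>t. ind (ladd M m m', n) t - ind (m, n) t - ind (m', n) t) | m m' n.
         m \<in> carr M \<and> m' \<in> carr M \<and> n \<in> carr N} \<union>
     {(\<lambda>t. ind (m, ladd N n n') t - ind (m, n) t - ind (m, n') t) | m n n'.
         m \<in> carr M \<and> n \<in> carr N \<and> n' \<in> carr N} \<union>
     {(\<lambda>t. ind (lsmul M k m, n) t - k * ind (m, n) t) | k m n.
         m \<in> carr M \<and> n \<in> carr N} \<union>
     {(\<lambda>t. ind (m, lsmul N k n) t - k * ind (m, n) t) | k m n.
         m \<in> carr M \<and> n \<in> carr N}"

definition tensor :: "('k::comm_ring_1, 'a) lalg \<Rightarrow> ('k, 'b) lalg \<Rightarrow> ('k, ('a \<times> 'b \<Rightarrow> 'k) set) lalg" where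
  "tensor M N = quot (free_mod (carr M \<times> carr N))
                     (lspan (free_mod (carr M \<times> carr N)) (tensor_rel M N))"

definition tmul :: "('k::comm_ring_1, 'a) lalg \<Rightarrow> ('k, 'b) lalg \<Rightarrow> 'a \<Rightarrow> 'b \<Rightarrow> ('a \<times> 'b \<Rightarrow> 'k) set" where
  "tmul M N m n = lcoset (free_mod (carr M \<times> carr N))
                     (lspan (free_mod (carr M \<times> carr N)) (tensor_rel M N)) (ind (m, n))"

text \<open>Differentials of the Leibniz complex in degrees 2 and 3:
  d(x1 \<otimes> x2) = -[x1,x2],
  d(x1 \<otimes> x2 \<otimes> x3) = -[x1,x2] \<otimes> x3 + [x1,x3] \<otimes> x2 + x1 \<otimes> [x2,x3].
  They are the (unique) K-linear maps with these values on pure tensors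
  (L^{\<otimes>3} is realised as (L \<otimes> L) \<otimes> L).\<close>

definition leib_d2 :: "('k::comm_ring_1, 'a) lalg \<Rightarrow> ('a \<times> 'a \<Rightarrow> 'k) set \<Rightarrow> 'a" where
  "leib_d2 L = (SOME f. linmap (tensor L L) L f \<and>
      (\<forall>x\<in>carr L. \<forall>y\<in>carr L. f (tmul L L x y) = lneg L (lbr L x y)))"

definition leib_d3 :: "('k::comm_ring_1, 'a) lalg \<Rightarrow> (('a \<times> 'a \<Rightarrow> 'k) set \<times> 'a \<Rightarrow> 'k) set
    \<Rightarrow> ('a \<times> 'a \<Rightarrow> 'k) set" where
  "leib_d3 L = (SOME f. linmap (tensor (tensor L L) L) (tensor L L) f \<and>
      (\<forall>x\<in>carr L. \<forall>y\<in>carr L. \<forall>z\<in>carr L.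
         f (tmul (tensor L L) L (tmul L L x y) z) =
           ladd (tensor L L)
             (ladd (tensor L L) (lneg (tensor L L) (tmul L L (lbr L x y) z))
                                 (tmul L L (lbr L x z) y))
             (tmul L L x (lbr L y z))))"

definition HL2 :: "('k::comm_ring_1, 'a) lalg \<Rightarrow> ('k, ('a \<times> 'a \<Rightarrow> 'k) set set) lalg" where
  "HL2 L = quot (restr (tensor L L) {t \<in> carr (tensor L L). leib_d2 L t = lzero L})
                (leib_d3 L ` carr (tensor (tensor L L) L))"

definition central_ext :: "('k::comm_ring_1, 'a) lalg \<Rightarrow> ('k, 'b) lalg \<Rightarrow> ('b \<Rightarrow> 'a) \<Rightarrow> bool" where
  "central_ext L E p \<longleftrightarrow> leibniz L \<and> leibniz E \<and> lhom E L p \<and> p ` carr E = carr L \<and>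
     (\<forall>z\<in>carr E. p z = lzero L \<longrightarrow>
        (\<forall>x\<in>carr E. lbr E z x = lzero E \<and> lbr E x z = lzero E)) \<and>
     (\<exists>s. linmap L E s \<and> (\<forall>x\<in>carr L. p (s x) = x))"

text \<open>Universality, tested against central extensions living in an arbitrary
  type 'e (the type variable is universally quantified at the theorem level).\<close>

definition universal_central_ext :: "'e itself \<Rightarrow> ('k::comm_ring_1, 'a) lalg \<Rightarrow> ('k, 'b) lalg
    \<Rightarrow> ('b \<Rightarrow> 'a) \<Rightarrow> bool" where
  "universal_central_ext _ L E p \<longleftrightarrow> central_ext L E p \<and>
     (\<forall>(E' :: ('k, 'e) lalg) q. central_ext L E' q \<longrightarrow>
        (\<exists>\<eta>. lhom E E' \<eta> \<and> (\<forall>x\<in>carr E. q (\<eta> x) = p x)) \<and>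
        (\<forall>\<eta>1 \<eta>2. lhom E E' \<eta>1 \<and> (\<forall>x\<in>carr E. q (\<eta>1 x) = p x) \<and>
                 lhom E E' \<eta>2 \<and> (\<forall>x\<in>carr E. q (\<eta>2 x) = p x) \<longrightarrow>
                 (\<forall>x\<in>carr E. \<eta>1 x = \<eta>2 x)))"

definition kalgebra :: "('k::comm_ring_1 \<Rightarrow> 'r::ring_1 \<Rightarrow> 'r) \<Rightarrow> bool" where
  "kalgebra sR \<longleftrightarrow> module sR \<and>
     (\<forall>k a b. sR k (a * b) = sR k a * b \<and> sR k (a * b) = a * sR k b)"

definition free_unit_basis :: "('k::comm_ring_1 \<Rightarrow> 'r::ring_1 \<Rightarrow> 'r) \<Rightarrow> bool" where
  "free_unit_basis sR \<longleftrightarrow>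
     (\<exists>B. 1 \<in> B \<and> module.independent sR B \<and> module.span sR B = UNIV)"

definition rmod :: "('k::comm_ring_1 \<Rightarrow> 'r::ring_1 \<Rightarrow> 'r) \<Rightarrow> ('k, 'r) lalg" where
  "rmod sR = \<lparr> carr = UNIV, ladd = (+), lzero = 0, lneg = uminus, lsmul = sR, lbr = (*) \<rparr>"

definition J3 :: "('k::comm_ring_1 \<Rightarrow> 'r::ring_1 \<Rightarrow> 'r) \<Rightarrow> 'r set" where
  "J3 sR = lspan (rmod sR) ({3 * r | r. True} \<union> {r * (a * b - b * a) | r a b. True})"

definition R3 :: "('k::comm_ring_1 \<Rightarrow> 'r::ring_1 \<Rightarrow> 'r) \<Rightarrow> ('k, 'r set) lalg" where
  "R3 sR = quot (rmod sR) (J3 sR)"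

definition rbar :: "('k::comm_ring_1 \<Rightarrow> 'r::ring_1 \<Rightarrow> 'r) \<Rightarrow> 'r \<Rightarrow> 'r set" where
  "rbar sR a = lcoset (rmod sR) (J3 sR) a"

definition Uidx :: "int set" where
  "Uidx = {1, 2, 3, -1, -2, -3}"

definition Umod :: "('k::comm_ring_1 \<Rightarrow> 'r::ring_1 \<Rightarrow> 'r) \<Rightarrow> ('k, int \<Rightarrow> 'r set) lalg" where
  "Umod sR = \<lparr> carr = {f. (\<forall>i\<in>Uidx. f i \<in> carr (R3 sR)) \<and> (\<forall>i. i \<notin> Uidx \<longrightarrow> f i = lzero (R3 sR))},
      ladd = (\<lambda>f g i. if i \<in> Uidx then ladd (R3 sR) (f i) (g i) else lzero (R3 sR)),
      lzero = (\<lambda>i. lzero (R3 sR)),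
      lneg = (\<lambda>f i. if i \<in> Uidx then lneg (R3 sR) (f i) else lzero (R3 sR)),
      lsmul = (\<lambda>k f i. if i \<in> Uidx then lsmul (R3 sR) k (f i) else lzero (R3 sR)),
      lbr = (\<lambda>f g i. lzero (R3 sR)) \<rparr>"

definition uvec :: "('k::comm_ring_1 \<Rightarrow> 'r::ring_1 \<Rightarrow> 'r) \<Rightarrow> int \<Rightarrow> 'r \<Rightarrow> int \<Rightarrow> 'r set" where
  "uvec sR m a = (\<lambda>i. if i = m then rbar sR a else lzero (R3 sR))"

datatype 'g mtree = Leaf 'g | Node "'g mtree" "'g mtree"

definition idx3 :: "nat set" where
  "idx3 = {1, 2, 3}"

definition gens :: "(nat \<times> nat \<times> 'r) set" where
  "gens = {(i, j, a) | i j a. i \<in> idx3 \<and> j \<in> idx3 \<and> i \<noteq> j}"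

text \<open>Free non-associative K-algebra on the generators: finitely supported
  K-valued functions on binary trees with leaves in gens; the bracket is the
  bilinear extension of tree grafting.\<close>

definition free_magma_alg :: "('k::comm_ring_1 \<Rightarrow> 'r::ring_1 \<Rightarrow> 'r)
    \<Rightarrow> ('k, (nat \<times> nat \<times> 'r) mtree \<Rightarrow> 'k) lalg" where
  "free_magma_alg sR = (free_mod {t. set_mtree t \<subseteq> gens})
     \<lparr> lbr := (\<lambda>f g t. case t of Leaf _ \<Rightarrow> 0 | Node u v \<Rightarrow> f u * g v) \<rparr>"

definition fX :: "nat \<Rightarrow> nat \<Rightarrow> 'r \<Rightarrow> (nat \<times> nat \<times> 'r) mtree \<Rightarrow> 'k::comm_ring_1" where
  "fX i j a = ind (Leaf (i, j, a))"

definition stl_rels :: "('k::comm_ring_1 \<Rightarrow> 'r::ring_1 \<Rightarrow> 'r) \<Rightarrow> ((nat \<times> nat \<times> 'r) mtree \<Rightarrow> 'k) set" where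
  "stl_rels sR = (let F = free_magma_alg sR in
     \<comment> \<open>Leibniz identity\<close>
     {lsub F (lbr F x (lbr F y z)) (lsub F (lbr F (lbr F x y) z) (lbr F (lbr F x z) y))
        | x y z. x \<in> carr F \<and> y \<in> carr F \<and> z \<in> carr F} \<union>
     \<comment> \<open>K-linearity of a \<mapsto> X_ij(a)\<close>
     {lsub F (fX i j (sR k a + b)) (ladd F (lsmul F k (fX i j a)) (fX i j b))
        | i j k a b. i \<in> idx3 \<and> j \<in> idx3 \<and> i \<noteq> j} \<union>
     \<comment> \<open>[X_ij(a), X_jk(b)] = X_ik(ab)\<close>
     {lsub F (lbr F (fX i j a) (fX j k b)) (fX i k (a * b))
        | i j k a b. i \<in> idx3 \<and> j \<in> idx3 \<and> k \<in> idx3 \<and> i \<noteq> j \<and> j \<noteq> k \<and> i \<noteq> k} \<union>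
     \<comment> \<open>[X_ij(a), X_ki(b)] = -X_kj(ba)\<close>
     {ladd F (lbr F (fX i j a) (fX k i b)) (fX k j (b * a))
        | i j k a b. i \<in> idx3 \<and> j \<in> idx3 \<and> k \<in> idx3 \<and> i \<noteq> j \<and> j \<noteq> k \<and> i \<noteq> k} \<union>
     \<comment> \<open>[X_ij(a), X_kl(b)] = 0 for j \<noteq> k, i \<noteq> l\<close>
     {lbr F (fX i j a) (fX k l b)
        | i j k l a b. i \<in> idx3 \<and> j \<in> idx3 \<and> k \<in> idx3 \<and> l \<in> idx3 \<and> i \<noteq> j \<and> k \<noteq> l
                       \<and> j \<noteq> k \<and> i \<noteq> l})"

definition stl3 :: "('k::comm_ring_1 \<Rightarrow> 'r::ring_1 \<Rightarrow> 'r)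
    \<Rightarrow> ('k, ((nat \<times> nat \<times> 'r) mtree \<Rightarrow> 'k) set) lalg" where
  "stl3 sR = quot (free_magma_alg sR) (ideal_gen (free_magma_alg sR) (stl_rels sR))"

definition stlX :: "('k::comm_ring_1 \<Rightarrow> 'r::ring_1 \<Rightarrow> 'r) \<Rightarrow> nat \<Rightarrow> nat \<Rightarrow> 'r
    \<Rightarrow> ((nat \<times> nat \<times> 'r) mtree \<Rightarrow> 'k) set" where
  "stlX sR i j a = lcoset (free_magma_alg sR) (ideal_gen (free_magma_alg sR) (stl_rels sR)) (fX i j a)"

definition stlH :: "('k::comm_ring_1 \<Rightarrow> 'r::ring_1 \<Rightarrow> 'r) \<Rightarrow> ((nat \<times> nat \<times> 'r) mtree \<Rightarrow> 'k) set set" where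
  "stlH sR = lspan (stl3 sR)
     {lbr (stl3 sR) (stlX sR i j a) (stlX sR j i b) | i j a b. i \<in> idx3 \<and> j \<in> idx3 \<and> i \<noteq> j}"

definition sgn2 :: "nat \<Rightarrow> nat \<Rightarrow> 'k::comm_ring_1" where
  "sgn2 m n = (if m < n then 1 else -1)"

text \<open>psi: the K-bilinear map stl_3(R) \<times> stl_3(R) \<rightarrow> \<U> with the prescribed
  values on pairs of generators and vanishing when an argument lies in H
  (well defined by stl_3(R) = H \<oplus> \<Oplus> X_ij(R)).\<close>

definition psi_spec :: "('k::comm_ring_1 \<Rightarrow> 'r::ring_1 \<Rightarrow> 'r)
    \<Rightarrow> (((nat \<times> nat \<times> 'r) mtree \<Rightarrow> 'k) set \<Rightarrow> ((nat \<times> nat \<times> 'r) mtree \<Rightarrow> 'k) set \<Rightarrow> int \<Rightarrow> 'r set)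
    \<Rightarrow> bool" where
  "psi_spec sR p \<longleftrightarrow> bilin (stl3 sR) (stl3 sR) (Umod sR) p \<and>
     (\<forall>i\<in>idx3. \<forall>j\<in>idx3. \<forall>k\<in>idx3. \<forall>a b. i \<noteq> j \<and> j \<noteq> k \<and> i \<noteq> k \<longrightarrow>
        p (stlX sR i j a) (stlX sR i k b) = lsmul (Umod sR) (sgn2 j k) (uvec sR (int i) (a * b)) \<and>
        p (stlX sR i j a) (stlX sR k j b) = lsmul (Umod sR) (sgn2 i k) (uvec sR (- int j) (a * b))) \<and>
     (\<forall>i\<in>idx3. \<forall>j\<in>idx3. \<forall>k\<in>idx3. \<forall>l\<in>idx3. \<forall>a b.
        i \<noteq> j \<and> k \<noteq> l \<and> \<not> (i = k \<and> j \<noteq> l) \<and> \<not> (j = l \<and> i \<noteq> k) \<longrightarrow>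
        p (stlX sR i j a) (stlX sR k l b) = lzero (Umod sR)) \<and>
     (\<forall>h\<in>stlH sR. \<forall>y\<in>carr (stl3 sR).
        p h y = lzero (Umod sR) \<and> p y h = lzero (Umod sR))"

definition psi :: "('k::comm_ring_1 \<Rightarrow> 'r::ring_1 \<Rightarrow> 'r)
    \<Rightarrow> ((nat \<times> nat \<times> 'r) mtree \<Rightarrow> 'k) set \<Rightarrow> ((nat \<times> nat \<times> 'r) mtree \<Rightarrow> 'k) set \<Rightarrow> int \<Rightarrow> 'r set" where
  "psi sR = (SOME p. psi_spec sR p)"

definition hat_stl3 :: "('k::comm_ring_1 \<Rightarrow> 'r::ring_1 \<Rightarrow> 'r)
    \<Rightarrow> ('k, (int \<Rightarrow> 'r set) \<times> ((nat \<times> nat \<times> 'r) mtree \<Rightarrow> 'k) set) lalg" where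
  "hat_stl3 sR = (let U = Umod sR; S = stl3 sR in
     \<lparr> carr = carr U \<times> carr S,
       ladd = (\<lambda>(c, x) (c', y). (ladd U c c', ladd S x y)),
       lzero = (lzero U, lzero S),
       lneg = (\<lambda>(c, x). (lneg U c, lneg S x)),
       lsmul = (\<lambda>k (c, x). (lsmul U k c, lsmul S k x)),
       lbr = (\<lambda>(c, x) (c', y). (psi sR x y, lbr S x y)) \<rparr>)"

end

theory Submission
  imports Defs "HOL-Algebra.FiniteProduct"
begin

text \<open>
  Call a bilinear map \<open>T : L \<times> L \<rightarrow> W\<close> a cocycle if \<open>T(x, [y, z]) = T([x, y], z) - T([x, z], y)\<close>. For
  \<open>L = stl\<^sub>3(R)\<close>, both claims follow once \<open>(x, y) \<mapsto> (\<psi>(x, y), [x, y])\<close> is known to be the universal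
  cocycle: it is a cocycle, its values span \<open>\<U> \<oplus> L\<close>, and every cocycle is its composite with a linear
  map. Given a central extension with linear section \<open>s\<close>, this is applied to \<open>T(x, y) = [s x, s y]\<close>; for
  \<open>HL\<^sub>2\<close> it is applied to \<open>L \<times> L \<rightarrow> (L \<otimes> L) / im d\<^sub>3\<close>, which identifies this quotient with \<open>\<U> \<oplus> L\<close> and
  \<open>d\<^sub>2\<close> with minus the projection to \<open>L\<close>.

  That \<open>\<psi>\<close> exists and is a cocycle is seen on \<open>3 \<times> 3\<close> matrices: \<open>L\<close> maps to the matrices whose trace lies
  in \<open>J = 3R + R[R, R]\<close>, the components of \<open>\<psi>\<close> are the expressions
  \<open>x\<^sub>i\<^sub>j y\<^sub>i\<^sub>k - x\<^sub>i\<^sub>k y\<^sub>i\<^sub>j\<close> and \<open>x\<^sub>j\<^sub>i y\<^sub>k\<^sub>i - x\<^sub>k\<^sub>i y\<^sub>j\<^sub>i\<close>, and modulo \<open>J\<close> the ring is commutative, \<open>3 = 0\<close>, and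
  the matrices are traceless.

  For the factorization of a cocycle \<open>T\<close>, the Leibniz identity and the action of
  \<open>h = [X\<^sub>i\<^sub>j(1), X\<^sub>j\<^sub>i(1)]\<close> show that \<open>T(X\<^sub>i\<^sub>j(a), X\<^sub>i\<^sub>k(b))\<close> equals \<open>\<plusminus> g(ab)\<close> with \<open>g\<close> linear and zero on
  \<open>J\<close>, and likewise for columns. Subtracting the composite of \<open>\<psi>\<close> with the resulting map \<open>\<U> \<rightarrow> W\<close> leaves a
  cocycle that vanishes on commuting generators and satisfies
  \<open>T(X\<^sub>i\<^sub>j(a), X\<^sub>j\<^sub>k(b)) = - T(X\<^sub>i\<^sub>k(ab), h) = - T(X\<^sub>j\<^sub>k(b), X\<^sub>i\<^sub>j(a))\<close>, and such a cocycle is a coboundary.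
\<close>

subsection \<open>Modules, linear maps and bilinear maps on carriers\<close>

lemma kmod_zero [simp]: "kmod M \<Longrightarrow> lzero M \<in> carr M"
  and kmod_add [simp]: "kmod M \<Longrightarrow> x \<in> carr M \<Longrightarrow> y \<in> carr M \<Longrightarrow> ladd M x y \<in> carr M"
  and kmod_neg [simp]: "kmod M \<Longrightarrow> x \<in> carr M \<Longrightarrow> lneg M x \<in> carr M"
  and kmod_smul [simp]: "kmod M \<Longrightarrow> x \<in> carr M \<Longrightarrow> lsmul M k x \<in> carr M"
  and kmod_assoc: "kmod M \<Longrightarrow> x \<in> carr M \<Longrightarrow> y \<in> carr M \<Longrightarrow> z \<in> carr M
        \<Longrightarrow> ladd M (ladd M x y) z = ladd M x (ladd M y z)"
  and kmod_comm: "kmod M \<Longrightarrow> x \<in> carr M \<Longrightarrow> y \<in> carr M \<Longrightarrow> ladd M x y = ladd M y x"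
  and kmod_0_left [simp]: "kmod M \<Longrightarrow> x \<in> carr M \<Longrightarrow> ladd M (lzero M) x = x"
  and kmod_neg_left [simp]: "kmod M \<Longrightarrow> x \<in> carr M \<Longrightarrow> ladd M (lneg M x) x = lzero M"
  and kmod_smul_add: "kmod M \<Longrightarrow> x \<in> carr M \<Longrightarrow> y \<in> carr M
        \<Longrightarrow> lsmul M k (ladd M x y) = ladd M (lsmul M k x) (lsmul M k y)"
  and kmod_add_smul: "kmod M \<Longrightarrow> x \<in> carr M \<Longrightarrow> lsmul M (k + l) x = ladd M (lsmul M k x) (lsmul M l x)"
  and kmod_mult_smul: "kmod M \<Longrightarrow> x \<in> carr M \<Longrightarrow> lsmul M (k * l) x = lsmul M k (lsmul M l x)"
  and kmod_1_smul [simp]: "kmod M \<Longrightarrow> x \<in> carr M \<Longrightarrow> lsmul M 1 x = x"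
  unfolding kmod_def by meson+

lemma kmod_lcomm: "kmod M \<Longrightarrow> x \<in> carr M \<Longrightarrow> y \<in> carr M \<Longrightarrow> z \<in> carr M
    \<Longrightarrow> ladd M x (ladd M y z) = ladd M y (ladd M x z)"
  by (metis kmod_assoc kmod_comm)

lemmas kmod_ac = kmod_assoc kmod_comm kmod_lcomm

lemma kmod_0_right [simp]: "kmod M \<Longrightarrow> x \<in> carr M \<Longrightarrow> ladd M x (lzero M) = x"
  by (metis kmod_0_left kmod_comm kmod_zero)

lemma kmod_neg_right [simp]: "kmod M \<Longrightarrow> x \<in> carr M \<Longrightarrow> ladd M x (lneg M x) = lzero M"
  by (metis kmod_comm kmod_neg kmod_neg_left)

lemma kmod_neg_add_cancel [simp]: "kmod M \<Longrightarrow> x \<in> carr M \<Longrightarrow> y \<in> carr M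
    \<Longrightarrow> ladd M (lneg M x) (ladd M x y) = y"
  by (metis kmod_0_left kmod_assoc kmod_neg kmod_neg_left)

lemma kmod_add_neg_cancel [simp]: "kmod M \<Longrightarrow> x \<in> carr M \<Longrightarrow> y \<in> carr M
    \<Longrightarrow> ladd M x (ladd M (lneg M x) y) = y"
  by (metis kmod_0_left kmod_assoc kmod_neg kmod_neg_right)

lemma kmod_conj_cancel [simp]: "kmod M \<Longrightarrow> x \<in> carr M \<Longrightarrow> y \<in> carr M
    \<Longrightarrow> ladd M x (ladd M y (lneg M x)) = y"
  using kmod_lcomm[of M x y "lneg M x"] by simp

lemma kmod_cancel [simp]: "kmod M \<Longrightarrow> x \<in> carr M \<Longrightarrow> y \<in> carr M \<Longrightarrow> z \<in> carr M
    \<Longrightarrow> ladd M x y = ladd M x z \<longleftrightarrow> y = z"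
  by (metis kmod_neg_add_cancel)

lemma kmod_neg_unique: "kmod M \<Longrightarrow> x \<in> carr M \<Longrightarrow> y \<in> carr M
    \<Longrightarrow> ladd M x y = lzero M \<Longrightarrow> y = lneg M x"
  by (metis kmod_0_right kmod_neg kmod_neg_add_cancel)

lemma kmod_neg_neg [simp]: "kmod M \<Longrightarrow> x \<in> carr M \<Longrightarrow> lneg M (lneg M x) = x"
  by (metis kmod_neg kmod_neg_left kmod_neg_unique)

lemma kmod_neg_zero [simp]: "kmod M \<Longrightarrow> lneg M (lzero M) = lzero M"
  by (metis kmod_0_left kmod_neg_unique kmod_zero)

lemma kmod_neg_add: "kmod M \<Longrightarrow> x \<in> carr M \<Longrightarrow> y \<in> carr M
    \<Longrightarrow> lneg M (ladd M x y) = ladd M (lneg M x) (lneg M y)"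
  by (rule sym, rule kmod_neg_unique) (simp_all add: kmod_ac)

lemma kmod_sub [simp]: "kmod M \<Longrightarrow> x \<in> carr M \<Longrightarrow> y \<in> carr M \<Longrightarrow> lsub M x y \<in> carr M"
  by (simp add: lsub_def)

lemma kmod_sub_self [simp]: "kmod M \<Longrightarrow> x \<in> carr M \<Longrightarrow> lsub M x x = lzero M"
  by (simp add: lsub_def)

lemma kmod_sub_eq: "kmod M \<Longrightarrow> x \<in> carr M \<Longrightarrow> y \<in> carr M \<Longrightarrow> z \<in> carr M
    \<Longrightarrow> lsub M x y = z \<longleftrightarrow> x = ladd M z y"
  unfolding lsub_def
  by (metis kmod_add kmod_assoc kmod_comm kmod_neg kmod_neg_add_cancel kmod_add_neg_cancel)

lemma kmod_sub_eq_0: "kmod M \<Longrightarrow> x \<in> carr M \<Longrightarrow> y \<in> carr M \<Longrightarrow> lsub M x y = lzero M \<longleftrightarrow> x = y"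
  by (simp add: kmod_sub_eq)

lemma kmod_smul_0 [simp]: "kmod M \<Longrightarrow> lsmul M k (lzero M) = lzero M"
  by (metis kmod_0_right kmod_cancel kmod_smul kmod_smul_add kmod_zero)

lemma kmod_0_smul [simp]: "kmod M \<Longrightarrow> x \<in> carr M \<Longrightarrow> lsmul M 0 x = lzero M"
  by (metis add.right_neutral kmod_0_right kmod_add_smul kmod_cancel kmod_smul kmod_zero)

lemma kmod_smul_neg [simp]: "kmod M \<Longrightarrow> x \<in> carr M \<Longrightarrow> lsmul M k (lneg M x) = lneg M (lsmul M k x)"
  by (rule kmod_neg_unique) (simp_all flip: kmod_smul_add)

lemma kmod_neg_smul [simp]: "kmod M \<Longrightarrow> x \<in> carr M \<Longrightarrow> lsmul M (- k) x = lneg M (lsmul M k x)"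
  by (rule kmod_neg_unique) (simp_all flip: kmod_add_smul)

lemma linmap_closed: "linmap M N f \<Longrightarrow> x \<in> carr M \<Longrightarrow> f x \<in> carr N"
  and linmap_add: "linmap M N f \<Longrightarrow> x \<in> carr M \<Longrightarrow> y \<in> carr M \<Longrightarrow> f (ladd M x y) = ladd N (f x) (f y)"
  and linmap_smul: "linmap M N f \<Longrightarrow> x \<in> carr M \<Longrightarrow> f (lsmul M k x) = lsmul N k (f x)"
  unfolding linmap_def by blast+

text \<open>\<open>linmap\<close> asks only for additivity and homogeneity; the scalar 0 gives this,
  and -1 gives the compatibility with negation that follows.\<close>

lemma linmap_zero: "kmod M \<Longrightarrow> kmod N \<Longrightarrow> linmap M N f \<Longrightarrow> f (lzero M) = lzero N"
  using linmap_smul[of M N f "lzero M" 0] by (simp add: linmap_closed)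

lemma linmap_neg: "kmod M \<Longrightarrow> kmod N \<Longrightarrow> linmap M N f \<Longrightarrow> x \<in> carr M \<Longrightarrow> f (lneg M x) = lneg N (f x)"
  using linmap_smul[of M N f x "-1"] by (simp add: linmap_closed)

lemma linmap_sub: "kmod M \<Longrightarrow> kmod N \<Longrightarrow> linmap M N f \<Longrightarrow> x \<in> carr M \<Longrightarrow> y \<in> carr M
    \<Longrightarrow> f (lsub M x y) = lsub N (f x) (f y)"
  by (simp add: lsub_def linmap_add linmap_neg)

lemma linmap_comp: "linmap M N f \<Longrightarrow> linmap N P g \<Longrightarrow> linmap M P (\<lambda>x. g (f x))"
  by (simp add: linmap_def)

lemma lhom_linmap: "lhom L M f \<Longrightarrow> linmap L M f"
  and lhom_br: "lhom L M f \<Longrightarrow> x \<in> carr L \<Longrightarrow> y \<in> carr L \<Longrightarrow> f (lbr L x y) = lbr M (f x) (f y)"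
  by (simp_all add: lhom_def)

lemma bilin_closed: "bilin A B C p \<Longrightarrow> x \<in> carr A \<Longrightarrow> y \<in> carr B \<Longrightarrow> p x y \<in> carr C"
  and bilin_add_left: "bilin A B C p \<Longrightarrow> x \<in> carr A \<Longrightarrow> x' \<in> carr A \<Longrightarrow> y \<in> carr B
        \<Longrightarrow> p (ladd A x x') y = ladd C (p x y) (p x' y)"
  and bilin_add_right: "bilin A B C p \<Longrightarrow> x \<in> carr A \<Longrightarrow> y \<in> carr B \<Longrightarrow> y' \<in> carr B
        \<Longrightarrow> p x (ladd B y y') = ladd C (p x y) (p x y')"
  and bilin_smul_left: "bilin A B C p \<Longrightarrow> x \<in> carr A \<Longrightarrow> y \<in> carr B
        \<Longrightarrow> p (lsmul A k x) y = lsmul C k (p x y)"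
  and bilin_smul_right: "bilin A B C p \<Longrightarrow> x \<in> carr A \<Longrightarrow> y \<in> carr B
        \<Longrightarrow> p x (lsmul B k y) = lsmul C k (p x y)"
  unfolding bilin_def by blast+

lemma bilin_linmap_left: "bilin A B C p \<Longrightarrow> y \<in> carr B \<Longrightarrow> linmap A C (\<lambda>x. p x y)"
  and bilin_linmap_right: "bilin A B C p \<Longrightarrow> x \<in> carr A \<Longrightarrow> linmap B C (p x)"
  by (simp_all add: bilin_def linmap_def)

lemma bilin_zero_left: "kmod A \<Longrightarrow> kmod C \<Longrightarrow> bilin A B C p \<Longrightarrow> y \<in> carr B \<Longrightarrow> p (lzero A) y = lzero C"
  and bilin_neg_left: "kmod A \<Longrightarrow> kmod C \<Longrightarrow> bilin A B C p \<Longrightarrow> x \<in> carr A \<Longrightarrow> y \<in> carr B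
        \<Longrightarrow> p (lneg A x) y = lneg C (p x y)"
  and bilin_sub_left: "kmod A \<Longrightarrow> kmod C \<Longrightarrow> bilin A B C p \<Longrightarrow> x \<in> carr A \<Longrightarrow> x' \<in> carr A \<Longrightarrow> y \<in> carr B
        \<Longrightarrow> p (lsub A x x') y = lsub C (p x y) (p x' y)"
  by (rule linmap_zero[OF _ _ bilin_linmap_left] linmap_neg[OF _ _ bilin_linmap_left]
      linmap_sub[OF _ _ bilin_linmap_left]; assumption)+

lemma bilin_zero_right: "kmod B \<Longrightarrow> kmod C \<Longrightarrow> bilin A B C p \<Longrightarrow> x \<in> carr A \<Longrightarrow> p x (lzero B) = lzero C"
  and bilin_neg_right: "kmod B \<Longrightarrow> kmod C \<Longrightarrow> bilin A B C p \<Longrightarrow> x \<in> carr A \<Longrightarrow> y \<in> carr B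
        \<Longrightarrow> p x (lneg B y) = lneg C (p x y)"
  and bilin_sub_right: "kmod B \<Longrightarrow> kmod C \<Longrightarrow> bilin A B C p \<Longrightarrow> x \<in> carr A \<Longrightarrow> y \<in> carr B \<Longrightarrow> y' \<in> carr B
        \<Longrightarrow> p x (lsub B y y') = lsub C (p x y) (p x y')"
  by (rule linmap_zero[OF _ _ bilin_linmap_right] linmap_neg[OF _ _ bilin_linmap_right]
      linmap_sub[OF _ _ bilin_linmap_right]; assumption)+

lemma bilin_comp: "bilin A B C p \<Longrightarrow> linmap A' A f \<Longrightarrow> linmap B' B g \<Longrightarrow> bilin A' B' C (\<lambda>x y. p (f x) (g y))"
  by (simp add: bilin_def linmap_def)

lemma linmap_bilin: "bilin A B C p \<Longrightarrow> linmap C D h \<Longrightarrow> bilin A B D (\<lambda>x y. h (p x y))"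
  by (simp add: bilin_def linmap_def)

lemma bilin_add: "kmod C \<Longrightarrow> bilin A B C p \<Longrightarrow> bilin A B C q \<Longrightarrow> bilin A B C (\<lambda>x y. ladd C (p x y) (q x y))"
  by (simp add: bilin_def kmod_smul_add kmod_ac)

lemma linmap_add_map: "kmod C \<Longrightarrow> linmap A C p \<Longrightarrow> linmap A C q \<Longrightarrow> linmap A C (\<lambda>x. ladd C (p x) (q x))"
  by (simp add: linmap_def kmod_smul_add kmod_ac)

lemma linmap_neg_map: "kmod C \<Longrightarrow> linmap A C p \<Longrightarrow> linmap A C (\<lambda>x. lneg C (p x))"
  by (simp add: linmap_def kmod_neg_add)

lemma bilin_neg: "kmod C \<Longrightarrow> bilin A B C p \<Longrightarrow> bilin A B C (\<lambda>x y. lneg C (p x y))"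
  by (simp add: bilin_def kmod_neg_add)

lemma bilin_sub: "kmod C \<Longrightarrow> bilin A B C p \<Longrightarrow> bilin A B C q \<Longrightarrow> bilin A B C (\<lambda>x y. lsub C (p x y) (q x y))"
  by (simp add: lsub_def bilin_add bilin_neg)

subsection \<open>Submodules, spans and generating sets\<close>

lemma submodule_carr: "kmod M \<Longrightarrow> submodule M (carr M)"
  by (simp add: submodule_def)

lemma submoduleD:
  assumes "submodule M N"
  shows "N \<subseteq> carr M" "lzero M \<in> N" "x \<in> N \<Longrightarrow> y \<in> N \<Longrightarrow> ladd M x y \<in> N"
    "x \<in> N \<Longrightarrow> lneg M x \<in> N" "x \<in> N \<Longrightarrow> lsmul M k x \<in> N"
    "x \<in> N \<Longrightarrow> x \<in> carr M" "x \<in> N \<Longrightarrow> y \<in> N \<Longrightarrow> lsub M x y \<in> N"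
  using assms unfolding submodule_def lsub_def by blast+

lemma submodule_Inter:
  assumes "\<And>N. N \<in> F \<Longrightarrow> submodule M N" "F \<noteq> {}"
  shows "submodule M (\<Inter>F)"
  using assms unfolding submodule_def by blast

lemma submodule_lspan: "kmod M \<Longrightarrow> S \<subseteq> carr M \<Longrightarrow> submodule M (lspan M S)"
  unfolding lspan_def using submodule_carr by (intro submodule_Inter) auto

lemma lspan_superset: "S \<subseteq> lspan M S"
  by (auto simp: lspan_def)

lemma lspan_subset: "submodule M N \<Longrightarrow> S \<subseteq> N \<Longrightarrow> lspan M S \<subseteq> N"
  by (auto simp: lspan_def)

lemma submodule_vimage:
  assumes "kmod M" "kmod P" "linmap M P f" "submodule P N"
  shows "submodule M {x \<in> carr M. f x \<in> N}"
  using assms by (auto simp: submodule_def linmap_zero linmap_neg linmap_add linmap_smul)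

lemma submodule_kernel: "kmod M \<Longrightarrow> kmod P \<Longrightarrow> linmap M P f \<Longrightarrow> submodule M {x \<in> carr M. f x = lzero P}"
  by (auto simp: submodule_def linmap_zero linmap_neg linmap_add linmap_smul)

lemma submodule_equalizer: "kmod M \<Longrightarrow> kmod P \<Longrightarrow> linmap M P f \<Longrightarrow> linmap M P g
    \<Longrightarrow> submodule M {x \<in> carr M. f x = g x}"
  by (auto simp: submodule_def linmap_zero linmap_neg linmap_add linmap_smul)

lemma submodule_image:
  assumes "kmod M" "kmod P" "linmap M P f" "submodule M N"
  shows "submodule P (f ` N)"
proof -
  note D = submoduleD[OF assms(4)]
  show ?thesis unfolding submodule_def
  proof (intro conjI ballI allI)
    show "f ` N \<subseteq> carr P" using assms(3) D(6) linmap_closed by fastforce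
    show "lzero P \<in> f ` N" using D(2) linmap_zero[OF assms(1-3)] by (metis imageI)
  next
    fix x y assume "x \<in> f ` N" "y \<in> f ` N"
    then show "ladd P x y \<in> f ` N"
      using D(3,6) linmap_add[OF assms(3)] by (smt (verit) image_iff)
  next
    fix x assume "x \<in> f ` N"
    then show "lneg P x \<in> f ` N"
      using D(4,6) linmap_neg[OF assms(1-3)] by (smt (verit) image_iff)
  next
    fix k x assume "x \<in> f ` N"
    then show "lsmul P k x \<in> f ` N"
      using D(5,6) linmap_smul[OF assms(3)] by (smt (verit) image_iff)
  qed
qed

text \<open>Phrased as an induction principle over submodules rather than as an equation for
  \<open>lspan\<close>, because that is how spanning sets are used: a property closed under the
  module operations is checked on \<open>S\<close>.\<close>

definition spans :: "('k::comm_ring_1, 'a) lalg \<Rightarrow> 'a set \<Rightarrow> bool" where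
  "spans M S \<longleftrightarrow> S \<subseteq> carr M \<and> (\<forall>N. submodule M N \<and> S \<subseteq> N \<longrightarrow> carr M \<subseteq> N)"

lemma spansI: "S \<subseteq> carr M \<Longrightarrow> (\<And>N. submodule M N \<Longrightarrow> S \<subseteq> N \<Longrightarrow> carr M \<subseteq> N) \<Longrightarrow> spans M S"
  by (auto simp: spans_def)

lemma spansD: "spans M S \<Longrightarrow> submodule M N \<Longrightarrow> S \<subseteq> N \<Longrightarrow> carr M \<subseteq> N"
  by (auto simp: spans_def)

lemma spans_linmap_eq:
  assumes "kmod M" "kmod P" "linmap M P f" "linmap M P g" "spans M S"
    and "\<And>s. s \<in> S \<Longrightarrow> f s = g s" and "x \<in> carr M"
  shows "f x = g x"
proof -
  have "S \<subseteq> carr M" using assms(5) by (simp add: spans_def)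
  then have "S \<subseteq> {x \<in> carr M. f x = g x}" using assms(6) by blast
  then show ?thesis using spansD[OF assms(5) submodule_equalizer[OF assms(1-4)]] assms(7) by blast
qed

text \<open>One argument at a time: for fixed \<open>s\<close> in \<open>S\<close> both sides are
  linear in \<open>y\<close>, and then for fixed \<open>y\<close> both are linear in
  \<open>x\<close>.\<close>

lemma spans_bilin_eq:
  assumes "kmod A" "kmod B" "kmod C" "bilin A B C p" "bilin A B C q" "spans A S" "spans B T"
    and eq: "\<And>s t. s \<in> S \<Longrightarrow> t \<in> T \<Longrightarrow> p s t = q s t" and "x \<in> carr A" "y \<in> carr B"
  shows "p x y = q x y"
proof -
  have S: "S \<subseteq> carr A" using assms(6) by (simp add: spans_def)
  have "p s y = q s y" if "s \<in> S" for s
    by (rule spans_linmap_eq[OF assms(2,3) bilin_linmap_right[OF assms(4)] bilin_linmap_right[OF assms(5)] assms(7)])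
       (use that S eq assms(10) in auto)
  then show ?thesis
    by (rule spans_linmap_eq[OF assms(1,3) bilin_linmap_left[OF assms(4,10)] bilin_linmap_left[OF assms(5,10)] assms(6) _ assms(9)])
qed

lemma spans_image:
  assumes "kmod M" "kmod P" "linmap M P f" "f ` carr M = carr P" "spans M S"
  shows "spans P (f ` S)"
proof (rule spansI)
  show "f ` S \<subseteq> carr P" using assms(4,5) by (auto simp: spans_def)
next
  fix N assume N: "submodule P N" "f ` S \<subseteq> N"
  have "carr M \<subseteq> {x \<in> carr M. f x \<in> N}"
  proof (rule spansD[OF assms(5) submodule_vimage[OF assms(1-3) N(1)]])
    have "S \<subseteq> carr M" using assms(5) by (simp add: spans_def)
    then show "S \<subseteq> {x \<in> carr M. f x \<in> N}" using N(2) by blast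
  qed
  then have "f ` carr M \<subseteq> N" by auto
  then show "carr P \<subseteq> N" by (simp add: assms(4))
qed

subsection \<open>Quotient modules\<close>

lemma lcoset_self: "kmod M \<Longrightarrow> submodule M N \<Longrightarrow> x \<in> carr M \<Longrightarrow> x \<in> lcoset M N x"
  unfolding lcoset_def by (smt (verit) kmod_0_right mem_Collect_eq submoduleD(2))

lemma lcoset_eq_iff:
  assumes "kmod M" "submodule M N" "x \<in> carr M" "y \<in> carr M"
  shows "lcoset M N x = lcoset M N y \<longleftrightarrow> lsub M x y \<in> N"
proof
  assume "lcoset M N x = lcoset M N y"
  then have "x \<in> lcoset M N y" using lcoset_self assms by metis
  then obtain n where n: "n \<in> N" "x = ladd M y n" by (auto simp: lcoset_def)
  then have "n \<in> carr M" using assms submoduleD by metis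
  then have "lsub M x y = n" using n assms by (simp add: kmod_sub_eq kmod_comm)
  then show "lsub M x y \<in> N" using n by simp
next
  assume d: "lsub M x y \<in> N"
  note D = submoduleD[OF assms(2)]
  have 1: "ladd M x n = ladd M y (ladd M (lsub M x y) n)" if "n \<in> N" for n
    using that D(6) assms by (simp add: lsub_def kmod_ac)
  have 2: "ladd M y n = ladd M x (ladd M (lneg M (lsub M x y)) n)" if "n \<in> N" for n
    using that D(6) assms by (simp add: lsub_def kmod_ac kmod_neg_add)
  show "lcoset M N x = lcoset M N y"
    unfolding lcoset_def using d 1 2 D(3,4) by blast
qed

lemma lcoset_eqI: "kmod M \<Longrightarrow> submodule M N \<Longrightarrow> x \<in> carr M \<Longrightarrow> y \<in> carr M \<Longrightarrow> lsub M x y \<in> N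
    \<Longrightarrow> lcoset M N x = lcoset M N y"
  by (simp add: lcoset_eq_iff)

text \<open>\<open>quot\<close> computes with representatives chosen by \<open>SOME\<close>. Writing
  the chosen one as \<open>x\<close> plus an error \<open>n\<close> in \<open>N\<close> is what
  makes the operations on cosets computable.\<close>

lemma rep_lcoset:
  assumes "kmod M" "submodule M N" "x \<in> carr M"
  obtains n where "n \<in> N" "n \<in> carr M" "rep (lcoset M N x) = ladd M x n"
proof -
  have "rep (lcoset M N x) \<in> lcoset M N x"
    unfolding rep_def using lcoset_self[OF assms] by (rule someI)
  then show thesis using that submoduleD(6)[OF assms(2)] by (auto simp: lcoset_def)
qed

lemma quot_carr: "carr (quot M N) = lcoset M N ` carr M"
  by (auto simp: quot_def)

lemma quot_carrI [simp]: "x \<in> carr M \<Longrightarrow> lcoset M N x \<in> carr (quot M N)"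
  by (simp add: quot_carr)

lemma quot_zero: "lzero (quot M N) = lcoset M N (lzero M)"
  by (simp add: quot_def)

lemma quot_add:
  assumes "kmod M" "submodule M N" "x \<in> carr M" "y \<in> carr M"
  shows "ladd (quot M N) (lcoset M N x) (lcoset M N y) = lcoset M N (ladd M x y)"
proof -
  note D = submoduleD[OF assms(2)]
  obtain m where m: "m \<in> N" "m \<in> carr M" "rep (lcoset M N x) = ladd M x m"
    using rep_lcoset assms by metis
  obtain n where n: "n \<in> N" "n \<in> carr M" "rep (lcoset M N y) = ladd M y n"
    using rep_lcoset assms by metis
  have "lsub M (ladd M (ladd M x m) (ladd M y n)) (ladd M x y) = ladd M m n"
    using assms m n by (simp add: kmod_sub_eq kmod_ac)
  then show ?thesis
    using assms m n D(3) by (simp add: quot_def lcoset_eq_iff)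
qed

lemma quot_neg:
  assumes "kmod M" "submodule M N" "x \<in> carr M"
  shows "lneg (quot M N) (lcoset M N x) = lcoset M N (lneg M x)"
proof -
  note D = submoduleD[OF assms(2)]
  obtain m where m: "m \<in> N" "m \<in> carr M" "rep (lcoset M N x) = ladd M x m"
    using rep_lcoset assms by metis
  have "lsub M (lneg M (ladd M x m)) (lneg M x) = lneg M m"
    using assms m by (simp add: kmod_sub_eq kmod_neg_add kmod_comm)
  then show ?thesis
    using assms m D(4) by (simp add: quot_def lcoset_eq_iff)
qed

lemma quot_smul:
  assumes "kmod M" "submodule M N" "x \<in> carr M"
  shows "lsmul (quot M N) k (lcoset M N x) = lcoset M N (lsmul M k x)"
proof -
  note D = submoduleD[OF assms(2)]
  obtain m where m: "m \<in> N" "m \<in> carr M" "rep (lcoset M N x) = ladd M x m"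
    using rep_lcoset assms by metis
  have "lsub M (lsmul M k (ladd M x m)) (lsmul M k x) = lsmul M k m"
    using assms m by (simp add: kmod_sub_eq kmod_smul_add kmod_comm)
  then show ?thesis
    using assms m D(5) by (simp add: quot_def lcoset_eq_iff)
qed

text \<open>The errors \<open>m\<close> and \<open>n\<close> of the representatives contribute
  \<open>[m, y] + [x, n] + [m, n]\<close>, which lies in \<open>N\<close> because \<open>N\<close>
  is a two-sided ideal.\<close>

lemma quot_br:
  assumes "kmod M" "lideal M N" "bilin M M M (lbr M)" "x \<in> carr M" "y \<in> carr M"
  shows "lbr (quot M N) (lcoset M N x) (lcoset M N y) = lcoset M N (lbr M x y)"
proof -
  have N: "submodule M N" and I: "\<And>x y. x \<in> N \<Longrightarrow> y \<in> carr M \<Longrightarrow> lbr M x y \<in> N \<and> lbr M y x \<in> N"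
    using assms(2) by (auto simp: lideal_def)
  note D = submoduleD[OF N]
  obtain m where m: "m \<in> N" "m \<in> carr M" "rep (lcoset M N x) = ladd M x m"
    using rep_lcoset N assms by metis
  obtain n where n: "n \<in> N" "n \<in> carr M" "rep (lcoset M N y) = ladd M y n"
    using rep_lcoset N assms by metis
  note B = bilin_closed[OF assms(3)]
  have "lsub M (lbr M (ladd M x m) (ladd M y n)) (lbr M x y)
      = ladd M (lbr M m y) (ladd M (lbr M x n) (lbr M m n))"
    using assms(1,4,5) m n B
    by (simp add: kmod_sub_eq bilin_add_left[OF assms(3)] bilin_add_right[OF assms(3)] kmod_ac)
  then show ?thesis
    using assms m n D(3) N I B by (simp add: quot_def lcoset_eq_iff)
qed

lemma kmod_quot:
  assumes "kmod M" "submodule M N"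
  shows "kmod (quot M N)"
  unfolding kmod_def quot_carr ball_simps quot_zero
  using assms
  by (simp add: quot_add quot_neg quot_smul kmod_ac kmod_smul_add kmod_add_smul kmod_mult_smul)

lemma linmap_lcoset: "kmod M \<Longrightarrow> submodule M N \<Longrightarrow> linmap M (quot M N) (lcoset M N)"
  by (simp add: linmap_def quot_add quot_smul)

lemma quot_lift:
  assumes "kmod M" "submodule M N" "kmod P" "linmap M P f" "\<And>n. n \<in> N \<Longrightarrow> f n = lzero P"
  obtains g where "linmap (quot M N) P g" "\<And>x. x \<in> carr M \<Longrightarrow> g (lcoset M N x) = f x"
proof -
  \<comment> \<open>\<open>f\<close> kills the error of the representative, so the value at
    \<open>rep\<close> is independent of the choice.\<close>
  have g: "f (rep (lcoset M N x)) = f x" if x: "x \<in> carr M" for x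
  proof -
    obtain m where "m \<in> N" "m \<in> carr M" "rep (lcoset M N x) = ladd M x m"
      using rep_lcoset[OF assms(1,2) x] by metis
    then show ?thesis using assms x by (simp add: linmap_add linmap_closed)
  qed
  show thesis
  proof (rule that[of "\<lambda>A. f (rep A)"])
    show "linmap (quot M N) P (\<lambda>A. f (rep A))"
      unfolding linmap_def quot_carr ball_simps
      using assms(1,2,4) by (simp add: quot_add quot_smul g linmap_closed linmap_add linmap_smul)
  qed (rule g)
qed

lemma spans_quot: "kmod M \<Longrightarrow> submodule M N \<Longrightarrow> spans M S \<Longrightarrow> spans (quot M N) (lcoset M N ` S)"
  by (rule spans_image) (simp_all add: kmod_quot linmap_lcoset quot_carr)

lemma bilin_quot_br:
  assumes "kmod M" "lideal M N" "bilin M M M (lbr M)"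
  shows "bilin (quot M N) (quot M N) (quot M N) (lbr (quot M N))"
proof -
  have "submodule M N" using assms(2) by (simp add: lideal_def)
  then show ?thesis
    unfolding bilin_def quot_carr ball_simps using assms
    by (simp add: quot_br quot_add quot_smul bilin_closed[OF assms(3)] bilin_add_left[OF assms(3)]
        bilin_add_right[OF assms(3)] bilin_smul_left[OF assms(3)] bilin_smul_right[OF assms(3)])
qed

subsection \<open>Free modules and tensor products\<close>

text \<open>Gives access to the finite products of HOL-Algebra, which serve as finite sums in the
  carrier when maps out of a free module are built.\<close>

lemma lmonoid: "kmod M \<Longrightarrow> comm_monoid \<lparr>carrier = carr M, mult = ladd M, one = lzero M\<rparr>"
  by unfold_locales (simp_all add: kmod_ac)

lemma free_mod_simps:
  "carr (free_mod X) = {f. finite {x. f x \<noteq> 0} \<and> {x. f x \<noteq> 0} \<subseteq> X}"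
  "ladd (free_mod X) f g = (\<lambda>x. f x + g x)" "lzero (free_mod X) = (\<lambda>x. 0)"
  "lneg (free_mod X) f = (\<lambda>x. - f x)" "lsmul (free_mod X) k f = (\<lambda>x. k * f x)"
  by (simp_all add: free_mod_def)

lemma kmod_free_mod: "kmod (free_mod X :: ('k::comm_ring_1, 'x \<Rightarrow> 'k) lalg)"
proof -
  have "finite {x. f x + g x \<noteq> 0}" if "finite {x. f x \<noteq> 0}" "finite {x. g x \<noteq> 0}" for f g :: "'x \<Rightarrow> 'k"
    by (rule finite_subset[OF _ finite_UnI[OF that]]) auto
  moreover have "finite {x. k * f x \<noteq> 0}" if "finite {x. f x \<noteq> 0}" for f :: "'x \<Rightarrow> 'k" and k
    by (rule finite_subset[OF _ that]) auto
  ultimately show ?thesis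
    unfolding kmod_def free_mod_simps
    by (auto simp: fun_eq_iff algebra_simps subset_iff)
      (metis add.right_neutral, metis mult_zero_right)
qed

lemma ind_closed: "x \<in> X \<Longrightarrow> ind x \<in> carr (free_mod X)"
  by (auto simp: free_mod_simps ind_def intro: finite_subset[of _ "{x}"])

lemma spans_free_mod: "spans (free_mod X) (ind ` X :: ('x \<Rightarrow> 'k::comm_ring_1) set)"
proof (rule spansI)
  show "ind ` X \<subseteq> carr (free_mod X)" by (auto simp: ind_closed)
next
  fix N :: "('x \<Rightarrow> 'k) set"
  assume N: "submodule (free_mod X) N" "ind ` X \<subseteq> N"
  have "f \<in> N" if "finite A" "A \<subseteq> X" "{x. f x \<noteq> 0} \<subseteq> A" for f :: "'x \<Rightarrow> 'k" and A
    using that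
  proof (induction A arbitrary: f rule: finite_induct)
    case empty
    then have "f = (\<lambda>x. 0)" by auto
    then show ?case using submoduleD(2)[OF N(1)] by (simp add: free_mod_simps)
  next
    case (insert a A)
    \<comment> \<open>Splitting off one coefficient: \<open>f\<close> is \<open>f(a := 0)\<close>
      plus \<open>f a\<close> times the basis vector at \<open>a\<close>.\<close>
    have "f(a := 0) \<in> N" using insert.prems by (intro insert.IH) auto
    moreover have "(\<lambda>x. f a * ind a x) \<in> N"
      using submoduleD(5)[OF N(1), of "ind a" "f a"] N(2) insert.prems by (auto simp: free_mod_simps)
    ultimately have "(\<lambda>x. (f(a := 0)) x + f a * ind a x) \<in> N"
      using submoduleD(3)[OF N(1)] unfolding free_mod_simps by blast
    moreover have "(\<lambda>x. (f(a := 0)) x + f a * ind a x) = f" by (auto simp: ind_def)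
    ultimately show ?case by simp
  qed
  then show "carr (free_mod X) \<subseteq> N" by (auto simp: free_mod_simps)
qed

lemma free_mod_lift:
  fixes P :: "('k::comm_ring_1, 'p) lalg" and X :: "'x set"
  assumes P: "kmod P" and \<phi>: "\<And>x. x \<in> X \<Longrightarrow> \<phi> x \<in> carr P"
  obtains F where "linmap (free_mod X) P F" "\<And>x. x \<in> X \<Longrightarrow> F (ind x) = \<phi> x"
proof -
  let ?G = "\<lparr>carrier = carr P, mult = ladd P, one = lzero P\<rparr>"
  interpret comm_monoid ?G using P by (rule lmonoid)
  define F where "F f = finprod ?G (\<lambda>x. lsmul P (f x) (\<phi> x)) {x. f x \<noteq> 0}" for f
  \<comment> \<open>Supports can shrink under addition and scaling, so the defining sum is first
    allowed to range over any larger finite set, where two functions can share one index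
    set.\<close>
  have F: "F f = finprod ?G (\<lambda>x. lsmul P (f x) (\<phi> x)) A"
    if "finite A" "A \<subseteq> X" "{x. f x \<noteq> 0} \<subseteq> A" for f A
    unfolding F_def by (rule finprod_mono_neutral_cong_left) (use that P \<phi> in auto)
  have smul: "finprod ?G (\<lambda>x. lsmul P k (g x)) A = lsmul P k (finprod ?G g A)"
    if "finite A" "\<And>x. x \<in> A \<Longrightarrow> g x \<in> carr P" for k g A
    using that
  proof (induction A rule: finite_induct)
    case (insert a A)
    have "g \<in> A \<rightarrow> carrier ?G" using insert.prems by auto
    from finprod_closed[OF this] have "finprod ?G g A \<in> carr P" by simp
    then show ?case
      using insert P by (subst (1 2) finprod_insert) (auto simp: kmod_smul_add)
  qed (use P in simp)
  show thesis
  proof (rule that[of F])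
    show "linmap (free_mod X) P F"
      unfolding linmap_def
    proof (intro conjI ballI allI)
      fix f :: "'x \<Rightarrow> 'k" assume f: "f \<in> carr (free_mod X)"
      then have fin: "finite {x. f x \<noteq> 0}" "{x. f x \<noteq> 0} \<subseteq> X" by (auto simp: free_mod_simps)
      show "F f \<in> carr P"
      proof -
        have "(\<lambda>x. lsmul P (f x) (\<phi> x)) \<in> {x. f x \<noteq> 0} \<rightarrow> carrier ?G"
          using fin P \<phi> by (auto simp: subset_iff)
        from finprod_closed[OF this] show ?thesis by (simp add: F_def)
      qed
      show "F (lsmul (free_mod X) k f) = lsmul P k (F f)" for k
      proof -
        have "F (\<lambda>x. k * f x) = finprod ?G (\<lambda>x. lsmul P (k * f x) (\<phi> x)) {x. f x \<noteq> 0}"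
          by (rule F[OF fin]) auto
        also have "\<dots> = finprod ?G (\<lambda>x. lsmul P k (lsmul P (f x) (\<phi> x))) {x. f x \<noteq> 0}"
          using fin P \<phi> by (intro finprod_cong') (auto simp: kmod_mult_smul subset_iff)
        also have "\<dots> = lsmul P k (F f)"
          unfolding F_def using fin P \<phi> by (intro smul) (auto simp: subset_iff)
        finally show ?thesis by (simp add: free_mod_simps)
      qed
      fix g :: "'x \<Rightarrow> 'k" assume "g \<in> carr (free_mod X)"
      then have "finite {x. g x \<noteq> 0}" "{x. g x \<noteq> 0} \<subseteq> X" by (auto simp: free_mod_simps)
      with fin have A: "finite ({x. f x \<noteq> 0} \<union> {x. g x \<noteq> 0})" "{x. f x \<noteq> 0} \<union> {x. g x \<noteq> 0} \<subseteq> X" by auto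
      let ?A = "{x. f x \<noteq> 0} \<union> {x. g x \<noteq> 0}"
      have "F (\<lambda>x. f x + g x) = finprod ?G (\<lambda>x. lsmul P (f x + g x) (\<phi> x)) ?A"
        by (rule F[OF A]) auto
      also have "\<dots> = finprod ?G (\<lambda>x. lsmul P (f x) (\<phi> x) \<otimes>\<^bsub>?G\<^esub> lsmul P (g x) (\<phi> x)) ?A"
        using A(2) P \<phi> by (intro finprod_cong') (auto simp: kmod_add_smul subset_iff)
      also have "\<dots> = ladd P (finprod ?G (\<lambda>x. lsmul P (f x) (\<phi> x)) ?A) (finprod ?G (\<lambda>x. lsmul P (g x) (\<phi> x)) ?A)"
        using A(2) P \<phi> by (subst finprod_multf) auto
      also have "\<dots> = ladd P (F f) (F g)"
        by (subst (1 2) F[OF A, symmetric]) auto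
      finally show "F (ladd (free_mod X) f g) = ladd P (F f) (F g)" by (simp add: free_mod_simps)
    qed
  next
    fix x assume "x \<in> X"
    then have "F (ind x) = finprod ?G (\<lambda>y. lsmul P (ind x y) (\<phi> y)) {x}"
      by (intro F) (auto simp: ind_def)
    also have "\<dots> = \<phi> x" using P \<phi>[OF \<open>x \<in> X\<close>] by (subst finprod_insert) (auto simp: ind_def)
    finally show "F (ind x) = \<phi> x" .
  qed
qed

lemma tensor_rel_subset:
  assumes "kmod M" "kmod N"
  shows "tensor_rel M N \<subseteq> carr (free_mod (carr M \<times> carr N))"
proof -
  let ?F = "free_mod (carr M \<times> carr N)"
  note F = kmod_free_mod[of "carr M \<times> carr N"]
  have sub: "(\<lambda>t. f t - g t) \<in> carr ?F" if "f \<in> carr ?F" "g \<in> carr ?F" for f g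
    using kmod_sub[OF F that] by (simp add: lsub_def free_mod_simps)
  have sm: "(\<lambda>t. k * f t) \<in> carr ?F" if "f \<in> carr ?F" for f k
    using kmod_smul[OF F that] by (simp add: free_mod_simps)
  show ?thesis
    using assms by (auto simp: tensor_rel_def intro!: sub sm ind_closed)
qed

lemma submodule_tensor_rel:
  "kmod M \<Longrightarrow> kmod N \<Longrightarrow>
    submodule (free_mod (carr M \<times> carr N)) (lspan (free_mod (carr M \<times> carr N)) (tensor_rel M N))"
  by (rule submodule_lspan[OF kmod_free_mod tensor_rel_subset])

lemma kmod_tensor: "kmod M \<Longrightarrow> kmod N \<Longrightarrow> kmod (tensor M N)"
  unfolding tensor_def by (rule kmod_quot[OF kmod_free_mod submodule_tensor_rel])

lemma tmul_closed: "m \<in> carr M \<Longrightarrow> n \<in> carr N \<Longrightarrow> tmul M N m n \<in> carr (tensor M N)"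
  unfolding tensor_def tmul_def by (simp add: ind_closed)

lemma bilin_tmul:
  fixes M :: "('k::comm_ring_1, 'a) lalg" and N :: "('k, 'b) lalg"
  assumes "kmod M" "kmod N"
  shows "bilin M N (tensor M N) (tmul M N)"
proof -
  let ?F = "free_mod (carr M \<times> carr N) :: ('k, 'a \<times> 'b \<Rightarrow> 'k) lalg"
  let ?R = "lspan ?F (tensor_rel M N)"
  note F = kmod_free_mod[of "carr M \<times> carr N"] and R = submodule_tensor_rel[OF assms]
  note sup = subsetD[OF lspan_superset[of "tensor_rel M N" ?F]]
  have eq: "lcoset ?F ?R f = lcoset ?F ?R g"
    if "f \<in> carr ?F" "g \<in> carr ?F" "(\<lambda>t. f t - g t) \<in> tensor_rel M N" for f g
    using that sup by (simp add: lcoset_eq_iff[OF F R] lsub_def free_mod_simps)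
  note I = ind_closed[of _ "carr M \<times> carr N"]
  have add: "lcoset ?F ?R (ind a) = ladd (quot ?F ?R) (lcoset ?F ?R (ind b)) (lcoset ?F ?R (ind c))"
    if "(\<lambda>t. ind a t - ind b t - ind c t) \<in> tensor_rel M N"
      "a \<in> carr M \<times> carr N" "b \<in> carr M \<times> carr N" "c \<in> carr M \<times> carr N" for a b c
    unfolding quot_add[OF F R I[OF that(3)] I[OF that(4)]]
    by (rule eq[OF I[OF that(2)] kmod_add[OF F I[OF that(3)] I[OF that(4)]]])
       (use that(1) in \<open>simp add: free_mod_simps(2) diff_diff_eq\<close>)
  have smul: "lcoset ?F ?R (ind a) = lsmul (quot ?F ?R) k (lcoset ?F ?R (ind b))"
    if "(\<lambda>t. ind a t - k * ind b t) \<in> tensor_rel M N" "a \<in> carr M \<times> carr N" "b \<in> carr M \<times> carr N" for a b k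
    unfolding quot_smul[OF F R I[OF that(3)]]
    by (rule eq[OF I[OF that(2)] kmod_smul[OF F I[OF that(3)]]])
       (use that(1) in \<open>simp add: free_mod_simps(5)\<close>)
  show ?thesis
    unfolding bilin_def
  proof (intro conjI ballI allI)
    fix x y assume x: "x \<in> carr M" and y: "y \<in> carr N"
    show "tmul M N x y \<in> carr (tensor M N)" using x y by (rule tmul_closed)
    show "tmul M N (ladd M x x') y = ladd (tensor M N) (tmul M N x y) (tmul M N x' y)" if "x' \<in> carr M" for x'
      unfolding tmul_def tensor_def
    proof (rule add)
      show "(\<lambda>t. ind (ladd M x x', y) t - ind (x, y) t - ind (x', y) t) \<in> tensor_rel M N"
        unfolding tensor_rel_def using x y that by blast
    qed (use x y that assms in auto)
    show "tmul M N x (ladd N y y') = ladd (tensor M N) (tmul M N x y) (tmul M N x y')" if "y' \<in> carr N" for y'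
      unfolding tmul_def tensor_def
    proof (rule add)
      show "(\<lambda>t. ind (x, ladd N y y') t - ind (x, y) t - ind (x, y') t) \<in> tensor_rel M N"
        unfolding tensor_rel_def using x y that by blast
    qed (use x y that assms in auto)
    fix k
    show "tmul M N (lsmul M k x) y = lsmul (tensor M N) k (tmul M N x y)"
      unfolding tmul_def tensor_def
    proof (rule smul)
      show "(\<lambda>t. ind (lsmul M k x, y) t - k * ind (x, y) t) \<in> tensor_rel M N"
        unfolding tensor_rel_def using x y by blast
    qed (use x y assms in auto)
    show "tmul M N x (lsmul N k y) = lsmul (tensor M N) k (tmul M N x y)"
      unfolding tmul_def tensor_def
    proof (rule smul)
      show "(\<lambda>t. ind (x, lsmul N k y) t - k * ind (x, y) t) \<in> tensor_rel M N"
        unfolding tensor_rel_def using x y by blast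
    qed (use x y assms in auto)
  qed
qed

lemma spans_tensor:
  assumes "kmod M" "kmod N"
  shows "spans (tensor M N) {tmul M N m n | m n. m \<in> carr M \<and> n \<in> carr N}"
proof -
  have "{tmul M N m n | m n. m \<in> carr M \<and> n \<in> carr N} =
      lcoset (free_mod (carr M \<times> carr N)) (lspan (free_mod (carr M \<times> carr N)) (tensor_rel M N))
        ` ind ` (carr M \<times> carr N)"
    by (auto simp: tmul_def image_iff)
  then show ?thesis
    using spans_quot[OF kmod_free_mod submodule_tensor_rel[OF assms] spans_free_mod]
    by (simp add: tensor_def)
qed

lemma tensor_lift:
  fixes M :: "('k::comm_ring_1, 'a) lalg" and N :: "('k, 'b) lalg"
  assumes "kmod M" "kmod N" "kmod P" "bilin M N P p"
  obtains f where "linmap (tensor M N) P f"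
    "\<And>m n. m \<in> carr M \<Longrightarrow> n \<in> carr N \<Longrightarrow> f (tmul M N m n) = p m n"
proof -
  let ?F = "free_mod (carr M \<times> carr N) :: ('k, 'a \<times> 'b \<Rightarrow> 'k) lalg"
  let ?R = "lspan ?F (tensor_rel M N)"
  note F = kmod_free_mod[of "carr M \<times> carr N"]
  have cl: "(case t of (m, n) \<Rightarrow> p m n) \<in> carr P" if "t \<in> carr M \<times> carr N" for t
    using that bilin_closed[OF assms(4)] by auto
  obtain f where f: "linmap ?F P f" "\<And>t. t \<in> carr M \<times> carr N \<Longrightarrow> f (ind t) = (case t of (m, n) \<Rightarrow> p m n)"
    by (rule free_mod_lift[OF assms(3) cl]) auto
  have sub: "f (\<lambda>t. g t - h t) = lsub P (f g) (f h)" if "g \<in> carr ?F" "h \<in> carr ?F" for g h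
    using linmap_sub[OF F assms(3) f(1) that] by (simp add: lsub_def free_mod_simps)
  have sm: "f (\<lambda>t. k * g t) = lsmul P k (f g)" if "g \<in> carr ?F" for g k
    using linmap_smul[OF f(1) that] by (simp add: free_mod_simps)
  have subc: "(\<lambda>t. g t - h t) \<in> carr ?F" if "g \<in> carr ?F" "h \<in> carr ?F" for g h
    using kmod_sub[OF F that] by (simp add: lsub_def free_mod_simps)
  have smc: "(\<lambda>t. k * g t) \<in> carr ?F" if "g \<in> carr ?F" for g k
    using kmod_smul[OF F that] by (simp add: free_mod_simps)
  note B = bilin_closed[OF assms(4)] bilin_add_left[OF assms(4)] bilin_add_right[OF assms(4)]
    bilin_smul_left[OF assms(4)] bilin_smul_right[OF assms(4)]
  have "f r = lzero P" if "r \<in> tensor_rel M N" for r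
    using that assms(1-3) unfolding tensor_rel_def
    by (auto simp: sub sm subc smc ind_closed f(2) B lsub_def kmod_neg_add kmod_ac)
  then have "tensor_rel M N \<subseteq> {x \<in> carr ?F. f x = lzero P}"
    using tensor_rel_subset[OF assms(1,2)] by blast
  then have "?R \<subseteq> {x \<in> carr ?F. f x = lzero P}"
    by (rule lspan_subset[OF submodule_kernel[OF F assms(3) f(1)]])
  then obtain g where "linmap (quot ?F ?R) P g" "\<And>x. x \<in> carr ?F \<Longrightarrow> g (lcoset ?F ?R x) = f x"
    using quot_lift[OF F submodule_tensor_rel[OF assms(1,2)] assms(3) f(1)] by blast
  then show thesis using that f(2) by (simp add: tensor_def tmul_def ind_closed)
qed

subsection \<open>Leibniz algebras and cocycles\<close>

lemma leibniz_kmod: "leibniz L \<Longrightarrow> kmod L"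
  by (simp add: leibniz_def)

text \<open>This is the Leibniz identity with the outer bracket replaced by \<open>T\<close>, so the
  bracket of a Leibniz algebra is itself a cocycle. It is also what makes \<open>cext W L T\<close>
  a Leibniz algebra.\<close>

definition cocycle :: "('k::comm_ring_1, 'a) lalg \<Rightarrow> ('k, 'b) lalg \<Rightarrow> ('a \<Rightarrow> 'a \<Rightarrow> 'b) \<Rightarrow> bool" where
  "cocycle L W T \<longleftrightarrow> bilin L L W T \<and>
     (\<forall>x\<in>carr L. \<forall>y\<in>carr L. \<forall>z\<in>carr L.
        T x (lbr L y z) = lsub W (T (lbr L x y) z) (T (lbr L x z) y))"

lemma leibniz_iff: "leibniz L \<longleftrightarrow> kmod L \<and> cocycle L L (lbr L)"
  unfolding leibniz_def cocycle_def bilin_def by meson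

lemma cocycleD: "cocycle L W T \<Longrightarrow> x \<in> carr L \<Longrightarrow> y \<in> carr L \<Longrightarrow> z \<in> carr L
    \<Longrightarrow> T x (lbr L y z) = lsub W (T (lbr L x y) z) (T (lbr L x z) y)"
  by (simp add: cocycle_def)

lemma cocycle_bilin: "cocycle L W T \<Longrightarrow> bilin L L W T"
  by (simp add: cocycle_def)

lemma leibniz_cocycle: "leibniz L \<Longrightarrow> cocycle L L (lbr L)"
  by (simp add: leibniz_iff)

lemma leibniz_bilin: "leibniz L \<Longrightarrow> bilin L L L (lbr L)"
  by (simp add: leibniz_iff cocycle_def)

lemma linmap_cocycle:
  assumes "kmod W" "kmod W'" "cocycle L W T" "linmap W W' h" "leibniz L"
  shows "cocycle L W' (\<lambda>x y. h (T x y))"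
  using assms linmap_bilin[OF cocycle_bilin[OF assms(3)] assms(4)]
    bilin_closed[OF cocycle_bilin[OF assms(3)]] bilin_closed[OF leibniz_bilin[OF assms(5)]]
  by (auto simp: cocycle_def[of L W'] cocycleD[OF assms(3)] linmap_sub)

text \<open>Written for arbitrary \<open>W\<close> and \<open>T\<close>: it yields
  \<open>hat_stl3\<close> when \<open>T\<close> is \<open>psi\<close>, and it is the target of the
  lifting argument in \<open>cocycle_coboundary\<close>.\<close>

definition cext :: "('k::comm_ring_1, 'b) lalg \<Rightarrow> ('k, 'a) lalg \<Rightarrow> ('a \<Rightarrow> 'a \<Rightarrow> 'b) \<Rightarrow> ('k, 'b \<times> 'a) lalg" where
  "cext W L T = \<lparr> carr = carr W \<times> carr L,
       ladd = (\<lambda>(c, x) (c', y). (ladd W c c', ladd L x y)),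
       lzero = (lzero W, lzero L),
       lneg = (\<lambda>(c, x). (lneg W c, lneg L x)),
       lsmul = (\<lambda>k (c, x). (lsmul W k c, lsmul L k x)),
       lbr = (\<lambda>(c, x) (c', y). (T x y, lbr L x y)) \<rparr>"

lemma cext_simps [simp]:
  "carr (cext W L T) = carr W \<times> carr L"
  "ladd (cext W L T) (c, x) (c', y) = (ladd W c c', ladd L x y)"
  "lzero (cext W L T) = (lzero W, lzero L)"
  "lneg (cext W L T) (c, x) = (lneg W c, lneg L x)"
  "lsmul (cext W L T) k (c, x) = (lsmul W k c, lsmul L k x)"
  "lbr (cext W L T) (c, x) (c', y) = (T x y, lbr L x y)"
  by (simp_all add: cext_def)

lemma lsub_cext [simp]: "lsub (cext W L T) (c, x) (c', y) = (lsub W c c', lsub L x y)"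
  by (simp add: lsub_def)

lemma kmod_cext: "kmod W \<Longrightarrow> kmod L \<Longrightarrow> kmod (cext W L T)"
  unfolding kmod_def[of "cext W L T"]
  by (auto simp: kmod_ac kmod_smul_add kmod_add_smul kmod_mult_smul)

lemma leibniz_cext:
  assumes "kmod W" "leibniz L" "cocycle L W T"
  shows "leibniz (cext W L T)"
proof -
  have T: "bilin L L W T" and L: "bilin L L L (lbr L)"
    using assms by (auto simp: cocycle_bilin leibniz_bilin)
  have "bilin (cext W L T) (cext W L T) (cext W L T) (lbr (cext W L T))"
    unfolding bilin_def
    by (auto simp: bilin_closed[OF T] bilin_closed[OF L] bilin_add_left[OF T] bilin_add_left[OF L]
        bilin_add_right[OF T] bilin_add_right[OF L] bilin_smul_left[OF T] bilin_smul_left[OF L]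
        bilin_smul_right[OF T] bilin_smul_right[OF L])
  then show ?thesis
    using assms(1,2) cocycleD[OF assms(3)] cocycleD[OF leibniz_cocycle[OF assms(2)]]
    by (auto simp: leibniz_iff[of "cext W L T"] cocycle_def[of "cext W L T"] kmod_cext leibniz_kmod)
qed

subsection \<open>The free non-associative algebra\<close>

primrec mtree_eval :: "('g \<Rightarrow> 'a) \<Rightarrow> ('a \<Rightarrow> 'a \<Rightarrow> 'a) \<Rightarrow> 'g mtree \<Rightarrow> 'a" where
  "mtree_eval Y b (Leaf g) = Y g"
| "mtree_eval Y b (Node u v) = b (mtree_eval Y b u) (mtree_eval Y b v)"

abbreviation trees :: "(nat \<times> nat \<times> 'r) mtree set" where
  "trees \<equiv> {t. set_mtree t \<subseteq> gens}"

lemma free_magma_simps: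
  "carr (free_magma_alg sR) = carr (free_mod trees)"
  "ladd (free_magma_alg sR) = ladd (free_mod trees)" "lzero (free_magma_alg sR) = lzero (free_mod trees)"
  "lneg (free_magma_alg sR) = lneg (free_mod trees)" "lsmul (free_magma_alg sR) = lsmul (free_mod trees)"
  "lbr (free_magma_alg sR) = (\<lambda>f g t. case t of Leaf _ \<Rightarrow> 0 | Node u v \<Rightarrow> f u * g v)"
  by (simp_all add: free_magma_alg_def)

lemma kmod_free_magma: "kmod (free_magma_alg sR)"
  using kmod_free_mod[of trees] unfolding kmod_def free_magma_simps .

lemma submodule_free_magma: "submodule (free_magma_alg sR) N \<longleftrightarrow> submodule (free_mod trees) N"
  unfolding submodule_def free_magma_simps ..

lemma linmap_free_magma: "linmap (free_magma_alg sR) P f \<longleftrightarrow> linmap (free_mod trees) P f"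
  unfolding linmap_def free_magma_simps ..

lemma spans_free_magma: "spans (free_magma_alg sR) (ind ` trees)"
  using spans_free_mod[of trees] unfolding spans_def submodule_free_magma free_magma_simps(1) .

lemma bilin_free_magma:
  fixes sR :: "'k::comm_ring_1 \<Rightarrow> 'r::ring_1 \<Rightarrow> 'r"
  shows   "bilin (free_magma_alg sR) (free_magma_alg sR) (free_magma_alg sR) (lbr (free_magma_alg sR))"
proof -
  have fin: "finite {t. (case t of Leaf _ \<Rightarrow> 0 | Node u v \<Rightarrow> f u * g v) \<noteq> 0}"
    if "finite {x. f x \<noteq> 0}" "finite {x. g x \<noteq> 0}" for f g :: "(nat \<times> nat \<times> 'r) mtree \<Rightarrow> 'k"
  proof (rule finite_subset[OF _ finite_imageI[OF finite_cartesian_product[OF that]]])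
    show "{t. (case t of Leaf _ \<Rightarrow> 0 | Node u v \<Rightarrow> f u * g v) \<noteq> 0}
        \<subseteq> (\<lambda>(u, v). Node u v) ` ({x. f x \<noteq> 0} \<times> {x. g x \<noteq> 0})"
    proof
      fix t assume "t \<in> {t. (case t of Leaf _ \<Rightarrow> 0 | Node u v \<Rightarrow> f u * g v) \<noteq> 0}"
      then show "t \<in> (\<lambda>(u, v). Node u v) ` ({x. f x \<noteq> 0} \<times> {x. g x \<noteq> 0})"
        by (cases t) (force simp: image_iff)+
    qed
  qed
  have tr: "set_mtree t \<subseteq> gens"
    if "{x. f x \<noteq> 0} \<subseteq> trees" "{x. g x \<noteq> 0} \<subseteq> trees" "(case t of Leaf _ \<Rightarrow> 0 | Node u v \<Rightarrow> f u * g v) \<noteq> 0"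
    for f g :: "(nat \<times> nat \<times> 'r) mtree \<Rightarrow> 'k" and t
  proof (cases t)
    case (Node u v)
    then have "f u \<noteq> 0" "g v \<noteq> 0" using that(3) by auto
    then have "u \<in> trees" "v \<in> trees" using that(1,2) by blast+
    then show ?thesis using Node by simp
  qed (use that in simp)
  show ?thesis
    unfolding bilin_def free_magma_simps free_mod_simps
  proof (intro conjI ballI allI, goal_cases)
    case (1 f g)
    then show ?case using fin[of f g] tr[of f g] by blast
  qed (auto simp: fun_eq_iff algebra_simps split: mtree.splits)
qed

lemma free_magma_br_ind: "lbr (free_magma_alg sR) (ind u) (ind v) = ind (Node u v)"
  by (auto simp: free_magma_simps fun_eq_iff ind_def split: mtree.splits)

text \<open>Trees form a basis, so evaluation of trees in \<open>P\<close> extends linearly.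
  Multiplicativity need only be checked on pairs of trees, where grafting evaluates to the
  bracket.\<close>

lemma free_magma_lift:
  fixes sR :: "'k::comm_ring_1 \<Rightarrow> 'r::ring_1 \<Rightarrow> 'r"
  assumes P: "kmod P" "bilin P P P (lbr P)" and Y: "\<And>g. g \<in> gens \<Longrightarrow> Y g \<in> carr P"
  obtains f where "lhom (free_magma_alg sR) P f" "\<And>g. g \<in> gens \<Longrightarrow> f (ind (Leaf g)) = Y g"
proof -
  let ?F = "free_magma_alg sR :: ('k, (nat \<times> nat \<times> 'r) mtree \<Rightarrow> 'k) lalg"
  note F = kmod_free_magma[of sR]
  let ?ev = "mtree_eval Y (lbr P)"
  have ev: "?ev t \<in> carr P" if "t \<in> trees" for t
    using that
  proof (induction t)
    case (Node u v)
    then have "u \<in> trees" "v \<in> trees" by simp_all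
    then show ?case using Node.IH bilin_closed[OF P(2)] by simp
  qed (simp add: Y)
  obtain f where f: "linmap (free_mod trees) P f" "\<And>t. t \<in> trees \<Longrightarrow> f (ind t) = ?ev t"
    by (rule free_mod_lift[where X = trees and \<phi> = ?ev, OF P(1) ev], assumption, rule that)
  have lin: "linmap ?F P f" using f(1) by (simp add: linmap_free_magma)
  have br: "f (lbr ?F x y) = lbr P (f x) (f y)" if "x \<in> carr ?F" "y \<in> carr ?F" for x y
    by (rule spans_bilin_eq[OF F F P(1) linmap_bilin[OF bilin_free_magma lin] bilin_comp[OF P(2) lin lin]
          spans_free_magma spans_free_magma _ that])
       (auto simp: free_magma_br_ind f(2))
  show thesis by (rule that[of f]) (auto simp: lhom_def lin br f(2))
qed

lemma lideal_ideal_gen: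
  assumes "kmod M" "bilin M M M (lbr M)" "S \<subseteq> carr M"
  shows "lideal M (ideal_gen M S)"
proof -
  \<comment> \<open>The carrier is an ideal containing \<open>S\<close>, so the intersection
    defining \<open>ideal_gen\<close> is over a nonempty family.\<close>
  have "lideal M (carr M)"
    using assms(1) bilin_closed[OF assms(2)] by (auto simp: lideal_def submodule_carr)
  then have "{N. lideal M N \<and> S \<subseteq> N} \<noteq> {}" using assms(3) by blast
  moreover have "submodule M (ideal_gen M S)"
    unfolding ideal_gen_def using calculation by (intro submodule_Inter) (auto simp: lideal_def)
  ultimately show ?thesis unfolding lideal_def[of M "ideal_gen M S"] ideal_gen_def
    by (auto simp: lideal_def)
qed

lemma ideal_gen_superset: "S \<subseteq> ideal_gen M S"
  by (auto simp: ideal_gen_def)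

lemma ideal_gen_subset: "lideal M N \<Longrightarrow> S \<subseteq> N \<Longrightarrow> ideal_gen M S \<subseteq> N"
  by (auto simp: ideal_gen_def)

subsection \<open>The Steinberg Leibniz algebra\<close>

definition distinct3 :: "nat \<Rightarrow> nat \<Rightarrow> nat \<Rightarrow> bool" where
  "distinct3 i j k \<longleftrightarrow> i \<in> idx3 \<and> j \<in> idx3 \<and> k \<in> idx3 \<and> i \<noteq> j \<and> j \<noteq> k \<and> i \<noteq> k"

definition distinct2 :: "nat \<Rightarrow> nat \<Rightarrow> bool" where
  "distinct2 i j \<longleftrightarrow> i \<in> idx3 \<and> j \<in> idx3 \<and> i \<noteq> j"

lemma distinct3D:
  assumes "distinct3 i j k"
  shows "distinct2 i j" "distinct2 j i" "distinct2 i k" "distinct2 k i" "distinct2 j k" "distinct2 k j"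
    "distinct3 i k j" "distinct3 j i k" "distinct3 j k i" "distinct3 k i j" "distinct3 k j i"
    "i \<noteq> j" "j \<noteq> i" "j \<noteq> k" "k \<noteq> j" "i \<noteq> k" "k \<noteq> i"
  using assms by (auto simp: distinct3_def distinct2_def)

lemma distinct2_sym: "distinct2 i j \<Longrightarrow> distinct2 j i"
  by (auto simp: distinct2_def)

lemma idx3_iff: "i \<in> idx3 \<longleftrightarrow> i = 1 \<or> i = 2 \<or> i = 3"
  by (simp add: idx3_def)

text \<open>Since 1 + 2 + 3 = 6, the third index has a closed form; this lets
  \<open>cocycle_coboundary\<close> define its lifts by a formula in \<open>i\<close> and
  \<open>j\<close>.\<close>

lemma distinct3_third: "distinct2 i j \<Longrightarrow> distinct3 i j (6 - i - j)"
  unfolding distinct2_def distinct3_def idx3_iff by auto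

lemma distinct2_third:
  assumes "distinct2 i j"
  obtains k where "distinct3 i j k"
  using distinct3_third[OF assms] by (rule that)

lemma distinct3_elem: "distinct3 i j k \<Longrightarrow> p \<in> idx3 \<Longrightarrow> p = i \<or> p = j \<or> p = k"
  unfolding distinct3_def idx3_iff by auto

lemma distinct3_cases:
  assumes "distinct3 i j k" "distinct2 p q"
  obtains "p = i" "q = j" | "p = j" "q = i" | "p = i" "q = k" | "p = k" "q = i"
    | "p = j" "q = k" | "p = k" "q = j"
  using assms(2) distinct3_elem[OF assms(1), of p] distinct3_elem[OF assms(1), of q]
  unfolding distinct2_def by metis

text \<open>The defining relations apart from the Leibniz identity, stated for any structure
  \<open>P\<close>, so that the presentation becomes a universal property in
  \<open>stl_lift\<close>.\<close>

definition steinberg :: "('k::comm_ring_1 \<Rightarrow> 'r::ring_1 \<Rightarrow> 'r) \<Rightarrow> ('k, 'a) lalg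
    \<Rightarrow> (nat \<Rightarrow> nat \<Rightarrow> 'r \<Rightarrow> 'a) \<Rightarrow> bool" where
  "steinberg sR P Y \<longleftrightarrow>
     (\<forall>i j. distinct2 i j \<longrightarrow> linmap (rmod sR) P (Y i j)) \<and>
     (\<forall>i j k a b. distinct3 i j k \<longrightarrow> lbr P (Y i j a) (Y j k b) = Y i k (a * b)) \<and>
     (\<forall>i j k a b. distinct3 i j k \<longrightarrow> lbr P (Y i j a) (Y k i b) = lneg P (Y k j (b * a))) \<and>
     (\<forall>i j k l a b. distinct2 i j \<longrightarrow> distinct2 k l \<longrightarrow> j \<noteq> k \<longrightarrow> i \<noteq> l \<longrightarrow>
        lbr P (Y i j a) (Y k l b) = lzero P)"

lemma steinbergD:
  assumes "steinberg sR P Y"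
  shows "distinct2 i j \<Longrightarrow> linmap (rmod sR) P (Y i j)"
    "distinct3 i j k \<Longrightarrow> lbr P (Y i j a) (Y j k b) = Y i k (a * b)"
    "distinct3 i j k \<Longrightarrow> lbr P (Y i j a) (Y k i b) = lneg P (Y k j (b * a))"
    "distinct2 i j \<Longrightarrow> distinct2 k l \<Longrightarrow> j \<noteq> k \<Longrightarrow> i \<noteq> l \<Longrightarrow> lbr P (Y i j a) (Y k l b) = lzero P"
  using assms by (simp_all add: steinberg_def)

lemma rmod_simps [simp]:
  "carr (rmod sR) = UNIV" "ladd (rmod sR) = (+)" "lzero (rmod sR) = 0" "lneg (rmod sR) = uminus"
  "lsmul (rmod sR) = sR"
  by (simp_all add: rmod_def)

lemma lsub_rmod [simp]: "lsub (rmod sR) a b = a - b"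
  by (simp add: lsub_def)

locale kalg =
  fixes sR :: "'k::comm_ring_1 \<Rightarrow> 'r::ring_1 \<Rightarrow> 'r"
  assumes kalgebra: "kalgebra sR"
begin

lemma sR_simps:
  "sR k (a + b) = sR k a + sR k b" "sR (k + l) a = sR k a + sR l a" "sR (k * l) a = sR k (sR l a)"
  "sR 1 a = a" "sR k a * b = sR k (a * b)" "a * sR k b = sR k (a * b)" "sR k 0 = 0" "sR 0 a = 0"
  "sR k (- a) = - sR k a" "sR (- k) a = - sR k a" "sR k (a - b) = sR k a - sR k b"
proof -
  have m: "module sR" and *: "\<And>k a b. sR k (a * b) = sR k a * b \<and> sR k (a * b) = a * sR k b"
    using kalgebra unfolding kalgebra_def by blast+
  interpret module sR by (rule m)
  show "sR k a * b = sR k (a * b)" "a * sR k b = sR k (a * b)" using * by metis+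
qed (insert kalgebra, simp_all add: kalgebra_def module.scale_right_distrib module.scale_left_distrib
      module.scale_one module.scale_zero_right module.scale_zero_left module.scale_minus_right
      module.scale_minus_left module.scale_right_diff_distrib module.scale_scale)

lemma kmod_rmod: "kmod (rmod sR)"
  by (simp add: kmod_def sR_simps)

section \<open>The presentation of stl_3(R) and its universal property\<close>

abbreviation F where "F \<equiv> free_magma_alg sR"
abbreviation I where "I \<equiv> ideal_gen F (stl_rels sR)"
abbreviation L where "L \<equiv> stl3 sR"
abbreviation X where "X \<equiv> stlX sR"

lemma fX_closed: "distinct2 i j \<Longrightarrow> fX i j a \<in> carr F"
  by (auto simp: fX_def free_magma_simps gens_def distinct2_def intro!: ind_closed)

lemma stl_rels_cases:
  assumes "r \<in> stl_rels sR"
  obtains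
    (jacobi) x y z where "x \<in> carr F" "y \<in> carr F" "z \<in> carr F"
      "r = lsub F (lbr F x (lbr F y z)) (lsub F (lbr F (lbr F x y) z) (lbr F (lbr F x z) y))"
  | (linear) i j k a b where "distinct2 i j"
      "r = lsub F (fX i j (sR k a + b)) (ladd F (lsmul F k (fX i j a)) (fX i j b))"
  | (br1) i j k a b where "distinct3 i j k" "r = lsub F (lbr F (fX i j a) (fX j k b)) (fX i k (a * b))"
  | (br2) i j k a b where "distinct3 i j k" "r = ladd F (lbr F (fX i j a) (fX k i b)) (fX k j (b * a))"
  | (br0) i j k l a b where "distinct2 i j" "distinct2 k l" "j \<noteq> k" "i \<noteq> l" "r = lbr F (fX i j a) (fX k l b)"
  using assms unfolding stl_rels_def Let_def Un_iff
proof (elim disjE, goal_cases)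
  case 1
  then show ?thesis unfolding mem_Collect_eq
    by (elim exE conjE) (rule jacobi[rotated 3], assumption, simp_all)
next
  case 2
  then show ?thesis unfolding mem_Collect_eq
    by (elim exE conjE) (rule linear[rotated 1], assumption, simp_all add: distinct2_def)
next
  case 3
  then show ?thesis unfolding mem_Collect_eq
    by (elim exE conjE) (rule br1[rotated 1], assumption, simp_all add: distinct3_def)
next
  case 4
  then show ?thesis unfolding mem_Collect_eq
    by (elim exE conjE) (rule br2[rotated 1], assumption, simp_all add: distinct3_def)
next
  case 5
  then show ?thesis unfolding mem_Collect_eq
    by (elim exE conjE) (rule br0[rotated 4], assumption, simp_all add: distinct2_def)
qed

lemma stl_rels_jacobi: "x \<in> carr F \<Longrightarrow> y \<in> carr F \<Longrightarrow> z \<in> carr F \<Longrightarrow>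
    lsub F (lbr F x (lbr F y z)) (lsub F (lbr F (lbr F x y) z) (lbr F (lbr F x z) y)) \<in> stl_rels sR"
  unfolding stl_rels_def Let_def
  by (rule UnI1, rule UnI1, rule UnI1, rule UnI1, intro CollectI exI conjI, rule refl) assumption+

lemma stl_rels_linear: "distinct2 i j \<Longrightarrow>
    lsub F (fX i j (sR k a + b)) (ladd F (lsmul F k (fX i j a)) (fX i j b)) \<in> stl_rels sR"
  unfolding stl_rels_def Let_def distinct2_def
  by (rule UnI1, rule UnI1, rule UnI1, rule UnI2, intro CollectI exI conjI, rule refl) simp_all

lemma stl_rels_br1: "distinct3 i j k \<Longrightarrow>
    lsub F (lbr F (fX i j a) (fX j k b)) (fX i k (a * b)) \<in> stl_rels sR"
  unfolding stl_rels_def Let_def distinct3_def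
  by (rule UnI1, rule UnI1, rule UnI2, intro CollectI exI conjI, rule refl) simp_all

lemma stl_rels_br2: "distinct3 i j k \<Longrightarrow>
    ladd F (lbr F (fX i j a) (fX k i b)) (fX k j (b * a)) \<in> stl_rels sR"
  unfolding stl_rels_def Let_def distinct3_def
  by (rule UnI1, rule UnI2, intro CollectI exI conjI, rule refl) simp_all

lemma stl_rels_br0: "distinct2 i j \<Longrightarrow> distinct2 k l \<Longrightarrow> j \<noteq> k \<Longrightarrow> i \<noteq> l \<Longrightarrow>
    lbr F (fX i j a) (fX k l b) \<in> stl_rels sR"
  unfolding stl_rels_def Let_def distinct2_def
  by (rule UnI2, intro CollectI exI conjI, rule refl) simp_all

lemma stl_rels_subset: "stl_rels sR \<subseteq> carr F"
proof
  note K = kmod_free_magma[of sR] and B = bilin_closed[OF bilin_free_magma[of sR]]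
  note C = kmod_sub[OF K] kmod_add[OF K] kmod_smul[OF K] B fX_closed
  fix r assume "r \<in> stl_rels sR"
  then show "r \<in> carr F"
    by (cases rule: stl_rels_cases) (auto intro!: C dest: distinct3D)
qed

lemma ideal_I: "lideal F I"
  by (rule lideal_ideal_gen[OF kmod_free_magma bilin_free_magma stl_rels_subset])

lemma submodule_I: "submodule F I"
  using ideal_I by (simp add: lideal_def)

lemma rel_in_I: "r \<in> stl_rels sR \<Longrightarrow> r \<in> I"
  by (rule subsetD[OF ideal_gen_superset])

lemma kmod_L: "kmod L"
  unfolding stl3_def by (rule kmod_quot[OF kmod_free_magma submodule_I])

lemma linmap_proj: "linmap F L (lcoset F I)"
  unfolding stl3_def by (rule linmap_lcoset[OF kmod_free_magma submodule_I])

lemma proj_br: "x \<in> carr F \<Longrightarrow> y \<in> carr F \<Longrightarrow> lbr L (lcoset F I x) (lcoset F I y) = lcoset F I (lbr F x y)"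
  unfolding stl3_def by (rule quot_br[OF kmod_free_magma ideal_I bilin_free_magma])

lemma proj_eqI: "lsub F x y \<in> stl_rels sR \<Longrightarrow> x \<in> carr F \<Longrightarrow> y \<in> carr F \<Longrightarrow> lcoset F I x = lcoset F I y"
  by (rule lcoset_eqI[OF kmod_free_magma submodule_I _ _ rel_in_I])

lemma carr_L: "carr L = lcoset F I ` carr F"
  by (simp add: stl3_def quot_carr)

lemma leibniz_L: "leibniz L"
proof -
  note K = kmod_free_magma[of sR] and B = bilin_closed[OF bilin_free_magma[of sR]]
  have "bilin L L L (lbr L)"
    unfolding stl3_def by (rule bilin_quot_br[OF K ideal_I bilin_free_magma])
  moreover have "lbr L (lcoset F I x) (lbr L (lcoset F I y) (lcoset F I z)) =
      lsub L (lbr L (lbr L (lcoset F I x) (lcoset F I y)) (lcoset F I z))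
        (lbr L (lbr L (lcoset F I x) (lcoset F I z)) (lcoset F I y))"
    if "x \<in> carr F" "y \<in> carr F" "z \<in> carr F" for x y z
  proof -
    have "lcoset F I (lbr F x (lbr F y z)) = lcoset F I (lsub F (lbr F (lbr F x y) z) (lbr F (lbr F x z) y))"
      by (rule proj_eqI[OF stl_rels_jacobi[OF that]]) (use that K B in simp_all)
    then show ?thesis
      using that B by (simp add: proj_br linmap_sub[OF K kmod_L linmap_proj])
  qed
  ultimately show ?thesis unfolding leibniz_iff cocycle_def carr_L by (simp add: kmod_L)
qed

lemma stlX_eq_lcoset: "X i j a = lcoset F I (fX i j a)"
  by (simp add: stlX_def)

lemma steinberg_L: "steinberg sR L X"
proof -
  note K = kmod_free_magma[of sR] and B = bilin_closed[OF bilin_free_magma[of sR]]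
  have cl: "X i j a \<in> carr L" if "distinct2 i j" for i j a
    by (simp add: stlX_eq_lcoset carr_L fX_closed that)
  have lin: "X i j (sR k a + b) = ladd L (lsmul L k (X i j a)) (X i j b)" if d: "distinct2 i j" for i j k a b
  proof -
    have "lcoset F I (fX i j (sR k a + b)) = lcoset F I (ladd F (lsmul F k (fX i j a)) (fX i j b))"
      by (rule proj_eqI[OF stl_rels_linear[OF d]]) (use d K in \<open>simp_all add: fX_closed\<close>)
    then show ?thesis
      using d K by (simp add: stlX_eq_lcoset linmap_add[OF linmap_proj] linmap_smul[OF linmap_proj] fX_closed)
  qed
  \<comment> \<open>The single linearity relator combines addition and scaling. With zero arguments
    it forces \<open>X i j 0\<close> to be zero, after which \<open>b = 0\<close> isolates the
    scaling law.\<close>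
  have X0: "X i j 0 = lzero L" if d: "distinct2 i j" for i j
  proof -
    have "X i j 0 = ladd L (X i j 0) (X i j 0)" using lin[OF d, of 1 0 0] cl[OF d] by (simp add: sR_simps kmod_L)
    then show ?thesis using cl[OF d] kmod_L by (metis kmod_0_right kmod_cancel kmod_zero)
  qed
  have "linmap (rmod sR) L (X i j)" if d: "distinct2 i j" for i j
    unfolding linmap_def using lin[OF d, of 1] lin[OF d, of _ _ 0] cl[OF d] X0[OF d]
    by (simp add: sR_simps kmod_L)
  moreover have "lbr L (X i j a) (X j k b) = X i k (a * b)" if d: "distinct3 i j k" for i j k a b
  proof -
    have "lcoset F I (lbr F (fX i j a) (fX j k b)) = lcoset F I (fX i k (a * b))"
      by (rule proj_eqI[OF stl_rels_br1[OF d]]) (use distinct3D[OF d] B in \<open>simp_all add: fX_closed\<close>)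
    then show ?thesis using distinct3D[OF d] by (simp add: stlX_eq_lcoset proj_br fX_closed)
  qed
  moreover have "lbr L (X i j a) (X k i b) = lneg L (X k j (b * a))" if d: "distinct3 i j k" for i j k a b
  proof -
    have "lsub F (lbr F (fX i j a) (fX k i b)) (lneg F (fX k j (b * a)))
        = ladd F (lbr F (fX i j a) (fX k i b)) (fX k j (b * a))"
      using distinct3D[OF d] by (simp add: lsub_def K fX_closed)
    then have "lcoset F I (lbr F (fX i j a) (fX k i b)) = lcoset F I (lneg F (fX k j (b * a)))"
      using distinct3D[OF d] B K stl_rels_br2[OF d] by (intro proj_eqI) (simp_all add: fX_closed)
    then show ?thesis
      using distinct3D[OF d] by (simp add: stlX_eq_lcoset proj_br fX_closed linmap_neg[OF K kmod_L linmap_proj])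
  qed
  moreover have "lbr L (X i j a) (X k l b) = lzero L"
    if d: "distinct2 i j" "distinct2 k l" "j \<noteq> k" "i \<noteq> l" for i j k l a b
  proof -
    have r: "lbr F (fX i j a) (fX k l b) \<in> stl_rels sR"
      by (rule stl_rels_br0[OF d])
    have "lcoset F I (lbr F (fX i j a) (fX k l b)) = lcoset F I (lzero F)"
      using d r B K by (intro proj_eqI) (simp_all add: fX_closed lsub_def)
    then show ?thesis
      using d by (simp add: stlX_eq_lcoset proj_br fX_closed linmap_zero[OF K kmod_L linmap_proj])
  qed
  ultimately show ?thesis unfolding steinberg_def by simp
qed

text \<open>The homomorphism from the free algebra kills the relators because \<open>P\<close>
  satisfies the relations. Its kernel is an ideal, hence contains \<open>I\<close>, so the map
  descends to the quotient.\<close>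

lemma stl_lift:
  assumes "leibniz P" "steinberg sR P Y"
  obtains f where "lhom L P f" "\<And>i j a. distinct2 i j \<Longrightarrow> f (X i j a) = Y i j a"
proof -
  note K = kmod_free_magma[of sR] and B = bilin_closed[OF bilin_free_magma[of sR]]
  note P = leibniz_kmod[OF assms(1)] and PB = leibniz_bilin[OF assms(1)]
  have lin: "linmap (rmod sR) P (Y i j)" if "distinct2 i j" for i j
    using that by (rule steinbergD(1)[OF assms(2)])
  have Y: "Y i j a \<in> carr P" if "distinct2 i j" for i j a
    using linmap_closed[OF lin[OF that]] by simp
  have cl: "(case g of (i, j, a) \<Rightarrow> Y i j a) \<in> carr P" if "g \<in> gens" for g
    using that Y by (auto simp: gens_def distinct2_def)
  obtain f where f: "lhom F P f" "\<And>g. g \<in> gens \<Longrightarrow> f (ind (Leaf g)) = (case g of (i, j, a) \<Rightarrow> Y i j a)"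
    by (rule free_magma_lift[where sR = sR and Y = "\<lambda>(i, j, a). Y i j a", OF P PB cl], assumption, rule that)
  note fl = lhom_linmap[OF f(1)] and fb = lhom_br[OF f(1)]
  have fX: "f (fX i j a) = Y i j a" if "distinct2 i j" for i j a
    using f(2)[of "(i, j, a)"] that by (simp add: fX_def gens_def distinct2_def)
  have "f r = lzero P" if "r \<in> stl_rels sR" for r
    using that
  proof (cases rule: stl_rels_cases)
    case (jacobi x y z)
    have "f x \<in> carr P" "f y \<in> carr P" "f z \<in> carr P" using jacobi linmap_closed[OF fl] by auto
    then show ?thesis
      using jacobi B K P bilin_closed[OF PB] cocycleD[OF leibniz_cocycle[OF assms(1)], of "f x" "f y" "f z"]
      by (simp add: linmap_sub[OF K P fl] fb)
  next
    case (linear i j k a b)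
    have "Y i j (sR k a + b) = ladd P (lsmul P k (Y i j a)) (Y i j b)"
      using linmap_add[OF lin, of i j "sR k a" b] linmap_smul[OF lin, of i j a k] linear by simp
    then show ?thesis
      using linear K P by (simp add: linmap_sub[OF K P fl] linmap_add[OF fl] linmap_smul[OF fl] fX_closed fX Y)
  next
    case (br1 i j k a b)
    have "lbr P (Y i j a) (Y j k b) = Y i k (a * b)" using steinbergD(2)[OF assms(2)] br1 by simp
    then show ?thesis
      using br1 K P B distinct3D[OF br1(1)] by (simp add: linmap_sub[OF K P fl] fX_closed fX fb Y)
  next
    case (br2 i j k a b)
    have "lbr P (Y i j a) (Y k i b) = lneg P (Y k j (b * a))" using steinbergD(3)[OF assms(2)] br2 by simp
    then show ?thesis
      using br2 K P B distinct3D[OF br2(1)] by (simp add: linmap_add[OF fl] fX_closed fX fb Y)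
  next
    case (br0 i j k l a b)
    have "lbr P (Y i j a) (Y k l b) = lzero P" using steinbergD(4)[OF assms(2)] br0 by simp
    then show ?thesis using br0 by (simp add: fX_closed fX fb)
  qed
  then have "stl_rels sR \<subseteq> {x \<in> carr F. f x = lzero P}"
    using stl_rels_subset by blast
  moreover have "lideal F {x \<in> carr F. f x = lzero P}"
    unfolding lideal_def using submodule_kernel[OF K P fl] B linmap_closed[OF fl]
    by (auto simp: fb bilin_zero_left[OF P P PB] bilin_zero_right[OF P P PB])
  ultimately have "I \<subseteq> {x \<in> carr F. f x = lzero P}" by (intro ideal_gen_subset)
  then have ker: "\<And>n. n \<in> I \<Longrightarrow> f n = lzero P" by blast
  obtain g where g: "linmap (quot F I) P g" "\<And>x. x \<in> carr F \<Longrightarrow> g (lcoset F I x) = f x"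
    by (rule quot_lift[OF K submodule_I P fl ker]) (assumption, rule that)
  then have gL: "linmap L P g" by (simp only: stl3_def)
  show thesis
  proof (rule that[of g])
    show "lhom L P g"
      unfolding lhom_def carr_L using gL g(2) B by (simp add: proj_br fb)
    show "g (X i j a) = Y i j a" if "distinct2 i j" for i j a
      using that by (simp add: stlX_eq_lcoset g(2) fX_closed fX)
  qed
qed

text \<open>Such an \<open>N\<close> contains the class of every tree, by induction on the tree, and
  these classes span.\<close>

lemma stl_generated:
  assumes N: "submodule L N" and X: "\<And>i j a. distinct2 i j \<Longrightarrow> X i j a \<in> N"
    and br: "\<And>x y. x \<in> N \<Longrightarrow> y \<in> N \<Longrightarrow> lbr L x y \<in> N"
  shows "carr L \<subseteq> N"
proof -
  note K = kmod_free_magma[of sR]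
  have tree: "lcoset F I (ind t) \<in> N" if "t \<in> trees" for t
    using that
  proof (induction t)
    case (Leaf g)
    then obtain i j a where "g = (i, j, a)" "distinct2 i j" by (auto simp: gens_def distinct2_def)
    then show ?case using X by (simp add: stlX_eq_lcoset fX_def)
  next
    case (Node u v)
    then have "u \<in> trees" "v \<in> trees" by simp_all
    then have "lbr L (lcoset F I (ind u)) (lcoset F I (ind v)) \<in> N" using Node.IH br by blast
    then show ?case
      using \<open>u \<in> trees\<close> \<open>v \<in> trees\<close>
      by (simp add: proj_br free_magma_br_ind free_magma_simps(1) ind_closed)
  qed
  have "spans L (lcoset F I ` ind ` trees)"
    unfolding stl3_def by (rule spans_quot[OF K submodule_I spans_free_magma])
  then show ?thesis by (rule spansD[OF _ N]) (use tree in auto)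
qed

lemma X_lin: "distinct2 i j \<Longrightarrow> linmap (rmod sR) L (X i j)"
  by (rule steinbergD(1)[OF steinberg_L])

lemma X_closed [simp]: "distinct2 i j \<Longrightarrow> X i j a \<in> carr L"
  using linmap_closed[OF X_lin] by simp

lemma X_add: "distinct2 i j \<Longrightarrow> X i j (a + b) = ladd L (X i j a) (X i j b)"
  and X_smul: "distinct2 i j \<Longrightarrow> X i j (sR k a) = lsmul L k (X i j a)"
  and X_neg: "distinct2 i j \<Longrightarrow> X i j (- a) = lneg L (X i j a)"
  using linmap_add[OF X_lin, of i j a b] linmap_smul[OF X_lin, of i j a k]
    linmap_neg[OF kmod_rmod kmod_L X_lin, of i j a]
  by simp_all

lemma br1: "distinct3 i j k \<Longrightarrow> lbr L (X i j a) (X j k b) = X i k (a * b)"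
  and br2: "distinct3 i j k \<Longrightarrow> lbr L (X i j a) (X k i b) = lneg L (X k j (b * a))"
  and br0: "distinct2 i j \<Longrightarrow> distinct2 k l \<Longrightarrow> j \<noteq> k \<Longrightarrow> i \<noteq> l \<Longrightarrow> lbr L (X i j a) (X k l b) = lzero L"
  by (rule steinbergD[OF steinberg_L]; assumption)+

lemma br_closed [simp]: "x \<in> carr L \<Longrightarrow> y \<in> carr L \<Longrightarrow> lbr L x y \<in> carr L"
  by (rule bilin_closed[OF leibniz_bilin[OF leibniz_L]])

lemmas br_jacobi = cocycleD[OF leibniz_cocycle[OF leibniz_L]]

text \<open>In this form the Leibniz identity says that right multiplication by \<open>z\<close> is
  a derivation.\<close>

lemma br_jacobi':
  "x \<in> carr L \<Longrightarrow> y \<in> carr L \<Longrightarrow> z \<in> carr L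
    \<Longrightarrow> lbr L (lbr L x y) z = ladd L (lbr L x (lbr L y z)) (lbr L (lbr L x z) y)"
  by (simp add: br_jacobi kmod_L flip: kmod_sub_eq)

lemmas br_zero = bilin_zero_left[OF kmod_L kmod_L leibniz_bilin[OF leibniz_L]]
  bilin_zero_right[OF kmod_L kmod_L leibniz_bilin[OF leibniz_L]]
lemmas br_neg = bilin_neg_left[OF kmod_L kmod_L leibniz_bilin[OF leibniz_L]]
  bilin_neg_right[OF kmod_L kmod_L leibniz_bilin[OF leibniz_L]]

section \<open>Brackets of generators with the elements \<open>hh i j a b\<close>\<close>

abbreviation hh where "hh i j a b \<equiv> lbr L (X i j a) (X j i b)"

text \<open>These generators share exactly one index with the pair \<open>i\<close>,
  \<open>j\<close>, so expanding \<open>hh i j a b\<close> by the Leibniz identity leaves only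
  brackets given by the presentation. In matrices \<open>hh i j a b\<close> is diagonal, with
  entries \<open>a * b\<close> at \<open>i\<close> and \<open>- (b * a)\<close> at
  \<open>j\<close>.\<close>

lemma X_hh:
  assumes d: "distinct3 i j k"
  shows "lbr L (X i k c) (hh i j a b) = lneg L (X i k (a * b * c))"
    "lbr L (X k i c) (hh i j a b) = X k i (c * a * b)"
    "lbr L (X j k c) (hh i j a b) = X j k (b * a * c)"
    "lbr L (X k j c) (hh i j a b) = lneg L (X k j (c * b * a))"
  using distinct3D[OF d] d
  by (simp_all add: br_jacobi br1 br2 br0 br_neg br_zero kmod_L lsub_def mult.assoc)

lemma hh_X:
  assumes d: "distinct3 i j k"
  shows "lbr L (hh i j a b) (X i k c) = X i k (a * b * c)"
    "lbr L (hh i j a b) (X k i c) = lneg L (X k i (c * a * b))"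
    "lbr L (hh i j a b) (X j k c) = lneg L (X j k (b * a * c))"
    "lbr L (hh i j a b) (X k j c) = X k j (c * b * a)"
  using distinct3D[OF d] d
  by (simp_all add: br_jacobi' br1 br2 br0 br_neg br_zero kmod_L lsub_def mult.assoc)

text \<open>Direct expansion would meet brackets of opposite generators. Instead
  \<open>X i j c = [X i k c, X k j 1]\<close>, and the derivation rule reduces to the cases of
  \<open>X_hh\<close>; likewise for \<open>X j i c\<close>.\<close>

lemma X_hh_long:
  assumes d: "distinct3 i j k"
  shows "lbr L (X i j c) (hh i j a b) = lneg L (X i j (c * b * a + a * b * c))"
    "lbr L (X j i c) (hh i j a b) = X j i (c * a * b + b * a * c)"
proof -
  note D = distinct3D[OF d] and C = br_jacobi'[of _ _ "hh i j a b"]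
  show "lbr L (X i j c) (hh i j a b) = lneg L (X i j (c * b * a + a * b * c))"
    using d D C[of "X i k c" "X k j 1"]
    by (simp add: br1 X_hh br_neg X_add kmod_neg_add kmod_L mult.assoc)
  show "lbr L (X j i c) (hh i j a b) = X j i (c * a * b + b * a * c)"
    using d D C[of "X j k c" "X k i 1"]
    by (simp add: br1 X_hh br_neg X_add kmod_neg_add kmod_L mult.assoc)
qed

text \<open>The same factorization through \<open>k\<close>; as left multiplication is no
  derivation, the Leibniz identity is used in its original form for
  \<open>[h, [y, z]]\<close>.\<close>

lemma hh_X_long:
  assumes d: "distinct3 i j k"
  shows "lbr L (hh i j a b) (X i j c) = X i j (a * b * c + c * b * a)"
    "lbr L (hh i j a b) (X j i c) = lneg L (X j i (b * a * c + c * a * b))"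
proof -
  note D = distinct3D[OF d] and C = br_jacobi[of "hh i j a b"]
  show "lbr L (hh i j a b) (X i j c) = X i j (a * b * c + c * b * a)"
    using d D C[of "X i k c" "X k j 1"]
    by (simp add: br1 br2 hh_X br_neg X_add kmod_neg_add kmod_L lsub_def mult.assoc)
  show "lbr L (hh i j a b) (X j i c) = lneg L (X j i (b * a * c + c * a * b))"
    using d D C[of "X j k c" "X k i 1"]
    by (simp add: br1 br2 hh_X br_neg X_add kmod_neg_add kmod_L lsub_def mult.assoc)
qed

section \<open>A spanning set of stl_3(R)\<close>

definition Xset where "Xset = {X i j a | i j a. distinct2 i j}"
definition Hset where "Hset = {hh i j a b | i j a b. distinct2 i j}"

lemma XsetI: "distinct2 i j \<Longrightarrow> X i j a \<in> Xset"
  by (auto simp: Xset_def)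

lemma X_hh_ex: "distinct2 p q \<Longrightarrow> distinct2 i j \<Longrightarrow> \<exists>r. lbr L (X p q c) (hh i j a b) = X p q r"
proof (elim distinct2_third[of i j])
  fix k assume d: "distinct3 i j k" and "distinct2 p q"
  then show ?thesis
    by (cases rule: distinct3_cases) (use distinct3D[OF d] in \<open>auto simp: X_hh[OF d] X_hh_long[OF d] simp flip: X_neg\<close>)
qed

lemma hh_X_ex: "distinct2 p q \<Longrightarrow> distinct2 i j \<Longrightarrow> \<exists>r. lbr L (hh i j a b) (X p q c) = X p q r"
proof (elim distinct2_third[of i j])
  fix k assume d: "distinct3 i j k" and "distinct2 p q"
  then show ?thesis
    by (cases rule: distinct3_cases) (use distinct3D[OF d] in \<open>auto simp: hh_X[OF d] hh_X_long[OF d] simp flip: X_neg\<close>)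
qed

lemma bilin_lspan:
  assumes "kmod A" "kmod B" "kmod C" "bilin A B C p" "submodule C N" "S \<subseteq> carr A" "T \<subseteq> carr B"
    and st: "\<And>s t. s \<in> S \<Longrightarrow> t \<in> T \<Longrightarrow> p s t \<in> N" and "x \<in> lspan A S" "y \<in> lspan B T"
  shows "p x y \<in> N"
proof -
  have y: "y \<in> carr B" using assms(10) submoduleD(1)[OF submodule_lspan[OF assms(2,7)]] by blast
  have "lspan B T \<subseteq> {y \<in> carr B. p s y \<in> N}" if "s \<in> S" for s
    using that st assms(6,7)
    by (intro lspan_subset submodule_vimage[OF assms(2,3) bilin_linmap_right[OF assms(4)] assms(5)]) auto
  then have "S \<subseteq> {x \<in> carr A. p x y \<in> N}" using assms(6,10) by blast
  then have "lspan A S \<subseteq> {x \<in> carr A. p x y \<in> N}"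
    by (rule lspan_subset[OF submodule_vimage[OF assms(1,3) bilin_linmap_left[OF assms(4) y] assms(5)]])
  then show ?thesis using assms(9) by blast
qed

text \<open>By \<open>stl_generated\<close> it suffices that the span of the two families is closed
  under brackets.\<close>

lemma spans_L: "spans L (Xset \<union> Hset)"
proof (rule spansI)
  show sub: "Xset \<union> Hset \<subseteq> carr L"
    by (auto simp: Xset_def Hset_def distinct2_sym)
  let ?A = "lspan L (Xset \<union> Hset)"
  have A: "submodule L ?A" by (rule submodule_lspan[OF kmod_L sub])
  note sup = subsetD[OF lspan_superset[of "Xset \<union> Hset" L]]
  have XA: "X i j a \<in> ?A" if "distinct2 i j" for i j a
    by (rule sup) (simp add: XsetI that)
  have br_XX: "lbr L (X i j a) (X k l b) \<in> ?A" if d: "distinct2 i j" "distinct2 k l" for i j k l a b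
  proof (cases "j = k"; cases "i = l")
    assume "j = k" "i = l"
    then have "lbr L (X i j a) (X k l b) \<in> Hset" using d unfolding Hset_def by blast
    then show ?thesis by (intro sup) simp
  next
    assume "j = k" "i \<noteq> l"
    then have "distinct3 i j l" "distinct2 i l" using d by (auto simp: distinct2_def distinct3_def)
    then show ?thesis using \<open>j = k\<close> by (simp add: br1 XA)
  next
    assume "j \<noteq> k" "i = l"
    then have "distinct3 i j k" "distinct2 k j" using d by (auto simp: distinct2_def distinct3_def)
    then show ?thesis using \<open>i = l\<close> by (simp add: br2 XA submoduleD(4)[OF A])
  next
    assume "j \<noteq> k" "i \<noteq> l"
    then show ?thesis using d by (simp add: br0 submoduleD(2)[OF A])
  qed
  have gen: "lbr L s t \<in> ?A" if s: "s \<in> Xset \<union> Hset" and t: "t \<in> Xset \<union> Hset" for s t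
  proof -
    consider (XX) "s \<in> Xset" "t \<in> Xset" | (XH) "s \<in> Xset" "t \<in> Hset"
      | (HX) "s \<in> Hset" "t \<in> Xset" | (HH) "s \<in> Hset" "t \<in> Hset"
      using s t by blast
    then show ?thesis
    proof cases
      case XX
      then show ?thesis using br_XX by (auto simp: Xset_def)
    next
      case XH
      then obtain p q c i j a b where "s = X p q c" "distinct2 p q" "t = hh i j a b" "distinct2 i j"
        unfolding Xset_def Hset_def by blast
      then show ?thesis using X_hh_ex[of p q i j c a b] XA by auto
    next
      case HX
      then obtain p q c i j a b where "t = X p q c" "distinct2 p q" "s = hh i j a b" "distinct2 i j"
        unfolding Xset_def Hset_def by blast
      then show ?thesis using hh_X_ex[of p q i j a b c] XA by auto
    next
      case HH
      then obtain p q c d i j a b where st: "s = hh p q c d" "distinct2 p q" "t = hh i j a b" "distinct2 i j"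
        unfolding Hset_def by blast
      obtain r where r: "lbr L (X p q c) t = X p q r" using X_hh_ex[of p q i j c a b] st by auto
      obtain r' where r': "lbr L (X q p d) t = X q p r'"
        using X_hh_ex[of q p i j d a b] st distinct2_sym[OF st(2)] by auto
      have "t \<in> carr L" using st distinct2_sym[OF st(4)] by simp
      \<comment> \<open>Right multiplication by \<open>t\<close> is a derivation that maps
        \<open>X p q c\<close> and \<open>X q p d\<close> to generators with the same indices, so
        the bracket is a sum of two brackets of generators.\<close>
      then have "lbr L s t = ladd L (lbr L (X p q c) (X q p r')) (lbr L (X p q r) (X q p d))"
        using br_jacobi'[of "X p q c" "X q p d" t] st(2) distinct2_sym[OF st(2)]
        unfolding r r' st(1) by simp
      then show ?thesis using br_XX st(2) distinct2_sym[OF st(2)] submoduleD(3)[OF A] by simp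
    qed
  qed
  have "lbr L x y \<in> ?A" if "x \<in> ?A" "y \<in> ?A" for x y
    by (rule bilin_lspan[OF kmod_L kmod_L kmod_L leibniz_bilin[OF leibniz_L] A sub sub gen that])
  then have *: "carr L \<subseteq> ?A" by (intro stl_generated A XA)
  fix N assume "submodule L N" "Xset \<union> Hset \<subseteq> N"
  then have "?A \<subseteq> N" by (rule lspan_subset)
  with * show "carr L \<subseteq> N" by (rule subset_trans)
qed

end

subsection \<open>Matrices with trace in the ideal of \<open>R\<^sub>3\<close>\<close>

lemma mult_3_eq_add: "3 * a = a + a + (a :: 'a::ring_1)"
proof -
  have "3 * a = (1 + 1 + 1) * a" by simp
  also have "\<dots> = a + a + a" by (simp only: distrib_right mult_1)
  finally show ?thesis .
qed

lemma sum_idx3: "distinct3 i j k \<Longrightarrow> (\<Sum>t\<in>idx3. f t) = f i + f j + (f k :: 'a::comm_monoid_add)"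
proof -
  assume d: "distinct3 i j k"
  have *: "idx3 = {i, j, k}" using d distinct3_elem[OF d] unfolding distinct3_def by blast
  show ?thesis unfolding * using distinct3D(12-17)[OF d] by (simp add: add.assoc)
qed

text \<open>Matrices are functions on all of \<open>nat \<times> nat\<close>, but products sum over \<open>{1, 2, 3}\<close> only;
  entries outside this range are unconstrained and never matter.\<close>

definition mat_mult :: "(nat \<Rightarrow> nat \<Rightarrow> 'r::ring_1) \<Rightarrow> (nat \<Rightarrow> nat \<Rightarrow> 'r) \<Rightarrow> nat \<Rightarrow> nat \<Rightarrow> 'r" where
  "mat_mult x y = (\<lambda>p q. \<Sum>t\<in>idx3. x p t * y t q)"

definition mat_br :: "(nat \<Rightarrow> nat \<Rightarrow> 'r::ring_1) \<Rightarrow> (nat \<Rightarrow> nat \<Rightarrow> 'r) \<Rightarrow> nat \<Rightarrow> nat \<Rightarrow> 'r" where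
  "mat_br x y = (\<lambda>p q. mat_mult x y p q - mat_mult y x p q)"

definition mat_trace :: "(nat \<Rightarrow> nat \<Rightarrow> 'r::ring_1) \<Rightarrow> 'r" where
  "mat_trace x = (\<Sum>t\<in>idx3. x t t)"

definition emat :: "nat \<Rightarrow> nat \<Rightarrow> 'r \<Rightarrow> nat \<Rightarrow> nat \<Rightarrow> 'r::ring_1" where
  "emat i j a = (\<lambda>p q. if p = i \<and> q = j then a else 0)"

lemma mat_mult_assoc: "mat_mult (mat_mult x y) z = mat_mult x (mat_mult y z)"
proof (intro ext)
  fix p q
  have "mat_mult (mat_mult x y) z p q = (\<Sum>t\<in>idx3. \<Sum>s\<in>idx3. x p s * y s t * z t q)"
    by (simp add: mat_mult_def sum_distrib_right)
  also have "\<dots> = (\<Sum>s\<in>idx3. \<Sum>t\<in>idx3. x p s * y s t * z t q)" by (rule sum.swap)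
  also have "\<dots> = mat_mult x (mat_mult y z) p q"
    by (simp add: mat_mult_def sum_distrib_left mult.assoc)
  finally show "mat_mult (mat_mult x y) z p q = mat_mult x (mat_mult y z) p q" .
qed

lemma mat_mult_diff:
  "mat_mult (\<lambda>p q. x p q - y p q) z = (\<lambda>p q. mat_mult x z p q - mat_mult y z p q)"
  "mat_mult z (\<lambda>p q. x p q - y p q) = (\<lambda>p q. mat_mult z x p q - mat_mult z y p q)"
  by (simp_all add: mat_mult_def algebra_simps sum_subtractf)

lemma mat_mult_add:
  "mat_mult (\<lambda>p q. x p q + y p q) z = (\<lambda>p q. mat_mult x z p q + mat_mult y z p q)"
  "mat_mult z (\<lambda>p q. x p q + y p q) = (\<lambda>p q. mat_mult z x p q + mat_mult z y p q)"
  by (simp_all add: mat_mult_def algebra_simps sum.distrib)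

lemma mat_br_jacobi: "mat_br x (mat_br y z) = (\<lambda>p q. mat_br (mat_br x y) z p q + - mat_br (mat_br x z) y p q)"
  by (simp add: mat_br_def mat_mult_diff mat_mult_assoc fun_eq_iff)

lemma mat_mult_emat:
  assumes "j \<in> idx3" "k \<in> idx3"
  shows "mat_mult (emat i j a) (emat k l b) = (if j = k then emat i l (a * b) else (\<lambda>p q. 0))"
proof (intro ext)
  fix p q
  have "mat_mult (emat i j a) (emat k l b) p q
      = (\<Sum>t\<in>idx3. if t = j then (if p = i \<and> k = j \<and> q = l then a * b else 0) else 0)"
    unfolding mat_mult_def emat_def by (intro sum.cong) auto
  also have "\<dots> = (if p = i \<and> k = j \<and> q = l then a * b else 0)"
    using assms by (subst sum.delta) (auto simp: idx3_def)
  finally show "mat_mult (emat i j a) (emat k l b) p q = (if j = k then emat i l (a * b) else (\<lambda>p q. 0)) p q"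
    by (auto simp: emat_def)
qed

section \<open>The ideal \<open>J\<close> and traces of matrix commutators\<close>

context kalg
begin

abbreviation J where "J \<equiv> J3 sR"

lemma submodule_J: "submodule (rmod sR) J"
  unfolding J3_def by (rule submodule_lspan[OF kmod_rmod]) simp

lemma J_closed:
  "0 \<in> J" "a \<in> J \<Longrightarrow> b \<in> J \<Longrightarrow> a + b \<in> J" "a \<in> J \<Longrightarrow> - a \<in> J" "a \<in> J \<Longrightarrow> b \<in> J \<Longrightarrow> a - b \<in> J"
  "a \<in> J \<Longrightarrow> sR k a \<in> J"
  using submoduleD(2,3,4,5,7)[OF submodule_J] by simp_all

lemma J_gens: "3 * r \<in> J" "r * (a * b - b * a) \<in> J"
proof -
  note sup = subsetD[OF lspan_superset[of "{3 * r | r. True} \<union> {r * (a * b - b * a) | r a b. True}" "rmod sR"]]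
  show "3 * r \<in> J" "r * (a * b - b * a) \<in> J" unfolding J3_def by (rule sup; blast)+
qed

lemma J_induct:
  assumes "kmod P" "linmap (rmod sR) P f" "\<And>r. f (3 * r) = lzero P" "\<And>r a b. f (r * (a * b - b * a)) = lzero P"
    and "a \<in> J"
  shows "f a = lzero P"
proof -
  have "J \<subseteq> {x \<in> carr (rmod sR). f x = lzero P}"
    unfolding J3_def
    by (rule lspan_subset[OF submodule_kernel[OF kmod_rmod assms(1,2)]]) (use assms(3,4) in auto)
  then show ?thesis using assms(5) by blast
qed

lemma J_mult_left: "a \<in> J \<Longrightarrow> r * a \<in> J"
proof -
  have "linmap (rmod sR) (rmod sR) ((*) r)"
    by (simp add: linmap_def distrib_left sR_simps)
  from submodule_vimage[OF kmod_rmod kmod_rmod this submodule_J]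
  have "submodule (rmod sR) {a. r * a \<in> J}" by simp
  moreover have "r * (3 * s) \<in> J" "r * (s * (a * b - b * a)) \<in> J" for s a b
    using J_gens(1)[of "r * s"] J_gens(2)[of "r * s" a b] mult_of_nat_commute[of 3 r]
    by (simp_all add: mult.assoc) (simp flip: mult.assoc)
  ultimately have "J \<subseteq> {a. r * a \<in> J}"
    unfolding J3_def[of sR] by (intro lspan_subset) auto
  then show "a \<in> J \<Longrightarrow> r * a \<in> J" by blast
qed

text \<open>\<open>J\<close> is spanned by left multiples. For a commutator \<open>c\<close>,
  \<open>s * c * r = s * r * c + s * (c * r - r * c)\<close>, and both terms are again left
  multiples of commutators.\<close>

lemma J_mult_right: "a \<in> J \<Longrightarrow> a * r \<in> J"
proof -
  have "linmap (rmod sR) (rmod sR) (\<lambda>a. a * r)"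
    by (simp add: linmap_def distrib_right sR_simps)
  from submodule_vimage[OF kmod_rmod kmod_rmod this submodule_J]
  have sub: "submodule (rmod sR) {a. a * r \<in> J}" by simp
  have 1: "3 * s * r \<in> J" for s
    using J_gens(1)[of "s * r"] by (simp add: mult.assoc)
  have 2: "s * (a * b - b * a) * r \<in> J" for s a b
  proof -
    have "s * (a * b - b * a) * r = s * r * (a * b - b * a) + s * ((a * b - b * a) * r - r * (a * b - b * a))"
      by (simp add: algebra_simps)
    then show ?thesis using J_gens(2) J_closed(2) by metis
  qed
  have "J \<subseteq> {a. a * r \<in> J}"
    unfolding J3_def[of sR] by (rule lspan_subset) (use sub 1 2 in \<open>auto simp: J3_def\<close>)
  then show "a \<in> J \<Longrightarrow> a * r \<in> J" by blast
qed

lemma J_comm: "a * b - b * a \<in> J"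
  using J_gens(2)[of 1 a b] by simp

lemma J_sum: "(\<And>t. t \<in> A \<Longrightarrow> f t \<in> J) \<Longrightarrow> sum f A \<in> J"
  by (induction A rule: infinite_finite_induct) (auto intro: J_closed)

lemma trace_mat_br: "mat_trace (mat_br x y) \<in> J"
proof -
  have "mat_trace (mat_br x y) = (\<Sum>s\<in>idx3. \<Sum>t\<in>idx3. x s t * y t s) - (\<Sum>s\<in>idx3. \<Sum>t\<in>idx3. y s t * x t s)"
    by (simp add: mat_trace_def mat_br_def mat_mult_def sum_subtractf)
  \<comment> \<open>Exchanging the summation indices pairs the two sums term by term into
    commutators of entries.\<close>
  also have "(\<Sum>s\<in>idx3. \<Sum>t\<in>idx3. y s t * x t s) = (\<Sum>s\<in>idx3. \<Sum>t\<in>idx3. y t s * x s t)"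
    by (rule sum.swap)
  finally have "mat_trace (mat_br x y) = (\<Sum>s\<in>idx3. \<Sum>t\<in>idx3. x s t * y t s - y t s * x s t)"
    by (simp add: sum_subtractf)
  then show ?thesis by (simp add: J_sum J_comm)
qed

text \<open>An analogue of sl_3(R) with the trace allowed anywhere in \<open>J\<close>. This trace
  condition is what the cocycle identity for minors uses in
  \<open>minor_defect_in_J\<close>.\<close>

definition msl :: "('k, nat \<Rightarrow> nat \<Rightarrow> 'r) lalg" where
  "msl = \<lparr> carr = {x. mat_trace x \<in> J}, ladd = (\<lambda>x y p q. x p q + y p q), lzero = (\<lambda>p q. 0),
      lneg = (\<lambda>x p q. - x p q), lsmul = (\<lambda>k x p q. sR k (x p q)), lbr = mat_br \<rparr>"

lemma msl_simps:
  "carr msl = {x. mat_trace x \<in> J}" "ladd msl x y = (\<lambda>p q. x p q + y p q)" "lzero msl = (\<lambda>p q. 0)"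
  "lneg msl x = (\<lambda>p q. - x p q)" "lsmul msl k x = (\<lambda>p q. sR k (x p q))" "lbr msl = mat_br"
  by (simp_all add: msl_def)

lemma sR_sum: "sR k (sum f A) = (\<Sum>t\<in>A. sR k (f t))"
  by (induction A rule: infinite_finite_induct) (simp_all add: sR_simps)

lemma leibniz_msl: "leibniz msl"
proof -
  have tr: "mat_trace (\<lambda>p q. x p q + y p q) = mat_trace x + mat_trace y"
    "mat_trace (\<lambda>p q. - x p q) = - mat_trace x" "mat_trace (\<lambda>p q. sR k (x p q)) = sR k (mat_trace x)"
    "mat_trace (\<lambda>p q. 0) = 0" for x y :: "nat \<Rightarrow> nat \<Rightarrow> 'r" and k
    by (simp_all add: mat_trace_def sum.distrib sum_negf sR_sum)
  have "kmod msl"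
    unfolding kmod_def msl_simps by (auto simp: tr J_closed sR_simps algebra_simps)
  moreover have sm: "mat_mult (\<lambda>p q. sR k (x p q)) y = (\<lambda>p q. sR k (mat_mult x y p q))"
    "mat_mult x (\<lambda>p q. sR k (y p q)) = (\<lambda>p q. sR k (mat_mult x y p q))" for x y k
    by (simp_all add: mat_mult_def sR_simps sR_sum)
  have "bilin msl msl msl (lbr msl)"
    unfolding bilin_def msl_simps using trace_mat_br[unfolded mat_br_def]
    by (auto simp: mat_br_def mat_mult_add sm sR_simps fun_eq_iff algebra_simps)
  ultimately show ?thesis
    unfolding leibniz_iff cocycle_def by (simp add: msl_simps lsub_def mat_br_jacobi)
qed

lemma steinberg_msl: "steinberg sR msl emat"
  unfolding steinberg_def
proof (intro conjI allI impI)
  fix i j assume "distinct2 i j"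
  then have "mat_trace (emat i j a) = 0" for a :: 'r
    unfolding mat_trace_def emat_def distinct2_def by (intro sum.neutral) auto
  then show "linmap (rmod sR) msl (emat i j)"
    unfolding linmap_def msl_simps by (auto simp: emat_def J_closed fun_eq_iff sR_simps)
next
  fix i j k and a b :: 'r assume "distinct3 i j k"
  then show "lbr msl (emat i j a) (emat j k b) = emat i k (a * b)"
    "lbr msl (emat i j a) (emat k i b) = lneg msl (emat k j (b * a))"
    unfolding msl_simps distinct3_def by (auto simp: mat_br_def mat_mult_emat)
next
  fix i j k l and a b :: 'r assume "distinct2 i j" "distinct2 k l" "j \<noteq> k" "i \<noteq> l"
  then show "lbr msl (emat i j a) (emat k l b) = lzero msl"
    unfolding msl_simps distinct2_def by (auto simp: mat_br_def mat_mult_emat)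
qed

section \<open>The matrix representation and the cocycle identity for minors modulo
  \<open>J\<close>\<close>

definition rho where
  "rho = (SOME f. lhom L msl f \<and> (\<forall>i j a. distinct2 i j \<longrightarrow> f (X i j a) = emat i j a))"

lemma rho: "lhom L msl rho" "distinct2 i j \<Longrightarrow> rho (X i j a) = emat i j a"
proof -
  have "\<exists>f. lhom L msl f \<and> (\<forall>i j a. distinct2 i j \<longrightarrow> f (X i j a) = emat i j a)"
    by (rule stl_lift[OF leibniz_msl steinberg_msl]) blast
  from someI_ex[OF this] show "lhom L msl rho" "distinct2 i j \<Longrightarrow> rho (X i j a) = emat i j a"
    unfolding rho_def by auto
qed

text \<open>For commuting entries this is the determinant formed from the entries of
  \<open>x\<close> and \<open>y\<close> at the positions \<open>(p, q)\<close> and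
  \<open>(r, s)\<close>.\<close>

definition minor :: "(nat \<Rightarrow> nat \<Rightarrow> 'r) \<Rightarrow> (nat \<Rightarrow> nat \<Rightarrow> 'r) \<Rightarrow> nat \<Rightarrow> nat \<Rightarrow> nat \<Rightarrow> nat \<Rightarrow> 'r" where
  "minor x y p q r s = x p q * y r s - x r s * y p q"

definition minor_defect where
  "minor_defect x y z p q r s =
     minor x (mat_br y z) p q r s - minor (mat_br x y) z p q r s + minor (mat_br x z) y p q r s"

text \<open>Modulo \<open>J\<close> every monomial may be reordered so that the factors from \<open>x\<close>, \<open>y\<close> and \<open>z\<close> come
  in this order; this is the result of doing so in \<open>minor_defect\<close>.\<close>

definition minor_sorted where
  "minor_sorted x y z p q r s = (\<Sum>t\<in>idx3.
      x p q * (y r t * z t s - y t s * z r t) - x r s * (y p t * z t q - y t q * z p t)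
      - (x p t * y t q - x t q * y p t) * z r s + (x r t * y t s - x t s * y r t) * z p q
      + (x p t * y r s * z t q - x t q * y r s * z p t) - (x r t * y p q * z t s - x t s * y p q * z r t))"

text \<open>Every exchange of factors costs a commutator \<open>c\<close>; the sum in the proof
  collects these costs, and \<open>J\<close> absorbs them because it is a two-sided ideal.\<close>

lemma minor_defect_sorted: "minor_defect x y z p q r s - minor_sorted x y z p q r s \<in> J"
proof -
  define c where "c a b = a * b - b * a" for a b :: 'r
  have c: "c a b \<in> J" for a b unfolding c_def by (rule J_comm)
  have "minor_defect x y z p q r s - minor_sorted x y z p q r s = (\<Sum>t\<in>idx3. x r s * c (z p t) (y t q) - x p q * c (z r t) (y t s)
      + c (y p t) (x t q) * z r s - c (y r t) (x t s) * z p q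
      + x p t * c (z t q) (y r s) - c (z p t) (x t q * y r s)
      - x r t * c (z t s) (y p q) + c (z r t) (x t s * y p q))"
    unfolding minor_defect_def minor_sorted_def minor_def mat_br_def mat_mult_def c_def
    by (simp add: sum_subtractf sum.distrib sum_distrib_left sum_distrib_right algebra_simps)
  also have "\<dots> \<in> J" by (intro J_sum J_closed J_mult_left J_mult_right c)
  finally show ?thesis .
qed

text \<open>Once the sum over \<open>t\<close> is written out, the sorted defect consists of
  multiples of the three traces and three times a remainder. The column case is the transposed row
  case with opposite sign, since transposition reverses the bracket of matrices with commuting
  entries.\<close>

lemma minor_defect_in_J:
  assumes d: "distinct3 i j k" and tr: "mat_trace x \<in> J" "mat_trace y \<in> J" "mat_trace z \<in> J"
  shows "minor_defect x y z i j i k \<in> J" "minor_defect x y z j i k i \<in> J"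
proof -
  note S = sum_idx3[OF d]
  have "minor_sorted x y z i j i k = mat_trace x * (y i j * z i k - y i k * z i j)
      - (x i j * mat_trace y * z i k - x i k * mat_trace y * z i j) + (x i j * y i k - x i k * y i j) * mat_trace z
      + 3 * (x i j * y i i * z i k - x i j * y i k * z i i - x i k * y i i * z i j + x i k * y i j * z i i
        - x i i * y i j * z i k + x i i * y i k * z i j)"
    unfolding mat_trace_def minor_sorted_def S mult_3_eq_add by (simp add: algebra_simps)
  also have "\<dots> \<in> J" by (intro J_closed J_mult_left J_mult_right J_gens tr)
  finally have "minor_sorted x y z i j i k \<in> J" .
  from J_closed(2)[OF minor_defect_sorted[of x y z i j i k] this] show "minor_defect x y z i j i k \<in> J" by simp
  have "minor_sorted x y z j i k i = - (mat_trace x * (y j i * z k i - y k i * z j i))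
      + (x j i * mat_trace y * z k i - x k i * mat_trace y * z j i) - (x j i * y k i - x k i * y j i) * mat_trace z
      + 3 * (x j i * y k i * z i i - x j i * y i i * z k i - x k i * y j i * z i i + x k i * y i i * z j i
        + x i i * y j i * z k i - x i i * y k i * z j i)"
    unfolding mat_trace_def minor_sorted_def S mult_3_eq_add by (simp add: algebra_simps)
  also have "\<dots> \<in> J" by (intro J_closed J_mult_left J_mult_right J_gens tr)
  finally have "minor_sorted x y z j i k i \<in> J" .
  from J_closed(2)[OF minor_defect_sorted[of x y z j i k i] this] show "minor_defect x y z j i k i \<in> J" by simp
qed

subsection \<open>The module \<open>\<U>\<close> and the cocycle \<open>\<psi>\<close>\<close>

abbreviation U where "U \<equiv> Umod sR"

text \<open>Describes elements of \<open>U\<close> by representatives in \<open>R\<close>, so that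
  equations in \<open>U\<close> become congruences modulo \<open>J\<close> in each
  coordinate.\<close>

definition uelem :: "(int \<Rightarrow> 'r) \<Rightarrow> int \<Rightarrow> 'r set" where
  "uelem c = (\<lambda>m. if m \<in> Uidx then rbar sR (c m) else rbar sR 0)"

lemma R3_zero: "lzero (R3 sR) = rbar sR 0"
  by (simp add: R3_def quot_zero rbar_def)

lemma rbar_simps:
  "ladd (R3 sR) (rbar sR a) (rbar sR b) = rbar sR (a + b)" "lneg (R3 sR) (rbar sR a) = rbar sR (- a)"
  "lsmul (R3 sR) k (rbar sR a) = rbar sR (sR k a)"
  unfolding R3_def rbar_def
  using quot_add[OF kmod_rmod submodule_J, of a b] quot_neg[OF kmod_rmod submodule_J, of a]
    quot_smul[OF kmod_rmod submodule_J, of a k] by simp_all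

lemma rbar_eq_iff: "rbar sR a = rbar sR b \<longleftrightarrow> a - b \<in> J"
  unfolding rbar_def using lcoset_eq_iff[OF kmod_rmod submodule_J, of a b] by simp

lemma carr_R3: "carr (R3 sR) = range (rbar sR)"
  by (simp add: R3_def quot_carr rbar_def)

lemma U_simps:
  "ladd U (uelem c) (uelem d) = uelem (\<lambda>m. c m + d m)" "lneg U (uelem c) = uelem (\<lambda>m. - c m)"
  "lsmul U k (uelem c) = uelem (\<lambda>m. sR k (c m))" "lzero U = uelem (\<lambda>m. 0)"
  by (auto simp: Umod_def uelem_def rbar_simps R3_zero fun_eq_iff)

lemma lsub_U: "lsub U (uelem c) (uelem d) = uelem (\<lambda>m. c m - d m)"
  by (simp add: lsub_def U_simps)

lemma carr_U: "carr U = range uelem"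
proof
  show "range uelem \<subseteq> carr U"
    by (auto simp: Umod_def uelem_def carr_R3 R3_zero)
  show "carr U \<subseteq> range uelem"
  proof
    fix f assume "f \<in> carr U"
    then have f: "\<And>i. i \<in> Uidx \<Longrightarrow> f i \<in> range (rbar sR)" "\<And>i. i \<notin> Uidx \<Longrightarrow> f i = rbar sR 0"
      by (auto simp: Umod_def carr_R3 R3_zero)
    then have "\<forall>i. \<exists>a. i \<in> Uidx \<longrightarrow> f i = rbar sR a" by blast
    then obtain c where "\<And>i. i \<in> Uidx \<Longrightarrow> f i = rbar sR (c i)" by metis
    then have "f = uelem c" using f(2) by (auto simp: uelem_def fun_eq_iff)
    then show "f \<in> range uelem" by simp
  qed
qed

lemma uelem_closed [simp]: "uelem c \<in> carr U"
  by (simp add: carr_U)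

lemma uelem_eq_iff: "uelem c = uelem d \<longleftrightarrow> (\<forall>m\<in>Uidx. c m - d m \<in> J)"
  by (auto simp: uelem_def fun_eq_iff rbar_eq_iff)

lemma uelem_cong: "(\<And>m. m \<in> Uidx \<Longrightarrow> c m = d m) \<Longrightarrow> uelem c = uelem d"
  by (simp add: uelem_eq_iff J_closed)

lemma kmod_U: "kmod U"
  unfolding kmod_def carr_U by (simp add: U_simps sR_simps algebra_simps)

lemma uvec_eq: "m \<in> Uidx \<Longrightarrow> uvec sR m a = uelem (\<lambda>i. if i = m then a else 0)"
  by (auto simp: uvec_def uelem_def R3_zero fun_eq_iff)

text \<open>A positive index names the row, a negative one the column, shared by the two positions.
  The remaining indices are taken in increasing order, which produces the sign
  \<open>sgn2\<close>.\<close>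

definition minors :: "(nat \<Rightarrow> nat \<Rightarrow> 'r) \<Rightarrow> (nat \<Rightarrow> nat \<Rightarrow> 'r) \<Rightarrow> int \<Rightarrow> 'r" where
  "minors x y m = (if m = 1 then minor x y 1 2 1 3 else if m = 2 then minor x y 2 1 2 3
     else if m = 3 then minor x y 3 1 3 2 else if m = - 1 then minor x y 2 1 3 1
     else if m = - 2 then minor x y 1 2 3 2 else minor x y 1 3 2 3)"

lemma minors_add: "minors (\<lambda>p q. x p q + x' p q) y m = minors x y m + minors x' y m"
    "minors x (\<lambda>p q. y p q + y' p q) m = minors x y m + minors x y' m"
  and minors_smul: "minors (\<lambda>p q. sR k (x p q)) y m = sR k (minors x y m)"
    "minors x (\<lambda>p q. sR k (y p q)) m = sR k (minors x y m)"
  by (simp_all add: minors_def minor_def algebra_simps sR_simps)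

lemma minors_offdiag_zero:
  assumes "\<And>i j. distinct2 i j \<Longrightarrow> x i j = 0"
  shows "minors x y m = 0" "minors y x m = 0"
proof -
  have "distinct2 1 2" "distinct2 1 3" "distinct2 2 1" "distinct2 2 3" "distinct2 3 1" "distinct2 3 2"
    by (auto simp: distinct2_def idx3_iff)
  then show "minors x y m = 0" "minors y x m = 0" using assms by (simp_all add: minors_def minor_def)
qed

definition psi0 where
  "psi0 x y = uelem (minors (rho x) (rho y))"

lemma bilin_psi0: "bilin L L U psi0"
proof -
  have "bilin msl msl U (\<lambda>x y. uelem (minors x y))"
    unfolding bilin_def msl_simps by (simp add: U_simps minors_add[abs_def] minors_smul[abs_def])
  from bilin_comp[OF this lhom_linmap[OF rho(1)] lhom_linmap[OF rho(1)]]
  show ?thesis by (simp add: psi0_def[abs_def])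
qed

lemma cocycle_psi0: "cocycle L U psi0"
proof -
  have d: "distinct3 1 2 3" "distinct3 2 1 3" "distinct3 3 1 2"
    by (auto simp: distinct3_def idx3_iff)
  have *: "uelem (minors x (mat_br y z)) = lsub U (uelem (minors (mat_br x y) z)) (uelem (minors (mat_br x z) y))"
    if "mat_trace x \<in> J" "mat_trace y \<in> J" "mat_trace z \<in> J" for x y z
  proof -
    have "minors x (mat_br y z) m - (minors (mat_br x y) z m - minors (mat_br x z) y m) \<in> J" for m
      using minor_defect_in_J[OF d(1) that] minor_defect_in_J[OF d(2) that] minor_defect_in_J[OF d(3) that]
      unfolding minors_def minor_defect_def by (simp add: diff_diff_eq2 algebra_simps)
    then show ?thesis by (simp add: lsub_U uelem_eq_iff)
  qed
  show ?thesis
    using bilin_psi0 linmap_closed[OF lhom_linmap[OF rho(1)]]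
    by (auto simp: cocycle_def psi0_def lhom_br[OF rho(1)] msl_simps(1,6) intro!: *)
qed

text \<open>The commutator of \<open>emat i j a\<close> and \<open>emat j i b\<close> is diagonal.
  As \<open>minors\<close> reads only off-diagonal entries, this makes \<open>psi0\<close> vanish on
  \<open>stlH\<close>.\<close>

lemma rho_offdiag: "h \<in> stlH sR \<Longrightarrow> distinct2 p q \<Longrightarrow> rho h p q = 0"
proof -
  assume h: "h \<in> stlH sR" and pq: "distinct2 p q"
  note rl = lhom_linmap[OF rho(1)] and M = leibniz_kmod[OF leibniz_msl]
  let ?N = "{x \<in> carr L. rho x p q = 0}"
  have "submodule L ?N"
    unfolding submodule_def
    by (auto simp: kmod_L linmap_zero[OF kmod_L M rl] linmap_add[OF rl] linmap_neg[OF kmod_L M rl]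
        linmap_smul[OF rl] msl_simps sR_simps)
  moreover have "lbr L (X i j a) (X j i b) \<in> ?N" if "distinct2 i j" for i j a b
    using that pq distinct2_sym[OF that]
    by (simp add: lhom_br[OF rho(1)] rho(2) msl_simps mat_br_def mat_mult_emat distinct2_def)
      (auto simp: emat_def)
  ultimately have "stlH sR \<subseteq> ?N"
    unfolding stlH_def by (intro lspan_subset) (auto simp: distinct2_def)
  then show "rho h p q = 0" using h by blast
qed

lemma distinct3_iff: "distinct3 i j k \<longleftrightarrow>
    i = 1 \<and> j = 2 \<and> k = 3 \<or> i = 1 \<and> j = 3 \<and> k = 2 \<or> i = 2 \<and> j = 1 \<and> k = 3 \<or>
    i = 2 \<and> j = 3 \<and> k = 1 \<or> i = 3 \<and> j = 1 \<and> k = 2 \<or> i = 3 \<and> j = 2 \<and> k = 1"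
  unfolding distinct3_def idx3_iff by auto

lemma minors_emat:
  assumes "distinct3 i j k" "m \<in> Uidx"
  shows "minors (emat i j a) (emat i k b) m = sR (sgn2 j k) (if m = int i then a * b else 0)"
    "minors (emat i j a) (emat k j b) m = sR (sgn2 i k) (if m = - int j then a * b else 0)"
  using assms unfolding distinct3_iff Uidx_def
  by (elim disjE insertE emptyE conjE;
      simp add: minors_def minor_def emat_def sgn2_def sR_simps)+

text \<open>Each minor pairs two positions sharing exactly one of row and column, whereas
  \<open>(i, j)\<close> and \<open>(k, l)\<close> share both or neither.\<close>

lemma minors_emat_other:
  "i = k \<longleftrightarrow> j = l \<Longrightarrow> minors (emat i j a) (emat k l b) m = 0"
proof -
  assume *: "i = k \<longleftrightarrow> j = l"
  have "minor (emat i j a) (emat k l b) p q r s = 0" if "p = r \<longleftrightarrow> q \<noteq> s" for p q r s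
    using * that by (auto simp: minor_def emat_def)
  then show ?thesis by (simp add: minors_def)
qed

lemma psi_spec_psi0: "psi_spec sR psi0"
  unfolding psi_spec_def
proof (intro conjI ballI allI impI)
  show "bilin L L U psi0" by (rule bilin_psi0)
next
  fix i j k and a b :: 'r
  assume *: "i \<in> idx3" "j \<in> idx3" "k \<in> idx3" "i \<noteq> j \<and> j \<noteq> k \<and> i \<noteq> k"
  then have r: "rho (X i j a) = emat i j a" "rho (X i k b) = emat i k b" "rho (X k j b) = emat k j b"
    by (simp_all add: rho(2) distinct2_def)
  have d: "distinct3 i j k" using * by (simp add: distinct3_def)
  have m: "int i \<in> Uidx" "- int j \<in> Uidx" using * by (auto simp: idx3_iff Uidx_def)
  show "psi0 (X i j a) (X i k b) = lsmul U (sgn2 j k) (uvec sR (int i) (a * b))"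
    unfolding psi0_def uvec_eq[OF m(1)] U_simps r
    by (rule uelem_cong) (simp add: minors_emat[OF d])
  show "psi0 (X i j a) (X k j b) = lsmul U (sgn2 i k) (uvec sR (- int j) (a * b))"
    unfolding psi0_def uvec_eq[OF m(2)] U_simps r
    by (rule uelem_cong) (simp add: minors_emat[OF d])
next
  fix i j k l and a b :: 'r
  assume *: "i \<in> idx3" "j \<in> idx3" "k \<in> idx3" "l \<in> idx3"
    "i \<noteq> j \<and> k \<noteq> l \<and> \<not> (i = k \<and> j \<noteq> l) \<and> \<not> (j = l \<and> i \<noteq> k)"
  then have r: "rho (X i j a) = emat i j a" "rho (X k l b) = emat k l b"
    by (simp_all add: rho(2) distinct2_def)
  show "psi0 (X i j a) (X k l b) = lzero U"
    unfolding psi0_def U_simps r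
    using * by (intro uelem_cong minors_emat_other) auto
next
  fix h y assume "h \<in> stlH sR"
  note z = minors_offdiag_zero[of "rho h", OF rho_offdiag[OF this]]
  show "psi0 h y = lzero U" "psi0 y h = lzero U"
    unfolding psi0_def U_simps by (rule uelem_cong, simp add: z)+
qed

lemma psi_specD:
  assumes "psi_spec sR p"
  shows "bilin L L U p"
    and "distinct3 i j k \<Longrightarrow> p (X i j a) (X i k b) = lsmul U (sgn2 j k) (uvec sR (int i) (a * b))"
    and "distinct3 i j k \<Longrightarrow> p (X i j a) (X k j b) = lsmul U (sgn2 i k) (uvec sR (- int j) (a * b))"
    and "distinct2 i j \<Longrightarrow> distinct2 k l \<Longrightarrow> i = k \<longleftrightarrow> j = l \<Longrightarrow> p (X i j a) (X k l b) = lzero U"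
    and "h \<in> stlH sR \<Longrightarrow> y \<in> carr L \<Longrightarrow> p h y = lzero U"
    and "h \<in> stlH sR \<Longrightarrow> y \<in> carr L \<Longrightarrow> p y h = lzero U"
  using assms unfolding psi_spec_def distinct2_def distinct3_def by simp_all

lemma Hset_stlH: "h \<in> Hset \<Longrightarrow> h \<in> stlH sR"
proof -
  assume "h \<in> Hset"
  then have "h \<in> {lbr L (X i j a) (X j i b) | i j a b. i \<in> idx3 \<and> j \<in> idx3 \<and> i \<noteq> j}"
    unfolding Hset_def distinct2_def .
  then show "h \<in> stlH sR" unfolding stlH_def by (rule subsetD[OF lspan_superset])
qed

text \<open>The specification prescribes all values on the spanning set
  \<open>Xset \<union> Hset\<close>. Hence the chosen \<open>psi\<close> agrees with
  \<open>psi0\<close> and inherits its cocycle identity.\<close>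

lemma psi_spec_unique:
  assumes p: "psi_spec sR p" and q: "psi_spec sR q" and "x \<in> carr L" "y \<in> carr L"
  shows "p x y = q x y"
proof (rule spans_bilin_eq[OF kmod_L kmod_L kmod_U psi_specD(1)[OF p] psi_specD(1)[OF q] spans_L spans_L _ assms(3,4)])
  note P = psi_specD[OF p] and Q = psi_specD[OF q]
  fix s t assume s: "s \<in> Xset \<union> Hset" and t: "t \<in> Xset \<union> Hset"
  then have carr: "s \<in> carr L" "t \<in> carr L" using spans_L by (auto simp: spans_def)
  consider "s \<in> Hset" | "t \<in> Hset" | "s \<in> Xset" "t \<in> Xset" using s t by blast
  then show "p s t = q s t"
  proof cases
    case 1
    then show ?thesis using P(5) Q(5) Hset_stlH carr by metis
  next
    case 2
    then show ?thesis using P(6) Q(6) Hset_stlH carr by metis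
  next
    case 3
    then obtain i j a k l b where st: "s = X i j a" "t = X k l b" and d: "distinct2 i j" "distinct2 k l"
      unfolding Xset_def by blast
    consider "i = k \<longleftrightarrow> j = l" | "i = k" "j \<noteq> l" | "i \<noteq> k" "j = l" by blast
    then show ?thesis
    proof cases
      case 1
      then show ?thesis using P(4) Q(4) d by (simp add: st)
    next
      case 2
      then have "distinct3 i j l" using d by (auto simp: distinct2_def distinct3_def)
      then show ?thesis using P(2) Q(2) 2 by (simp add: st)
    next
      case 3
      then have "distinct3 i j k" using d by (auto simp: distinct2_def distinct3_def)
      then show ?thesis using P(3) Q(3) 3 by (simp add: st)
    qed
  qed
qed

abbreviation \<psi> where "\<psi> \<equiv> psi sR"

lemma psi_spec_psi: "psi_spec sR \<psi>"
  unfolding psi_def by (rule someI[of "psi_spec sR", OF psi_spec_psi0])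

lemmas psi_row = psi_specD(2)[OF psi_spec_psi]
  and psi_col = psi_specD(3)[OF psi_spec_psi]
  and psi_other = psi_specD(4)[OF psi_spec_psi]

lemma cocycle_psi: "cocycle L U \<psi>"
proof -
  have eq: "\<psi> x y = psi0 x y" if "x \<in> carr L" "y \<in> carr L" for x y
    by (rule psi_spec_unique[OF psi_spec_psi psi_spec_psi0 that])
  show ?thesis
    using cocycle_psi0 psi_specD(1)[OF psi_spec_psi] unfolding cocycle_def by (simp add: eq)
qed

abbreviation E where "E \<equiv> hat_stl3 sR"

lemma hat_eq_cext: "E = cext U L \<psi>"
  by (simp add: hat_stl3_def cext_def Let_def)

lemma leibniz_E: "leibniz E"
  unfolding hat_eq_cext by (rule leibniz_cext[OF kmod_U leibniz_L cocycle_psi])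

lemma sgn2_smul: "a \<in> carr U \<Longrightarrow> lsmul U (sgn2 j k) a = (if j < k then a else lneg U a)"
  by (simp add: sgn2_def kmod_U)

lemma uvec_closed: "m \<in> Uidx \<Longrightarrow> uvec sR m a \<in> carr U"
  by (simp add: uvec_eq)

lemma uvec_index: "i \<in> idx3 \<Longrightarrow> int i \<in> Uidx" "i \<in> idx3 \<Longrightarrow> - int i \<in> Uidx"
  by (auto simp: idx3_iff Uidx_def)

end

subsection \<open>Cocycles on the Steinberg Leibniz algebra\<close>

context kalg
begin

lemma third_index: "distinct3 i j k \<Longrightarrow> 6 - i - j = k"
  unfolding distinct3_iff by auto

lemma spans_U: "spans U {uvec sR m a | m a. m \<in> Uidx}"
proof (rule spansI)
  show "{uvec sR m a | m a. m \<in> Uidx} \<subseteq> carr U" by (auto simp: uvec_closed)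
next
  fix N assume N: "submodule U N" "{uvec sR m a | m a. m \<in> Uidx} \<subseteq> N"
  have step: "uelem (\<lambda>m. if m \<in> A then c m else 0) \<in> N" if "finite A" "A \<subseteq> Uidx" for A c
    using that
  proof (induction A rule: finite_induct)
    case empty
    then show ?case using submoduleD(2)[OF N(1)] by (simp add: U_simps)
  next
    case (insert n A)
    then have "uvec sR n (c n) \<in> N" using N(2) by blast
    then have "uelem (\<lambda>m. if m = n then c n else 0) \<in> N" using insert.prems by (simp add: uvec_eq)
    moreover have "uelem (\<lambda>m. if m \<in> A then c m else 0) \<in> N" using insert by simp
    ultimately have "uelem (\<lambda>m. (if m = n then c n else 0) + (if m \<in> A then c m else 0)) \<in> N"
      unfolding U_simps(1)[symmetric] by (rule submoduleD(3)[OF N(1)])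
    moreover have "(\<lambda>m. (if m = n then c n else 0) + (if m \<in> A then c m else 0)) =
        (\<lambda>m. if m \<in> insert n A then c m else 0)"
      using insert.hyps(2) by auto
    ultimately show ?case by simp
  qed
  show "carr U \<subseteq> N"
  proof
    fix u assume "u \<in> carr U"
    then obtain c where c: "u = uelem c" by (auto simp: carr_U)
    have "u = uelem (\<lambda>m. if m \<in> Uidx then c m else 0)" unfolding c by (rule uelem_cong) simp
    then show "u \<in> N" using step[of Uidx c] by (simp add: Uidx_def)
  qed
qed

text \<open>Each \<open>g m\<close> kills \<open>J\<close> and so factors through \<open>R3\<close>;
  the map adds up the six induced maps, each applied to its own coordinate.\<close>

lemma U_lift:
  assumes W: "kmod W" and g: "\<And>m. m \<in> Uidx \<Longrightarrow> linmap (rmod sR) W (g m)"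
    and J: "\<And>m a. m \<in> Uidx \<Longrightarrow> a \<in> J \<Longrightarrow> g m a = lzero W"
  obtains f where "linmap U W f" "\<And>m a. m \<in> Uidx \<Longrightarrow> f (uvec sR m a) = g m a"
proof -
  have "\<exists>e. linmap (R3 sR) W e \<and> (\<forall>a. e (rbar sR a) = g m a)" if m: "m \<in> Uidx" for m
    by (rule quot_lift[OF kmod_rmod submodule_J W g[OF m] J[OF m]])
       (auto simp: R3_def rbar_def)
  then obtain e :: "int \<Rightarrow> _" where e: "\<And>m. m \<in> Uidx \<Longrightarrow> linmap (R3 sR) W (e m)"
    "\<And>m a. m \<in> Uidx \<Longrightarrow> e m (rbar sR a) = g m a"
    by metis
  have lin: "linmap U W (\<lambda>u. e m (u m))" if "m \<in> Uidx" for m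
    unfolding linmap_def carr_U ball_simps U_simps using that linmap_add[OF g[OF that]] linmap_smul[OF g[OF that]]
      linmap_closed[OF g[OF that]] by (simp add: uelem_def e)
  define f where "f u = ladd W (e 1 (u 1)) (ladd W (e 2 (u 2)) (ladd W (e 3 (u 3))
      (ladd W (e (- 1) (u (- 1))) (ladd W (e (- 2) (u (- 2))) (e (- 3) (u (- 3)))))))"
    for u :: "int \<Rightarrow> 'r set"
  have "linmap U W f"
    unfolding f_def[abs_def] by (intro linmap_add_map W lin) (auto simp: Uidx_def)
  moreover have "f (uvec sR m a) = g m a" if m: "m \<in> Uidx" for m a
  proof -
    have idx: "1 \<in> Uidx" "2 \<in> Uidx" "3 \<in> Uidx" "- 1 \<in> Uidx" "- 2 \<in> Uidx" "- 3 \<in> Uidx"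
      by (simp_all add: Uidx_def)
    have gc: "g m a \<in> carr W" using linmap_closed[OF g[OF m], of a] by simp
    have en: "e n (uvec sR m a n) = (if n = m then g m a else lzero W)" if "n \<in> Uidx" for n
      using that m e(2)[OF that] linmap_zero[OF kmod_rmod W g[OF that]]
      by (simp add: uvec_eq uelem_def)
    show ?thesis
      using m gc W unfolding f_def idx[THEN en] Uidx_def by (elim insertE emptyE) simp_all
  qed
  ultimately show thesis by (rule that)
qed

section \<open>Values of a cocycle on pairs of generators\<close>

context
  fixes W :: "('k, 'w) lalg" and T
  assumes W: "kmod W" and T: "cocycle L W T"
begin

lemmas T_closed [simp] = bilin_closed[OF cocycle_bilin[OF T]]
lemmas T_jacobi = cocycleD[OF T]
lemmas T_add = bilin_add_left[OF cocycle_bilin[OF T]] bilin_add_right[OF cocycle_bilin[OF T]]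
lemmas T_neg = bilin_neg_left[OF kmod_L W cocycle_bilin[OF T]] bilin_neg_right[OF kmod_L W cocycle_bilin[OF T]]
lemmas T_zero = bilin_zero_left[OF kmod_L W cocycle_bilin[OF T]] bilin_zero_right[OF kmod_L W cocycle_bilin[OF T]]
lemmas T_simps = T_add T_neg T_zero

lemma T_linear:
  assumes "distinct2 i j" "y \<in> carr L"
  shows "linmap (rmod sR) W (\<lambda>a. T (X i j a) y)"
  using bilin_smul_left[OF cocycle_bilin[OF T]] assms
  by (simp add: linmap_def X_add X_smul T_add)

text \<open>Write \<open>X i j b = [X i k b, X k j 1]\<close>; the bracket of \<open>X i j a\<close>
  with either factor is zero, so both terms of the cocycle identity vanish.\<close>

lemma T_same:
  assumes "distinct2 i j"
  shows "T (X i j a) (X i j b) = lzero W"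
proof -
  obtain k where d: "distinct3 i j k" using distinct2_third[OF assms] .
  then show ?thesis
    using d distinct3D[OF d] T_jacobi[of "X i j a" "X i k b" "X k j 1"]
    by (simp add: br1 br0 T_simps W kmod_L)
qed

text \<open>Right multiplication by \<open>h = hh i j 1 1\<close> acts on \<open>X i j a\<close> as
  -2 and on \<open>y\<close> as -1. For the value \<open>t = T (X i j a) y\<close>, the cocycle
  identity at \<open>X i j a\<close>, \<open>y\<close>, \<open>h\<close> then reads
  \<open>- t = 2 t\<close>.\<close>

lemma T_triple_zero:
  assumes d: "distinct3 i j k" and y: "y \<in> carr L" "lbr L y (hh i j 1 1) = lneg L y" "lbr L (X i j a) y = lzero L"
  shows "T (X i j (3 * a)) y = lzero W"
proof -
  note D = distinct3D[OF d]
  let ?t = "T (X i j a) y"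
  have t: "?t \<in> carr W" using D y by simp
  have "lneg W ?t = ladd W ?t ?t"
    using D y T_jacobi[of "X i j a" y "hh i j 1 1"]
    by (simp add: X_hh_long[OF d] X_add T_simps W kmod_L lsub_def)
  then have "ladd W ?t (ladd W ?t ?t) = lzero W" using t W by (metis kmod_neg_right)
  then show ?thesis using D y t by (simp add: mult_3_eq_add X_add T_add kmod_assoc W kmod_L)
qed

lemma T_row:
  assumes d: "distinct3 i j k"
  shows "T (X i j a) (X i k b) = T (X i j (a * b)) (X i k 1)"
    "T (X i j a) (X i k 1) = lneg W (T (X i k a) (X i j 1))"
    "r \<in> J \<Longrightarrow> T (X i j r) (X i k 1) = lzero W"
proof -
  note D = distinct3D[OF d]
  \<comment> \<open>The cocycle identity for \<open>X i k (b * c) = [X i j b, X j k c]\<close>.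
    Setting \<open>c = 1\<close> gives antisymmetry, and combining the two moves a factor from the
    second argument to the first.\<close>
  have sw: "T (X i j a) (X i k (b * c)) = lneg W (T (X i k (a * c)) (X i j b))" for a b c
    using d D T_jacobi[of "X i j a" "X i j b" "X j k c"] by (simp add: br1 br0 T_simps W kmod_L lsub_def)
  have anti: "T (X i j a) (X i k b) = lneg W (T (X i k a) (X i j b))" for a b
    using sw[of a b 1] by simp
  have shift: "T (X i j a) (X i k (b * c)) = T (X i j (a * c)) (X i k b)" for a b c
    using sw[of a b c] anti[of "a * c" b] by simp
  show prod: "T (X i j a) (X i k b) = T (X i j (a * b)) (X i k 1)" for a b
    using shift[of a 1 b] by simp
  show "T (X i j a) (X i k 1) = lneg W (T (X i k a) (X i j 1))" by (rule anti)
  show "T (X i j r) (X i k 1) = lzero W" if "r \<in> J"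
  proof (rule J_induct[OF W T_linear _ _ that])
    show "distinct2 i j" "X i k 1 \<in> carr L" using D by simp_all
    show "T (X i j (3 * r)) (X i k 1) = lzero W" for r
      using D by (intro T_triple_zero[OF d]) (simp_all add: X_hh[OF d] br0)
    fix r a b
    \<comment> \<open>Moving \<open>a * b\<close> across as one factor, or \<open>b\<close> first
      and \<open>a\<close> afterwards, gives the two orders.\<close>
    have "T (X i j (r * a * b)) (X i k 1) = T (X i j (r * b * a)) (X i k 1)"
      using shift[of r a b] by (simp add: prod[of r "a * b"] prod[of "r * b" a] mult.assoc)
    then show "T (X i j (r * (a * b - b * a))) (X i k 1) = lzero W"
      using D linmap_sub[OF kmod_rmod W T_linear[of i j "X i k 1"], of "r * a * b" "r * b * a"]
      by (simp add: right_diff_distrib W mult.assoc)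
  qed
qed

lemma T_col:
  assumes d: "distinct3 i j k"
  shows "T (X i j a) (X k j b) = T (X i j (a * b)) (X k j 1)"
    "T (X i j a) (X k j 1) = lneg W (T (X k j a) (X i j 1))"
    "r \<in> J \<Longrightarrow> T (X i j r) (X k j 1) = lzero W"
proof -
  note D = distinct3D[OF d]
  have sw: "T (X i j a) (X k j (b * c)) = lneg W (T (X k j (b * a)) (X i j c))" for a b c
    using d D T_jacobi[of "X i j a" "X k i b" "X i j c"] by (simp add: br1 br2 br0 T_simps W kmod_L lsub_def)
  have anti: "T (X i j a) (X k j b) = lneg W (T (X k j a) (X i j b))" for a b
    using sw[of a 1 b] by simp
  have shift: "T (X i j a) (X k j (b * c)) = T (X i j (b * a)) (X k j c)" for a b c
    using sw[of a b c] anti[of "b * a" c] by simp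
  have prod: "T (X i j a) (X k j b) = T (X i j (b * a)) (X k j 1)" for a b
    using shift[of a b 1] by simp
  \<comment> \<open>In contrast to rows, factors arrive at the left end of the first argument and
    are exchanged there; \<open>cyc\<close> then carries this over to the left multiples of
    commutators that span \<open>J\<close>.\<close>
  have comm: "T (X i j (a * b * c)) (X k j 1) = T (X i j (b * a * c)) (X k j 1)" for a b c
    using shift[of c a b] by (simp add: prod[of c "a * b"] prod[of "a * c" b] mult.assoc)
  have cyc: "T (X i j (a * b)) (X k j 1) = T (X i j (b * a)) (X k j 1)" for a b
    using comm[of a b 1] by simp
  show "T (X i j a) (X k j b) = T (X i j (a * b)) (X k j 1)" using prod cyc by simp
  show "T (X i j a) (X k j 1) = lneg W (T (X k j a) (X i j 1))" by (rule anti)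
  show "T (X i j r) (X k j 1) = lzero W" if "r \<in> J"
  proof (rule J_induct[OF W T_linear _ _ that])
    show "distinct2 i j" "X k j 1 \<in> carr L" using D by simp_all
    show "T (X i j (3 * r)) (X k j 1) = lzero W" for r
      using D by (intro T_triple_zero[OF d]) (simp_all add: X_hh[OF d] br0)
    fix r a b
    have "T (X i j (r * a * b)) (X k j 1) = T (X i j (r * b * a)) (X k j 1)"
      using cyc[of "r * a" b] comm[of b r a] by (simp add: mult.assoc)
    then show "T (X i j (r * (a * b - b * a))) (X k j 1) = lzero W"
      using D linmap_sub[OF kmod_rmod W T_linear[of i j "X k j 1"], of "r * a * b" "r * b * a"]
      by (simp add: right_diff_distrib W mult.assoc)
  qed
qed

text \<open>The cocycle identity is applied with third argument \<open>hh i j 1 1\<close>. The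
  multiples of the unknown value on its two sides differ by exactly one, so it can be solved for
  without any division in \<open>K\<close>.\<close>

lemma T_prod:
  assumes d: "distinct3 i j k"
  shows "T (X i j a) (X j k b) = lneg W (T (X i k (a * b)) (hh i j 1 1))"
    "T (X j k b) (X i j a) = T (X i k (a * b)) (hh i j 1 1)"
proof -
  note D = distinct3D[OF d]
  let ?t = "T (X i j a) (X j k b)" and ?s = "T (X j k b) (X i j a)" and ?h = "T (X i k (a * b)) (hh i j 1 1)"
  have c: "?t \<in> carr W" "?s \<in> carr W" "?h \<in> carr W" using D by simp_all
  have eq: "?t = ladd W ?h (ladd W ?t ?t)"
    using d D T_jacobi[of "X i j a" "X j k b" "hh i j 1 1"]
    by (simp add: X_hh[OF d] X_hh_long[OF d] br1 X_add T_simps W kmod_L lsub_def)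
  have "ladd W ?t (ladd W ?h ?t) = ?t" using eq kmod_lcomm[OF W c(1,3,1)] by simp
  also have "\<dots> = ladd W ?t (lzero W)" using c W by simp
  finally have "ladd W ?h ?t = lzero W" using c W by (subst (asm) kmod_cancel) simp_all
  then show "?t = lneg W ?h" by (rule kmod_neg_unique[OF W c(3,1)])
  have "lneg W (ladd W ?s ?s) = ladd W (lneg W ?h) (lneg W ?s)"
    using d D T_jacobi[of "X j k b" "X i j a" "hh i j 1 1"]
    by (simp add: X_hh[OF d] X_hh_long[OF d] br2 X_add T_simps W kmod_L lsub_def)
  from arg_cong[OF this, of "lneg W"] have "ladd W ?s ?s = ladd W ?h ?s" using c W
    by (simp add: kmod_neg_add)
  then have "ladd W ?s ?s = ladd W ?s ?h" by (simp only: kmod_comm[OF W c(3,2)])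
  then show "?s = ?h" using c W by (subst (asm) kmod_cancel) simp_all
qed

end

text \<open>The lifts \<open>(T (X\<^sub>i\<^sub>k(a), X\<^sub>k\<^sub>j(1)), X\<^sub>i\<^sub>j(a))\<close> satisfy the Steinberg relations in the
  extension defined by \<open>T\<close>, so the presentation of \<open>stl\<^sub>3(R)\<close> yields a section that is a homomorphism.\<close>

lemma cocycle_coboundary:
  assumes W: "kmod W" and T: "cocycle L W T"
    and zero: "\<And>i j k l a b. distinct2 i j \<Longrightarrow> distinct2 k l \<Longrightarrow> j \<noteq> k \<Longrightarrow> i \<noteq> l \<Longrightarrow>
      T (X i j a) (X k l b) = lzero W"
  obtains f where "linmap L W f" "\<And>x y. x \<in> carr L \<Longrightarrow> y \<in> carr L \<Longrightarrow> f (lbr L x y) = T x y"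
proof -
  note Tp = T_prod[OF W T] and Tc = bilin_closed[OF cocycle_bilin[OF T]]
  define P where "P = cext W L T"
  have P: "leibniz P" unfolding P_def by (rule leibniz_cext[OF W leibniz_L T])
  \<comment> \<open>A homomorphic section must send \<open>X i j a = [X i k a, X k j 1]\<close> to
    an element with this first component, where \<open>k = 6 - i - j\<close>.\<close>
  define Y where "Y i j a = (T (X i (6 - i - j) a) (X (6 - i - j) j 1), X i j a)" for i j a
  have Y: "Y i j a = (T (X i k a) (X k j 1), X i j a)" if "distinct3 i j k" for i j k a
    using third_index[OF that] by (simp add: Y_def)
  have "steinberg sR P Y"
    unfolding steinberg_def
  proof (intro conjI allI impI)
    fix i j assume "distinct2 i j"
    then obtain k where d: "distinct3 i j k" by (rule distinct2_third)
    note D = distinct3D[OF d]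
    have "linmap (rmod sR) W (\<lambda>a. T (X i k a) (X k j 1))"
      using D by (intro T_linear[OF W T]) simp_all
    then show "linmap (rmod sR) P (Y i j)"
      using X_lin[OF D(1)] by (simp add: linmap_def Y[OF d] P_def)
  next
    fix i j k a b assume d: "distinct3 i j k"
    note D = distinct3D[OF d]
    \<comment> \<open>By \<open>T_prod\<close> both first components equal the negative of
      \<open>T (X i k (a * b)) (hh i j 1 1)\<close>.\<close>
    show "lbr P (Y i j a) (Y j k b) = Y i k (a * b)"
      using Tp(1)[OF d, of a b] Tp(1)[OF d, of "a * b" 1] d D
      by (simp add: Y[of i j k] Y[of j k i] Y[of i k j] P_def br1)
    show "lbr P (Y i j a) (Y k i b) = lneg P (Y k j (b * a))"
      using Tp(1)[of k i j "b * a" 1] Tp(2)[of k i j a b] d D W Tc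
      by (simp add: Y[of i j k] Y[of k i j] Y[of k j i] P_def br2)
  next
    fix i j k l a b assume *: "distinct2 i j" "distinct2 k l" "j \<noteq> k" "i \<noteq> l"
    then show "lbr P (Y i j a) (Y k l b) = lzero P"
      by (simp add: Y_def P_def br0 zero)
  qed
  then obtain f where f: "lhom L P f" "\<And>i j a. distinct2 i j \<Longrightarrow> f (X i j a) = Y i j a"
    using stl_lift[OF P] by blast
  note fl = lhom_linmap[OF f(1)]
  have lin: "linmap P W fst" "linmap P L snd" by (auto simp: linmap_def P_def)
  have fc: "fst (f x) \<in> carr W" "snd (f x) \<in> carr L" if "x \<in> carr L" for x
    using linmap_closed[OF fl that] by (auto simp: P_def)
  have br: "f (lbr L x y) = (T (snd (f x)) (snd (f y)), lbr L (snd (f x)) (snd (f y)))"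
    if "x \<in> carr L" "y \<in> carr L" for x y
    unfolding lhom_br[OF f(1) that] P_def
    by (cases "f x"; cases "f y") simp
  have linid: "linmap L L (\<lambda>x. x)" by (simp add: linmap_def)
  \<comment> \<open>The composite of \<open>f\<close> with \<open>snd\<close> preserves brackets and
    fixes the generators, so it is the identity and \<open>f\<close> is a section. The first
    component of \<open>f\<close> on brackets is then \<open>T\<close>.\<close>
  have "carr L \<subseteq> {x \<in> carr L. snd (f x) = x}"
    by (rule stl_generated[OF submodule_equalizer[OF kmod_L kmod_L linmap_comp[OF fl lin(2)] linid]])
       (auto simp: f(2) Y_def br)
  then have id: "snd (f x) = x" if "x \<in> carr L" for x using that by blast
  show thesis
  proof (rule that[of "\<lambda>x. fst (f x)"])
    show "linmap L W (\<lambda>x. fst (f x))" by (rule linmap_comp[OF fl lin(1)])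
    show "fst (f (lbr L x y)) = T x y" if "x \<in> carr L" "y \<in> carr L" for x y
      using that by (simp add: br id)
  qed
qed

text \<open>The existence half of universality: \<open>e\<close> on \<open>U\<close> reproduces
  \<open>T\<close> on commuting generators, the rest of \<open>T\<close> is a coboundary given by
  \<open>f\<close>, and the required map is their sum. \<open>spans_E\<close> supplies
  uniqueness.\<close>

theorem cocycle_factorization:
  assumes W: "kmod W" and T: "cocycle L W T"
  obtains \<eta> where "linmap E W \<eta>"
    "\<And>x y. x \<in> carr L \<Longrightarrow> y \<in> carr L \<Longrightarrow> \<eta> (\<psi> x y, lbr L x y) = T x y"
proof -
  note Tc = bilin_closed[OF cocycle_bilin[OF T]]
  \<comment> \<open>The positions are those of \<open>minors\<close>, with the smaller free index
    first, so that \<open>\<psi>\<close> takes each of these pairs to the vector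
    \<open>uvec sR m a\<close> with sign 1.\<close>
  define g where "g m = (if m = 1 then (\<lambda>a. T (X 1 2 a) (X 1 3 1)) else if m = 2 then (\<lambda>a. T (X 2 1 a) (X 2 3 1))
     else if m = 3 then (\<lambda>a. T (X 3 1 a) (X 3 2 1)) else if m = - 1 then (\<lambda>a. T (X 2 1 a) (X 3 1 1))
     else if m = - 2 then (\<lambda>a. T (X 1 2 a) (X 3 2 1)) else (\<lambda>a. T (X 1 3 a) (X 2 3 1)))" for m :: int
  have d6: "distinct3 1 2 3" "distinct3 2 1 3" "distinct3 3 1 2" "distinct3 1 3 2" "distinct3 2 3 1" "distinct3 3 2 1"
    by (simp_all add: distinct3_iff)
  note D6 = d6[THEN distinct3D(1)]
  have gl: "linmap (rmod sR) W (g m)" for m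
    unfolding g_def using T_linear[OF W T D6(1) X_closed[OF D6(4)]] T_linear[OF W T D6(2) X_closed[OF D6(5)]]
      T_linear[OF W T D6(3) X_closed[OF D6(6)]] T_linear[OF W T D6(2) X_closed[OF D6(3)]]
      T_linear[OF W T D6(1) X_closed[OF D6(6)]] T_linear[OF W T D6(4) X_closed[OF D6(5)]]
    by simp
  have gJ: "g m a = lzero W" if "a \<in> J" for m a
    unfolding g_def using that
      T_row(3)[OF W T d6(1)] T_row(3)[OF W T d6(2)] T_row(3)[OF W T d6(3)]
      T_col(3)[OF W T d6(2)] T_col(3)[OF W T d6(1)] T_col(3)[OF W T d6(4)]
    by simp
  obtain e where e: "linmap U W e" "\<And>m a. m \<in> Uidx \<Longrightarrow> e (uvec sR m a) = g m a"
    by (rule U_lift[OF W gl gJ]) (assumption, rule that)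
  have row: "T (X i j a) (X i k b) = e (\<psi> (X i j a) (X i k b))" if d: "distinct3 i j k" for i j k a b
  proof -
    have i: "int i \<in> Uidx" using d by (simp add: distinct3_def uvec_index)
    have "g (int i) (a * b) = (if j < k then T (X i j (a * b)) (X i k 1) else T (X i k (a * b)) (X i j 1))"
      using d unfolding distinct3_iff by (auto simp: g_def)
    then show ?thesis
      using T_row(1,2)[OF W T d] i linmap_closed[OF gl, of "a * b"]
      by (simp add: psi_row[OF d] sgn2_smul uvec_closed linmap_neg[OF kmod_U W e(1)] e(2))
  qed
  have col: "T (X i j a) (X k j b) = e (\<psi> (X i j a) (X k j b))" if d: "distinct3 i j k" for i j k a b
  proof -
    have i: "- int j \<in> Uidx" using d by (simp add: distinct3_def uvec_index)
    have "g (- int j) (a * b) = (if i < k then T (X i j (a * b)) (X k j 1) else T (X k j (a * b)) (X i j 1))"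
      using d unfolding distinct3_iff by (auto simp: g_def)
    then show ?thesis
      using T_col(1,2)[OF W T d] i linmap_closed[OF gl, of "a * b"]
      by (simp add: psi_col[OF d] sgn2_smul uvec_closed linmap_neg[OF kmod_U W e(1)] e(2))
  qed
  have e0: "e (lzero U) = lzero W" by (rule linmap_zero[OF kmod_U W e(1)])
  have ce: "cocycle L W (\<lambda>x y. e (\<psi> x y))"
    by (rule linmap_cocycle[OF kmod_U W cocycle_psi e(1) leibniz_L])
  define T' where "T' x y = lsub W (T x y) (e (\<psi> x y))" for x y
  have "cocycle L W T'"
    unfolding cocycle_def
  proof (intro conjI ballI)
    show "bilin L L W T'"
      unfolding T'_def[abs_def] by (rule bilin_sub[OF W cocycle_bilin[OF T] cocycle_bilin[OF ce]])
    fix x y z assume "x \<in> carr L" "y \<in> carr L" "z \<in> carr L"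
    then show "T' x (lbr L y z) = lsub W (T' (lbr L x y) z) (T' (lbr L x z) y)"
      using W Tc bilin_closed[OF cocycle_bilin[OF ce]]
      by (simp add: T'_def cocycleD[OF T] cocycleD[OF ce] lsub_def kmod_neg_add kmod_ac)
  qed
  moreover have "T' (X i j a) (X k l b) = lzero W" if d: "distinct2 i j" "distinct2 k l" "j \<noteq> k" "i \<noteq> l"
    for i j k l a b
  proof -
    have eq: "T (X i j a) (X k l b) = e (\<psi> (X i j a) (X k l b))"
    proof -
      consider "i = k" "j = l" | "i = k" "j \<noteq> l" | "j = l" "i \<noteq> k" | "i \<noteq> k" "j \<noteq> l" by blast
      then show ?thesis
      proof cases
        case 1
        then show ?thesis using T_same[OF W T d(1)] psi_other[of i j i j] d e0 by simp
      next
        case 2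
        then have "distinct3 i j l" using d by (auto simp: distinct2_def distinct3_def)
        then show ?thesis using row 2 by simp
      next
        case 3
        then have "distinct3 i j k" using d by (auto simp: distinct2_def distinct3_def)
        then show ?thesis using col 3 by simp
      next
        case 4
        \<comment> \<open>All four indices would be pairwise distinct, which three values do not
          allow.\<close>
        then have False using d unfolding distinct2_def idx3_iff by auto
        then show ?thesis ..
      qed
    qed
    show ?thesis unfolding T'_def eq[symmetric] using d W Tc by simp
  qed
  ultimately obtain f where f: "linmap L W f" "\<And>x y. x \<in> carr L \<Longrightarrow> y \<in> carr L \<Longrightarrow> f (lbr L x y) = T' x y"
    using cocycle_coboundary[OF W] by blast
  show thesis
  proof (rule that[of "\<lambda>(u, x). ladd W (e u) (f x)"])
    have "linmap E U fst" "linmap E L snd" by (auto simp: linmap_def hat_eq_cext)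
    then have "linmap E W (\<lambda>w. ladd W (e (fst w)) (f (snd w)))"
      by (intro linmap_add_map[OF W] linmap_comp[OF _ e(1)] linmap_comp[OF _ f(1)])
    then show "linmap E W (\<lambda>(u, x). ladd W (e u) (f x))" by (simp add: case_prod_beta')
    fix x y assume "x \<in> carr L" "y \<in> carr L"
    then show "(case (\<psi> x y, lbr L x y) of (u, x) \<Rightarrow> ladd W (e u) (f x)) = T x y"
      using W Tc bilin_closed[OF cocycle_bilin[OF ce]] by (simp add: f(2) T'_def lsub_def kmod_ac)
  qed
qed

text \<open>\<open>\<psi>\<close> vanishes on \<open>X i k a\<close>, \<open>X k j 1\<close> and on
  opposite generators, so such brackets give the spanning set of \<open>L\<close>. Distinct
  generators in one row or column have bracket zero in \<open>L\<close> and give the spanning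
  vectors of \<open>U\<close>. Linear maps out of \<open>E\<close> are therefore determined on
  brackets.\<close>

lemma spans_E: "spans E {lbr E u v | u v. u \<in> carr E \<and> v \<in> carr E}"
proof (rule spansI)
  show "{lbr E u v | u v. u \<in> carr E \<and> v \<in> carr E} \<subseteq> carr E"
    using bilin_closed[OF leibniz_bilin[OF leibniz_E]] by auto
next
  fix N assume N: "submodule E N" and B: "{lbr E u v | u v. u \<in> carr E \<and> v \<in> carr E} \<subseteq> N"
  note K = leibniz_kmod[OF leibniz_E] and D = submoduleD[OF N]
  have br: "(\<psi> x y, lbr L x y) \<in> N" if "x \<in> carr L" "y \<in> carr L" for x y
  proof -
    have "(lzero U, x) \<in> carr E" "(lzero U, y) \<in> carr E"
      using that kmod_U by (simp_all add: hat_eq_cext)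
    then have "lbr E (lzero U, x) (lzero U, y) \<in> N" using B by blast
    then show ?thesis by (simp add: hat_eq_cext)
  qed
  have iL: "linmap L E (\<lambda>x. (lzero U, x))" and iU: "linmap U E (\<lambda>u. (u, lzero L))"
    by (simp_all add: linmap_def hat_eq_cext kmod_U kmod_L)
  have "Xset \<union> Hset \<subseteq> {x \<in> carr L. (lzero U, x) \<in> N}"
  proof
    fix x assume x: "x \<in> Xset \<union> Hset"
    then have "x \<in> carr L" using spans_L by (auto simp: spans_def)
    moreover have "(lzero U, x) \<in> N" using x
    proof
      assume "x \<in> Xset"
      then obtain i j a where "x = X i j a" "distinct2 i j" unfolding Xset_def by blast
      moreover obtain k where d: "distinct3 i j k" using distinct2_third calculation(2) by blast
      note D = distinct3D[OF d]
      have "(\<psi> (X i k a) (X k j 1), lbr L (X i k a) (X k j 1)) \<in> N" by (rule br) (use D in simp_all)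
      ultimately show ?thesis using D psi_other[of i k k j a 1] by (simp add: br1)
    next
      assume "x \<in> Hset"
      then obtain i j a b where x: "x = hh i j a b" "distinct2 i j" unfolding Hset_def by blast
      have "(\<psi> (X i j a) (X j i b), hh i j a b) \<in> N" by (rule br) (use x distinct2_sym in simp_all)
      moreover have "\<psi> (X i j a) (X j i b) = lzero U"
        by (rule psi_other[OF x(2) distinct2_sym[OF x(2)]]) auto
      ultimately show ?thesis using x by simp
    qed
    ultimately show "x \<in> {x \<in> carr L. (lzero U, x) \<in> N}" by simp
  qed
  then have *: "carr L \<subseteq> {x \<in> carr L. (lzero U, x) \<in> N}"
    by (rule spansD[OF spans_L submodule_vimage[OF kmod_L K iL N]])
  have uv: "(uvec sR m a, lzero L) \<in> N" if "m \<in> Uidx" for m a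
  proof -
    have row: "(uvec sR (int i) a, lzero L) \<in> N" if d: "distinct3 i j k" and "j < k" for i j k
    proof -
      note D = distinct3D[OF d]
      have "(\<psi> (X i j a) (X i k 1), lbr L (X i j a) (X i k 1)) \<in> N" by (rule br) (use D in simp_all)
      then show ?thesis
        using D d \<open>j < k\<close> by (simp add: br0 psi_row[OF d] sgn2_smul uvec_closed uvec_index distinct3_def)
    qed
    have col: "(uvec sR (- int j) a, lzero L) \<in> N" if d: "distinct3 i j k" and "i < k" for i j k
    proof -
      note D = distinct3D[OF d]
      have "(\<psi> (X i j a) (X k j 1), lbr L (X i j a) (X k j 1)) \<in> N" by (rule br) (use D in simp_all)
      then show ?thesis
        using D d \<open>i < k\<close> by (simp add: br0 psi_col[OF d] sgn2_smul uvec_closed uvec_index distinct3_def)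
    qed
    have "distinct3 1 2 3" "distinct3 2 1 3" "distinct3 3 1 2" "distinct3 1 3 2"
      by (simp_all add: distinct3_iff)
    then show ?thesis
      using that row[of 1 2 3] row[of 2 1 3] row[of 3 1 2] col[of 2 1 3] col[of 1 2 3] col[of 1 3 2]
      unfolding Uidx_def by auto
  qed
  have "carr U \<subseteq> {u \<in> carr U. (u, lzero L) \<in> N}"
    by (rule spansD[OF spans_U submodule_vimage[OF kmod_U K iU N]]) (use uv uvec_closed in auto)
  with * show "carr E \<subseteq> N"
  proof (intro subsetI)
    fix w assume "w \<in> carr E"
    then obtain u x where w: "w = (u, x)" "u \<in> carr U" "x \<in> carr L" by (auto simp: hat_eq_cext)
    then have "(u, lzero L) \<in> N" "(lzero U, x) \<in> N"
      using * \<open>carr U \<subseteq> {u \<in> carr U. (u, lzero L) \<in> N}\<close> by blast+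
    then have "ladd E (u, lzero L) (lzero U, x) \<in> N" by (rule D(3))
    then show "w \<in> N" using w by (simp add: hat_eq_cext kmod_U kmod_L)
  qed
qed

end

subsection \<open>The Leibniz complex in low degrees\<close>

lemma kmod_restr:
  assumes "kmod M" "submodule M N"
  shows "kmod (restr M N)"
  using assms(1) submoduleD[OF assms(2)]
  unfolding kmod_def[of "restr M N"]
  by (simp add: restr_def kmod_ac kmod_smul_add kmod_add_smul kmod_mult_smul)

lemma quot_iso:
  assumes M: "kmod M" and P: "kmod P" and f: "linmap M P f" and surj: "f ` carr M = carr P"
    and N: "N = {x \<in> carr M. f x = lzero P}"
  shows "\<exists>g. kmod_iso (quot M N) P g"
proof -
  have sub: "submodule M N" unfolding N by (rule submodule_kernel[OF M P f])
  obtain g where g: "linmap (quot M N) P g" "\<And>x. x \<in> carr M \<Longrightarrow> g (lcoset M N x) = f x"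
    by (rule quot_lift[OF M sub P f]) (auto simp: N)
  have "inj_on g (carr (quot M N))"
    unfolding quot_carr
  proof (rule inj_onI; elim imageE; simp only: g(2))
    fix x y assume xy: "x \<in> carr M" "y \<in> carr M" and "f x = f y"
    then have "f (lsub M x y) = lzero P"
      using P linmap_closed[OF f] by (simp add: linmap_sub[OF M P f])
    then show "lcoset M N x = lcoset M N y"
      using xy M by (intro lcoset_eqI[OF M sub]) (auto simp: N)
  qed
  moreover have "g ` carr (quot M N) = carr P"
    unfolding quot_carr image_image using g(2) surj by (simp cong: image_cong)
  ultimately show ?thesis using g(1) unfolding kmod_iso_def bij_betw_def by blast
qed

context
  fixes L :: "('k::comm_ring_1, 'a) lalg"
  assumes leib: "leibniz L"
begin

abbreviation "TT \<equiv> tensor L L"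

private lemmas K = leibniz_kmod[OF leib]
private lemmas KT = kmod_tensor[OF leibniz_kmod[OF leib] leibniz_kmod[OF leib]]
private lemmas B = bilin_closed[OF leibniz_bilin[OF leib]]
private lemmas BT = bilin_tmul[OF leibniz_kmod[OF leib] leibniz_kmod[OF leib]]

lemma leib_d2: "linmap TT L (leib_d2 L)"
    "x \<in> carr L \<Longrightarrow> y \<in> carr L \<Longrightarrow> leib_d2 L (tmul L L x y) = lneg L (lbr L x y)"
proof -
  have "\<exists>f. linmap TT L f \<and> (\<forall>x\<in>carr L. \<forall>y\<in>carr L. f (tmul L L x y) = lneg L (lbr L x y))"
    by (rule tensor_lift[OF K K K bilin_neg[OF K leibniz_bilin[OF leib]]]) blast
  from someI_ex[OF this] show "linmap TT L (leib_d2 L)"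
    "x \<in> carr L \<Longrightarrow> y \<in> carr L \<Longrightarrow> leib_d2 L (tmul L L x y) = lneg L (lbr L x y)"
    unfolding leib_d2_def by blast+
qed

definition d3_pure :: "'a \<Rightarrow> 'a \<Rightarrow> 'a \<Rightarrow> ('a \<times> 'a \<Rightarrow> 'k) set" where
  "d3_pure x y z = ladd TT (ladd TT (lneg TT (tmul L L (lbr L x y) z)) (tmul L L (lbr L x z) y))
             (tmul L L x (lbr L y z))"

lemma d3_pure_bilin: "z \<in> carr L \<Longrightarrow> bilin L L TT (\<lambda>x y. d3_pure x y z)"
  and d3_pure_linmap: "x \<in> carr L \<Longrightarrow> y \<in> carr L \<Longrightarrow> linmap L TT (d3_pure x y)"
proof -
  note LB = leibniz_bilin[OF leib]
  have id: "linmap L L (\<lambda>x. x)" by (simp add: linmap_def)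
  show "bilin L L TT (\<lambda>x y. d3_pure x y z)" if z: "z \<in> carr L"
    unfolding d3_pure_def
    by (intro bilin_add[OF KT] bilin_neg[OF KT] linmap_bilin[OF LB bilin_linmap_left[OF BT z]]
        bilin_comp[OF BT bilin_linmap_left[OF LB z] id] bilin_comp[OF BT id bilin_linmap_left[OF LB z]])
  show "linmap L TT (d3_pure x y)" if "x \<in> carr L" "y \<in> carr L"
    unfolding d3_pure_def[abs_def] using that B
    by (intro linmap_add_map[OF KT] linmap_neg_map[OF KT] bilin_linmap_right[OF BT]
        linmap_comp[OF bilin_linmap_right[OF LB] bilin_linmap_left[OF BT]]
        linmap_comp[OF bilin_linmap_right[OF LB] bilin_linmap_right[OF BT]]) auto
qed

text \<open>\<open>tensor_lift\<close> takes two factors at a time. For fixed \<open>z\<close> it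
  gives \<open>D z\<close> on \<open>TT\<close>; linearity of \<open>D\<close> in \<open>z\<close>
  is checked on pure tensors, and a second lift gives the differential.\<close>

lemma leib_d3: "linmap (tensor TT L) TT (leib_d3 L)"
    "x \<in> carr L \<Longrightarrow> y \<in> carr L \<Longrightarrow> z \<in> carr L \<Longrightarrow> leib_d3 L (tmul TT L (tmul L L x y) z) = d3_pure x y z"
proof -
  have "\<exists>f. linmap TT TT f \<and> (\<forall>x\<in>carr L. \<forall>y\<in>carr L. f (tmul L L x y) = d3_pure x y z)" if "z \<in> carr L" for z
    by (rule tensor_lift[OF K K KT d3_pure_bilin[OF that]]) blast
  then obtain D where D: "\<And>z. z \<in> carr L \<Longrightarrow> linmap TT TT (D z)"
    "\<And>x y z. x \<in> carr L \<Longrightarrow> y \<in> carr L \<Longrightarrow> z \<in> carr L \<Longrightarrow> D z (tmul L L x y) = d3_pure x y z"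
    by metis
  note sp = spans_tensor[OF K K]
  have "bilin TT L TT (\<lambda>t z. D z t)"
    unfolding bilin_def
  proof (intro conjI ballI allI)
    fix t z assume t: "t \<in> carr TT" and z: "z \<in> carr L"
    show "D z t \<in> carr TT" by (rule linmap_closed[OF D(1)[OF z] t])
    show "D z (ladd TT t t') = ladd TT (D z t) (D z t')" if "t' \<in> carr TT" for t'
      by (rule linmap_add[OF D(1)[OF z] t that])
    show "D (ladd L z z') t = ladd TT (D z t) (D z' t)" if z': "z' \<in> carr L" for z'
    proof (rule spans_linmap_eq[OF KT KT _ _ sp _ t])
      show "linmap TT TT (D (ladd L z z'))" using z z' K by (simp add: D(1))
      show "linmap TT TT (\<lambda>t. ladd TT (D z t) (D z' t))"
        by (rule linmap_add_map[OF KT D(1)[OF z] D(1)[OF z']])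
      fix s assume "s \<in> {tmul L L m n | m n. m \<in> carr L \<and> n \<in> carr L}"
      then show "D (ladd L z z') s = ladd TT (D z s) (D z' s)"
        using z z' K by (auto simp: D(2) linmap_add[OF d3_pure_linmap])
    qed
    fix k
    show "D z (lsmul TT k t) = lsmul TT k (D z t)" by (rule linmap_smul[OF D(1)[OF z] t])
    show "D (lsmul L k z) t = lsmul TT k (D z t)"
    proof (rule spans_linmap_eq[OF KT KT _ _ sp _ t])
      show "linmap TT TT (D (lsmul L k z))" using z K by (simp add: D(1))
      show "linmap TT TT (\<lambda>t. lsmul TT k (D z t))"
        using D(1)[OF z] KT unfolding linmap_def
        by (simp add: kmod_smul_add mult.commute[of k] flip: kmod_mult_smul)
      fix s assume "s \<in> {tmul L L m n | m n. m \<in> carr L \<and> n \<in> carr L}"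
      then show "D (lsmul L k z) s = lsmul TT k (D z s)"
        using z K by (auto simp: D(2) linmap_smul[OF d3_pure_linmap])
    qed
  qed
  from tensor_lift[OF KT K KT this]
  obtain f where "linmap (tensor TT L) TT f"
    "\<And>t z. t \<in> carr TT \<Longrightarrow> z \<in> carr L \<Longrightarrow> f (tmul TT L t z) = D z t" by blast
  then have "linmap (tensor TT L) TT f \<and>
      (\<forall>x\<in>carr L. \<forall>y\<in>carr L. \<forall>z\<in>carr L. f (tmul TT L (tmul L L x y) z) = d3_pure x y z)"
    by (simp add: tmul_closed D(2))
  from someI[where P = "\<lambda>f. linmap (tensor TT L) TT f \<and>
      (\<forall>x\<in>carr L. \<forall>y\<in>carr L. \<forall>z\<in>carr L. f (tmul TT L (tmul L L x y) z) = d3_pure x y z)", OF this]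
  show "linmap (tensor TT L) TT (leib_d3 L)"
    "x \<in> carr L \<Longrightarrow> y \<in> carr L \<Longrightarrow> z \<in> carr L \<Longrightarrow> leib_d3 L (tmul TT L (tmul L L x y) z) = d3_pure x y z"
    unfolding leib_d3_def d3_pure_def by blast+
qed

lemma spans_tensor3:
  "spans (tensor TT L) {tmul TT L (tmul L L x y) z | x y z. x \<in> carr L \<and> y \<in> carr L \<and> z \<in> carr L}"
proof (rule spansI)
  show "{tmul TT L (tmul L L x y) z | x y z. x \<in> carr L \<and> y \<in> carr L \<and> z \<in> carr L} \<subseteq> carr (tensor TT L)"
    by (auto intro!: tmul_closed)
next
  fix N assume N: "submodule (tensor TT L) N"
    and S: "{tmul TT L (tmul L L x y) z | x y z. x \<in> carr L \<and> y \<in> carr L \<and> z \<in> carr L} \<subseteq> N"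
  have "tmul TT L t z \<in> N" if z: "z \<in> carr L" and "t \<in> carr TT" for t z
  proof -
    have "carr TT \<subseteq> {t \<in> carr TT. tmul TT L t z \<in> N}"
      by (rule spansD[OF spans_tensor[OF K K] submodule_vimage[OF KT kmod_tensor[OF KT K]
              bilin_linmap_left[OF bilin_tmul[OF KT K] z] N]])
         (use S z in \<open>auto intro!: tmul_closed\<close>)
    then show ?thesis using that(2) by blast
  qed
  then show "carr (tensor TT L) \<subseteq> N"
    by (intro spansD[OF spans_tensor[OF KT K] N]) blast
qed

text \<open>On pure tensors, \<open>f\<close> of a boundary is the defect of the cocycle identity
  for \<open>T\<close>.\<close>

lemma d3_kernel:
  assumes W: "kmod W" and f: "linmap TT W f" and T: "cocycle L W T"
    and fT: "\<And>x y. x \<in> carr L \<Longrightarrow> y \<in> carr L \<Longrightarrow> f (tmul L L x y) = T x y"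
    and t: "t \<in> carr (tensor TT L)"
  shows "f (leib_d3 L t) = lzero W"
proof -
  have K3: "kmod (tensor TT L)" by (rule kmod_tensor[OF KT K])
  have z: "linmap (tensor TT L) W (\<lambda>_. lzero W)" using W by (simp add: linmap_def)
  note Tc = bilin_closed[OF cocycle_bilin[OF T]]
  show ?thesis
  proof (rule spans_linmap_eq[OF K3 W linmap_comp[OF leib_d3(1) f] z spans_tensor3 _ t])
    fix s assume "s \<in> {tmul TT L (tmul L L x y) z | x y z. x \<in> carr L \<and> y \<in> carr L \<and> z \<in> carr L}"
    then obtain x y z where s: "s = tmul TT L (tmul L L x y) z" and xyz: "x \<in> carr L" "y \<in> carr L" "z \<in> carr L"
      by blast
    have "f (d3_pure x y z) = ladd W (ladd W (lneg W (T (lbr L x y) z)) (T (lbr L x z) y)) (T x (lbr L y z))"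
      unfolding d3_pure_def using xyz B KT
      by (simp add: tmul_closed linmap_add[OF f] linmap_neg[OF KT W f] fT)
    also have "\<dots> = lzero W"
      using xyz B W Tc by (simp add: cocycleD[OF T] lsub_def kmod_ac)
    finally show "f (leib_d3 L s) = lzero W" using xyz by (simp add: s leib_d3(2))
  qed
qed

abbreviation "B2 \<equiv> leib_d3 L ` carr (tensor TT L)"

lemma submodule_B2: "submodule TT B2"
  by (rule submodule_image[OF kmod_tensor[OF KT K] KT leib_d3(1) submodule_carr[OF kmod_tensor[OF KT K]]])

lemma kmod_B2: "kmod (quot TT B2)"
  by (rule kmod_quot[OF KT submodule_B2])

text \<open>The defect of the cocycle identity is the boundary of the pure tensor of
  \<open>x\<close>, \<open>y\<close>, \<open>z\<close>, which vanishes in the quotient.\<close>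

lemma cocycle_universal: "cocycle L (quot TT B2) (\<lambda>x y. lcoset TT B2 (tmul L L x y))"
  unfolding cocycle_def
proof (intro conjI ballI)
  note lin = linmap_lcoset[OF KT submodule_B2]
  show "bilin L L (quot TT B2) (\<lambda>x y. lcoset TT B2 (tmul L L x y))"
    by (rule linmap_bilin[OF BT lin])
  fix x y z assume xyz: "x \<in> carr L" "y \<in> carr L" "z \<in> carr L"
  let ?a = "tmul L L (lbr L x y) z" and ?b = "tmul L L (lbr L x z) y" and ?c = "tmul L L x (lbr L y z)"
  have c: "?a \<in> carr TT" "?b \<in> carr TT" "?c \<in> carr TT" using xyz B by (auto intro!: tmul_closed)
  have "lsub TT ?c (lsub TT ?a ?b) = d3_pure x y z"
    unfolding d3_pure_def using c KT by (simp add: lsub_def kmod_neg_add kmod_ac)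
  also have "\<dots> \<in> B2"
    using leib_d3(2)[OF xyz] xyz by (metis imageI tmul_closed)
  finally have "lcoset TT B2 ?c = lcoset TT B2 (lsub TT ?a ?b)"
    using c KT by (intro lcoset_eqI[OF KT submodule_B2]) simp_all
  then show "lcoset TT B2 ?c = lsub (quot TT B2) (lcoset TT B2 ?a) (lcoset TT B2 ?b)"
    using c by (simp add: linmap_sub[OF KT kmod_B2 lin])
qed

end

subsection \<open>The universal central extension and its kernel\<close>

lemma (in kalg) central_ext_E: "central_ext L E snd"
  unfolding central_ext_def
proof (intro conjI ballI impI)
  show "leibniz L" "leibniz E" by (rule leibniz_L leibniz_E)+
  show "lhom E L snd" by (auto simp: lhom_def linmap_def hat_eq_cext)
  show "snd ` carr E = carr L" using kmod_zero[OF kmod_U] by (auto simp: hat_eq_cext)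
  fix z x assume "z \<in> carr E" "snd z = lzero L" "x \<in> carr E"
  then show "lbr E z x = lzero E" "lbr E x z = lzero E"
    by (auto simp: hat_eq_cext bilin_zero_left[OF kmod_L kmod_U cocycle_bilin[OF cocycle_psi]]
        bilin_zero_right[OF kmod_L kmod_U cocycle_bilin[OF cocycle_psi]] br_zero)
next
  show "\<exists>s. linmap L E s \<and> (\<forall>x\<in>carr L. snd (s x) = x)"
    by (rule exI[of _ "\<lambda>x. (lzero U, x)"]) (simp add: linmap_def hat_eq_cext kmod_U)
qed

lemma (in kalg) br_E: "u \<in> carr E \<Longrightarrow> v \<in> carr E \<Longrightarrow> lbr E u v = (\<psi> (snd u) (snd v), lbr L (snd u) (snd v))"
  by (cases u; cases v) (simp add: hat_eq_cext)

lemma central_extD: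
  assumes "central_ext L' E' q"
  shows "leibniz L'" "leibniz E'" "lhom E' L' q"
    "z \<in> carr E' \<Longrightarrow> q z = lzero L' \<Longrightarrow> x \<in> carr E' \<Longrightarrow> lbr E' z x = lzero E'"
    "z \<in> carr E' \<Longrightarrow> q z = lzero L' \<Longrightarrow> x \<in> carr E' \<Longrightarrow> lbr E' x z = lzero E'"
    "\<exists>s. linmap L' E' s \<and> (\<forall>x\<in>carr L'. q (s x) = x)"
  using assms by (simp_all add: central_ext_def)

text \<open>Elements with the same image differ by a central element, so a bracket depends only on
  the images of its arguments.\<close>

lemma central_ext_br_cong:
  assumes ext: "central_ext L' E' q" and "x \<in> carr E'" "x' \<in> carr E'" "y \<in> carr E'" "y' \<in> carr E'"
    and "q x = q x'" "q y = q y'"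
  shows "lbr E' x y = lbr E' x' y'"
proof -
  note E' = central_extD(2)[OF ext] and L' = leibniz_kmod[OF central_extD(1)[OF ext]]
    and q = lhom_linmap[OF central_extD(3)[OF ext]]
  note K = leibniz_kmod[OF E'] and Bl = leibniz_bilin[OF E']
  have "q (lsub E' x x') = lzero L'" "q (lsub E' y y') = lzero L'"
    using assms(2-7) L' linmap_closed[OF q] by (simp_all add: linmap_sub[OF K L' q])
  then have "lbr E' (lsub E' x x') y = lzero E'" "lbr E' x' (lsub E' y y') = lzero E'"
    using central_extD(4,5)[OF ext] assms(2-5) K by simp_all
  then have "lbr E' x y = lbr E' x' y" "lbr E' x' y = lbr E' x' y'"
    using assms(2-5) K bilin_closed[OF Bl]
    by (simp_all add: bilin_sub_left[OF K K Bl] bilin_sub_right[OF K K Bl] kmod_sub_eq_0)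
  then show ?thesis by simp
qed

theorem (in kalg) universal_E: "universal_central_ext TYPE('e) L E snd"
  unfolding universal_central_ext_def
proof (intro conjI allI impI)
  show "central_ext L E snd" by (rule central_ext_E)
next
  fix E' :: "('k, 'e) lalg" and q
  assume ext: "central_ext L E' q"
  obtain s where s: "linmap L E' s" "\<And>x. x \<in> carr L \<Longrightarrow> q (s x) = x"
    using central_extD(6)[OF ext] by auto
  note E' = central_extD(2)[OF ext] and q = central_extD(3)[OF ext]
  note K = leibniz_kmod[OF E'] and Bl = leibniz_bilin[OF E'] and ql = lhom_linmap[OF q]
  note sc = linmap_closed[OF s(1)] and brc = bilin_closed[OF Bl]
  \<comment> \<open>The section need not preserve brackets, but \<open>s [y, z]\<close> and
    \<open>[s y, s z]\<close> have the same image and so act alike in brackets; this makes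
    \<open>[s x, s y]\<close> a cocycle.\<close>
  have sbr: "lbr E' x (s (lbr L y z)) = lbr E' x (lbr E' (s y) (s z))"
    "lbr E' (s (lbr L y z)) x = lbr E' (lbr E' (s y) (s z)) x"
    if "x \<in> carr E'" "y \<in> carr L" "z \<in> carr L" for x y z
    by (rule central_ext_br_cong[OF ext]; use that sc brc s(2) lhom_br[OF q] in simp)+
  have "cocycle L E' (\<lambda>x y. lbr E' (s x) (s y))"
    unfolding cocycle_def using bilin_comp[OF Bl s(1) s(1)] sc
    by (simp add: sbr cocycleD[OF leibniz_cocycle[OF E']])
  then obtain \<eta> where \<eta>: "linmap E E' \<eta>"
    "\<And>x y. x \<in> carr L \<Longrightarrow> y \<in> carr L \<Longrightarrow> \<eta> (\<psi> x y, lbr L x y) = lbr E' (s x) (s y)"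
    using cocycle_factorization[OF K] by blast
  have sE: "snd u \<in> carr L" if "u \<in> carr E" for u using that by (auto simp: hat_eq_cext)
  have \<eta>br: "\<eta> (lbr E u v) = lbr E' (s (snd u)) (s (snd v))" if "u \<in> carr E" "v \<in> carr E" for u v
    using that by (simp add: br_E \<eta>(2) sE)
  have q\<eta>: "q (\<eta> u) = snd u" if "u \<in> carr E" for u
  proof (rule spans_linmap_eq[OF leibniz_kmod[OF leibniz_E] kmod_L linmap_comp[OF \<eta>(1) ql] _ spans_E _ that])
    show "linmap E L snd" by (auto simp: linmap_def hat_eq_cext)
    fix w assume "w \<in> {lbr E u v | u v. u \<in> carr E \<and> v \<in> carr E}"
    then obtain u v where w: "w = lbr E u v" and uv: "u \<in> carr E" "v \<in> carr E" by blast
    have "q (\<eta> w) = lbr L (snd u) (snd v)" using sE sc s(2) uv by (simp add: w \<eta>br lhom_br[OF q])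
    then show "q (\<eta> w) = snd w" by (simp add: w br_E[OF uv])
  qed
  have "lhom E E' \<eta>"
    unfolding lhom_def
  proof (intro conjI ballI \<eta>(1))
    fix u v assume uv: "u \<in> carr E" "v \<in> carr E"
    \<comment> \<open>\<open>\<eta> u\<close> and \<open>s (snd u)\<close> have the same image under
      \<open>q\<close>, and likewise for \<open>v\<close>, so the brackets agree.\<close>
    show "\<eta> (lbr E u v) = lbr E' (\<eta> u) (\<eta> v)"
      unfolding \<eta>br[OF uv]
      by (rule central_ext_br_cong[OF ext]) (use uv sE sc s(2) linmap_closed[OF \<eta>(1)] q\<eta> in simp_all)
  qed
  then show "\<exists>\<eta>. lhom E E' \<eta> \<and> (\<forall>x\<in>carr E. q (\<eta> x) = snd x)" using q\<eta> by blast
  fix \<eta>1 \<eta>2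
  assume *: "lhom E E' \<eta>1 \<and> (\<forall>x\<in>carr E. q (\<eta>1 x) = snd x) \<and> lhom E E' \<eta>2 \<and> (\<forall>x\<in>carr E. q (\<eta>2 x) = snd x)"
  then have l: "linmap E E' \<eta>1" "linmap E E' \<eta>2" by (simp_all add: lhom_def)
  show "\<forall>x\<in>carr E. \<eta>1 x = \<eta>2 x"
  proof
    fix x assume x: "x \<in> carr E"
    show "\<eta>1 x = \<eta>2 x"
    proof (rule spans_linmap_eq[OF leibniz_kmod[OF leibniz_E] K l spans_E _ x])
      fix w assume "w \<in> {lbr E u v | u v. u \<in> carr E \<and> v \<in> carr E}"
      then obtain u v where w: "w = lbr E u v" "u \<in> carr E" "v \<in> carr E" by blast
      have "lbr E' (\<eta>1 u) (\<eta>1 v) = lbr E' (\<eta>2 u) (\<eta>2 v)"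
        by (rule central_ext_br_cong[OF ext]) (use w * linmap_closed[OF l(1)] linmap_closed[OF l(2)] in simp_all)
      then show "\<eta>1 w = \<eta>2 w" using w * by (simp add: lhom_br[of E E'])
    qed
  qed
qed

theorem (in kalg) HL2_iso: "\<exists>f. kmod_iso (HL2 L) U f"
proof -
  note KT = kmod_tensor[OF kmod_L kmod_L] and KE = leibniz_kmod[OF leibniz_E]
  let ?T = "tensor L L" and ?B = "leib_d3 L ` carr (tensor (tensor L L) L)"
  define Z where "Z = {t \<in> carr ?T. leib_d2 L t = lzero L}"
  have Z: "submodule ?T Z"
    unfolding Z_def by (rule submodule_kernel[OF KT kmod_L leib_d2(1)[OF leibniz_L]])
  have cPsi: "cocycle L E (\<lambda>x y. (\<psi> x y, lbr L x y))"
    using cocycle_psi leibniz_cocycle[OF leibniz_L]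
    by (auto simp: cocycle_def bilin_def hat_eq_cext)
  obtain \<Psi> where \<Psi>: "linmap ?T E \<Psi>"
    "\<And>x y. x \<in> carr L \<Longrightarrow> y \<in> carr L \<Longrightarrow> \<Psi> (tmul L L x y) = (\<psi> x y, lbr L x y)"
    using tensor_lift[OF kmod_L kmod_L KE cocycle_bilin[OF cPsi]] by blast
  note Q = kmod_B2[OF leibniz_L] and linQ = linmap_lcoset[OF KT submodule_B2[OF leibniz_L]]
  obtain \<eta> where \<eta>: "linmap E (quot ?T ?B) \<eta>"
    "\<And>x y. x \<in> carr L \<Longrightarrow> y \<in> carr L \<Longrightarrow> \<eta> (\<psi> x y, lbr L x y) = lcoset ?T ?B (tmul L L x y)"
    using cocycle_factorization[OF Q cocycle_universal[OF leibniz_L]] by blast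
  \<comment> \<open>So \<open>\<eta>\<close> is a left inverse of the map that \<open>\<Psi>\<close>
    induces on \<open>?T\<close> modulo \<open>?B\<close>, and the kernel of \<open>\<Psi>\<close>
    is exactly the set of boundaries.\<close>
  have \<eta>\<Psi>: "\<eta> (\<Psi> t) = lcoset ?T ?B t" if "t \<in> carr ?T" for t
    by (rule spans_linmap_eq[OF KT Q linmap_comp[OF \<Psi>(1) \<eta>(1)] linQ spans_tensor[OF kmod_L kmod_L] _ that])
       (auto simp: \<Psi>(2) \<eta>(2))
  have Bc: "?B \<subseteq> carr ?T" using submoduleD(1)[OF submodule_B2[OF leibniz_L]] .
  have ker: "t \<in> ?B \<longleftrightarrow> \<Psi> t = lzero E" if t: "t \<in> carr ?T" for t
  proof
    assume "t \<in> ?B"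
    then show "\<Psi> t = lzero E" using d3_kernel[OF leibniz_L KE \<Psi>(1) cPsi \<Psi>(2)] by blast
  next
    assume "\<Psi> t = lzero E"
    then have "lcoset ?T ?B t = lcoset ?T ?B (lzero ?T)"
      using \<eta>\<Psi>[OF t] linmap_zero[OF KE Q \<eta>(1)] by (simp add: quot_zero)
    then show "t \<in> ?B"
      using t KT by (simp add: lcoset_eq_iff[OF KT submodule_B2[OF leibniz_L]] lsub_def)
  qed
  \<comment> \<open>Through \<open>\<Psi>\<close> the differential becomes minus the projection to
    \<open>L\<close>, so the cycles are the elements that \<open>\<Psi>\<close> sends into the copy
    of \<open>U\<close>.\<close>
  have d2: "leib_d2 L t = lneg L (snd (\<Psi> t))" if "t \<in> carr ?T" for t
  proof (rule spans_linmap_eq[OF KT kmod_L leib_d2(1)[OF leibniz_L] _ spans_tensor[OF kmod_L kmod_L] _ that])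
    have "linmap E L snd" by (auto simp: linmap_def hat_eq_cext)
    then show "linmap ?T L (\<lambda>t. lneg L (snd (\<Psi> t)))"
      by (intro linmap_neg_map[OF kmod_L] linmap_comp[OF \<Psi>(1)])
  qed (auto simp: leib_d2(2)[OF leibniz_L] \<Psi>(2))
  have \<Psi>c: "\<Psi> t \<in> carr U \<times> carr L" if "t \<in> carr ?T" for t
    using linmap_closed[OF \<Psi>(1) that] by (simp add: hat_eq_cext)
  have Z_iff: "t \<in> Z \<longleftrightarrow> snd (\<Psi> t) = lzero L" if "t \<in> carr ?T" for t
  proof -
    have c: "snd (\<Psi> t) \<in> carr L" using \<Psi>c[OF that] by auto
    have "lneg L (snd (\<Psi> t)) = lzero L \<longleftrightarrow> snd (\<Psi> t) = lzero L"
      using kmod_neg_neg[OF kmod_L c] kmod_neg_zero[OF kmod_L] by metis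
    then show ?thesis unfolding Z_def using that d2[OF that] by simp
  qed
  have surj: "\<Psi> ` carr ?T = carr E"
  proof
    show "\<Psi> ` carr ?T \<subseteq> carr E" using linmap_closed[OF \<Psi>(1)] by blast
    show "carr E \<subseteq> \<Psi> ` carr ?T"
    proof (rule spansD[OF spans_E submodule_image[OF KT KE \<Psi>(1) submodule_carr[OF KT]]])
      show "{lbr E u v | u v. u \<in> carr E \<and> v \<in> carr E} \<subseteq> \<Psi> ` carr ?T"
      proof
        fix w assume "w \<in> {lbr E u v | u v. u \<in> carr E \<and> v \<in> carr E}"
        then obtain u v where w: "w = lbr E u v" and uv: "u \<in> carr E" "v \<in> carr E" by blast
        then have "snd u \<in> carr L" "snd v \<in> carr L" by (auto simp: hat_eq_cext)
        then have "w = \<Psi> (tmul L L (snd u) (snd v))" using uv by (simp add: w br_E \<Psi>(2))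
        moreover have "tmul L L (snd u) (snd v) \<in> carr ?T"
          using \<open>snd u \<in> carr L\<close> \<open>snd v \<in> carr L\<close> by (rule tmul_closed)
        ultimately show "w \<in> \<Psi> ` carr ?T" by (rule image_eqI)
      qed
    qed
  qed
  \<comment> \<open>On cycles only the first component of \<open>\<Psi>\<close> can be nonzero; it
    maps onto \<open>U\<close>, and its kernel is the set of boundaries.\<close>
  have "\<exists>g. kmod_iso (quot (restr ?T Z) ?B) U g"
  proof (rule quot_iso[where f = "\<lambda>t. fst (\<Psi> t)"])
    show "kmod (restr ?T Z)" by (rule kmod_restr[OF KT Z])
    show "kmod U" by (rule kmod_U)
    have id: "linmap (restr ?T Z) ?T (\<lambda>t. t)"
      using submoduleD(6)[OF Z] by (simp add: linmap_def restr_def)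
    have "linmap E U fst" by (auto simp: linmap_def hat_eq_cext)
    then show "linmap (restr ?T Z) U (\<lambda>t. fst (\<Psi> t))"
      by (rule linmap_comp[OF linmap_comp[OF id \<Psi>(1)]])
    show "(\<lambda>t. fst (\<Psi> t)) ` carr (restr ?T Z) = carr U"
    proof
      show "(\<lambda>t. fst (\<Psi> t)) ` carr (restr ?T Z) \<subseteq> carr U"
        using \<Psi>c submoduleD(6)[OF Z] by (fastforce simp: restr_def)
      show "carr U \<subseteq> (\<lambda>t. fst (\<Psi> t)) ` carr (restr ?T Z)"
      proof
        fix u assume "u \<in> carr U"
        then have "(u, lzero L) \<in> \<Psi> ` carr ?T" unfolding surj using kmod_L by (simp add: hat_eq_cext)
        then obtain t where "t \<in> carr ?T" "\<Psi> t = (u, lzero L)" by auto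
        then show "u \<in> (\<lambda>t. fst (\<Psi> t)) ` carr (restr ?T Z)"
          using Z_iff by (auto simp: restr_def intro!: image_eqI[of _ _ t])
      qed
    qed
    show "?B = {t \<in> carr (restr ?T Z). fst (\<Psi> t) = lzero U}"
    proof (rule equalityI; rule subsetI)
      fix t assume t: "t \<in> ?B"
      then have "t \<in> carr ?T" using Bc by blast
      then show "t \<in> {t \<in> carr (restr ?T Z). fst (\<Psi> t) = lzero U}"
        using t ker Z_iff by (simp add: restr_def hat_eq_cext)
    next
      fix t assume "t \<in> {t \<in> carr (restr ?T Z). fst (\<Psi> t) = lzero U}"
      then have t: "t \<in> Z" "fst (\<Psi> t) = lzero U" by (auto simp: restr_def)
      then have "t \<in> carr ?T" using submoduleD(6)[OF Z] by blast
      then show "t \<in> ?B" using t ker Z_iff by (cases "\<Psi> t") (simp add: hat_eq_cext)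
    qed
  qed
  then show ?thesis by (simp add: HL2_def Z_def)
qed

theorem theorem4p4:
  fixes sR :: "'k::comm_ring_1 \<Rightarrow> 'r::ring_1 \<Rightarrow> 'r"
  assumes "kalgebra sR"
    and "free_unit_basis sR"
  shows "universal_central_ext TYPE('e) (stl3 sR) (hat_stl3 sR) snd \<and>
         (\<exists>f. kmod_iso (HL2 (stl3 sR)) (Umod sR) f)"
proof -
  interpret kalg sR by unfold_locales (rule assms(1))
  show ?thesis using universal_E HL2_iso by blast
qed

end
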